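(* Let $R$ be an order in a number field. Then the number of cusps of $R$, i.e. the cardinality of $\mathbb{P}^1(K(R))/\mathrm{SL}_2(R)$, equals $$\sum_{[I]\in \mathrm{Cl}(R),\ \mu(I)\le 2} \big[(R/\mathrm{Fitt}_1(I))^{\times} : \epsilon(I)\big],$$ where the sum is over the ideal classes of nonzero fractional ideals $I$ of $R$ that can be generated by at most two elements.
   Context: An order in a number field is a subring of finite index in its ring of integers; $K(R)$ is the field of fractions of $R$. A fractional ideal of $R$ is an $R$-submodule $I$ of $K(R)$ such that $dI\subseteq R$ for some regular $d\in R$. $\mu(I)$ is the minimal number of generators of $I$. Two fractional ideals $I,J$ are in the same ideal class if $rI=sJ$ for some regular (nonzero) $r,s\in R$; $\mathrm{Cl}(R)$ is the set of ideal classes. $\mathbb{P}^1(K(R))$ is the quotient of $K(R)\times K(R)\setminus\{(0,0)\}$ by the relation $v\sim w$ iff $rv=sw$ for some regular $r,s\in R$; $\mathrm{SL}_2(R)$ acts on it from the right by matrix multiplication on row vectors, $[r:s]\begin{pmatrix} a&b\\c&d\end{pmatrix}=[ar+cs:br+ds]$, and the set of cusps of $R$ is the orbit set $\mathbb{P}^1(K(R))/\mathrm{SL}_2(R)$. Fitting ideals: if $F\xrightarrow{\varphi} G\to M\to 0$ is exact with $F,G$ free $R$-modules and $G$ of finite rank $g$, then $\mathrm{Fitt}_i(M)$ is the ideal generated by the $(g-i)\times(g-i)$ minors of a matrix of $\varphi$ (the ideal of $0\times 0$ minors being $R$). For $I$ generated by two elements, let $V_2(I)$ be the set of generating pairs of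 $I$; $\bigwedge^2 I$ is cyclic with annihilator $\mathrm{Fitt}_1(I)$, generated by $m_1\wedge m_2$ for any $\mathbf m=(m_1,m_2)\in V_2(I)$; for $\mathbf m'\in V_2(I)$ define $\det_{\mathbf m}(\mathbf m')\in (R/\mathrm{Fitt}_1(I))^\times$ by $m_1'\wedge m_2'=\det_{\mathbf m}(\mathbf m')\,(m_1\wedge m_2)$. The ring of multipliers is $\varrho(I)=\{x\in K(R): xI\subseteq I\}$. For $u\in\varrho(I)^\times$, $\det(u):=\det_{\mathbf m}(u\mathbf m)$, which does not depend on $\mathbf m\in V_2(I)$, and $\epsilon(I):=\{\det(u): u\in\varrho(I)^\times\}$, a subgroup of $(R/\mathrm{Fitt}_1(I))^\times$. *)

theory Defs
  imports
    "HOL-Library.Extended_Nat"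
    "HOL-Library.Poly_Mapping"
    "HOL-Algebra.Algebra"
    "Jordan_Normal_Form.Determinant"
begin

text \<open>
  The number field is the type \<open>'k\<close>, which is an arbitrary field of characteristic zero that is
  assumed to be finite-dimensional over the rationals. Subrings, fractional ideals etc. are subsets
  of \<open>'k\<close>.
\<close>

section \<open>Orders in number fields\<close>

definition number_field :: "'k::field_char_0 itself \<Rightarrow> bool" where
  "number_field _ \<longleftrightarrow>
     (\<exists>B :: 'k set. finite B \<and> module.span (\<lambda>q x. of_rat q * x) B = UNIV)"

definition ring_on :: "'k::field set \<Rightarrow> 'k ring" where
  "ring_on S = \<lparr>carrier = S, monoid.mult = (*), one = 1, ring.zero = 0, add = (+)\<rparr>"

definition ring_of_integers :: "'k::field set" where
  "ring_of_integers = {x. algebraic_int x}"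

definition order_in_number_field :: "'k::field_char_0 set \<Rightarrow> bool" where
  "order_in_number_field R \<longleftrightarrow>
     number_field TYPE('k) \<and>
     subring R (ring_on ring_of_integers) \<and>
     finite (a_rcosets\<^bsub>ring_on ring_of_integers\<^esub> R)"

definition fraction_field :: "'k::field set \<Rightarrow> 'k set" where
  "fraction_field R = {r / s | r s. r \<in> R \<and> s \<in> R - {0}}"

section \<open>Modules over a subring\<close>

text \<open>
  The ring of scalars \<open>R\<close> is a set and not a type, so the notions from the locale \<^locale>\<open>module\<close>
  are not applicable. The argument \<open>scale\<close> is the scalar multiplication.
\<close>

definition is_submodule ::
  "'k::field set \<Rightarrow> ('k \<Rightarrow> 'm::ab_group_add \<Rightarrow> 'm) \<Rightarrow> 'm set \<Rightarrow> bool" where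
  "is_submodule R scale M \<longleftrightarrow>
     0 \<in> M \<and> (\<forall>x\<in>M. \<forall>y\<in>M. x + y \<in> M) \<and> (\<forall>r\<in>R. \<forall>x\<in>M. scale r x \<in> M)"

definition generated ::
  "'k::field set \<Rightarrow> ('k \<Rightarrow> 'm::ab_group_add \<Rightarrow> 'm) \<Rightarrow> 'm set \<Rightarrow> 'm set" where
  "generated R scale S = is_submodule R scale hull S"

definition free_module :: "'k::field set \<Rightarrow> 'x set \<Rightarrow> ('x \<Rightarrow>\<^sub>0 'k) set" where
  "free_module R B = {f. Poly_Mapping.keys f \<subseteq> B \<and> (\<forall>x. Poly_Mapping.lookup f x \<in> R)}"

definition pscale :: "'k::field \<Rightarrow> ('x \<Rightarrow>\<^sub>0 'k) \<Rightarrow> ('x \<Rightarrow>\<^sub>0 'k)" where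
  "pscale r f = Poly_Mapping.map ((*) r) f"

section \<open>Fractional ideals and ideal classes\<close>

definition fractional_ideal :: "'k::field set \<Rightarrow> 'k set \<Rightarrow> bool" where
  "fractional_ideal R I \<longleftrightarrow>
     I \<subseteq> fraction_field R \<and> is_submodule R (*) I \<and> (\<exists>d\<in>R - {0}. (*) d ` I \<subseteq> R)"

text \<open>The value is \<open>\<infinity>\<close> if \<open>I\<close> is not finitely generated.\<close>

definition min_generators :: "'k::field set \<Rightarrow> 'k set \<Rightarrow> enat" where
  "min_generators R I = (INF S \<in> {S. finite S \<and> generated R (*) S = I}. enat (card S))"

definition same_ideal_class :: "'k::field set \<Rightarrow> ('k set \<times> 'k set) set" where
  "same_ideal_class R = {(I, J). fractional_ideal R I \<and> fractional_ideal R J \<and>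
     (\<exists>r\<in>R - {0}. \<exists>s\<in>R - {0}. (*) r ` I = (*) s ` J)}"

text \<open>This includes the class of the zero ideal.\<close>

definition ideal_classes :: "'k::field set \<Rightarrow> 'k set set set" where
  "ideal_classes R = {I. fractional_ideal R I} // same_ideal_class R"

section \<open>Fitting ideals\<close>

text \<open>
  A free presentation \<open>F \<rightarrow> G \<rightarrow> M \<rightarrow> 0\<close> of a submodule \<open>M\<close> of the number field: \<open>G\<close> is free with basis
  \<open>{..<g}\<close>, the \<open>i\<close>-th basis vector is mapped to \<open>m i\<close>, and \<open>\<Phi>\<close> is the set of images in \<open>G\<close> of the
  elements of a basis of \<open>F\<close>, i.e. the (possibly infinite) set of columns of the matrix of
  \<open>F \<rightarrow> G\<close>. Repeated columns do not affect the ideals of minors and may be disregarded.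
\<close>

definition free_presentation ::
  "'k::field set \<Rightarrow> nat \<Rightarrow> (nat \<Rightarrow> 'k) \<Rightarrow> (nat \<Rightarrow>\<^sub>0 'k) set \<Rightarrow> 'k set \<Rightarrow> bool" where
  "free_presentation R g m \<Phi> M \<longleftrightarrow>
     generated R (*) (m ` {..<g}) = M \<and>
     generated R pscale \<Phi> =
       {f \<in> free_module R {..<g}. (\<Sum>i<g. Poly_Mapping.lookup f i * m i) = 0}"

definition minors :: "nat \<Rightarrow> (nat \<Rightarrow>\<^sub>0 'k::field) set \<Rightarrow> nat \<Rightarrow> 'k set" where
  "minors g \<Phi> k =
     {det (mat k k (\<lambda>(a, b). Poly_Mapping.lookup (col b) (row a))) | row col.
        row ` {..<k} \<subseteq> {..<g} \<and> strict_mono_on {..<k} row \<and>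
        col ` {..<k} \<subseteq> \<Phi> \<and> inj_on col {..<k}}"

text \<open>For \<open>i > g\<close> the truncated difference \<open>g - i\<close> yields the usual convention that the Fitting
  ideal is \<open>R\<close>.\<close>

definition fitting_ideal :: "'k::field set \<Rightarrow> nat \<Rightarrow> 'k set \<Rightarrow> 'k set" where
  "fitting_ideal R i M =
     (THE J. \<exists>g m \<Phi>. free_presentation R g m \<Phi> M \<and> J = generated R (*) (minors g \<Phi> (g - i)))"

section \<open>The exterior square\<close>

text \<open>
  The exterior square of \<open>I\<close> is the quotient of the free module on \<open>I \<times> I\<close> by the submodule
  \<open>ext_relations R I\<close>; its elements are the cosets \<open>ext_class R I f\<close>.
\<close>

definition ext_relations :: "'k::field set \<Rightarrow> 'k set \<Rightarrow> ('k \<times> 'k \<Rightarrow>\<^sub>0 'k) set" where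
  "ext_relations R I = (let e = (\<lambda>x y. Poly_Mapping.single (x, y) 1) in
     generated R pscale
      ({e (x + x') y - e x y - e x' y | x x' y. x \<in> I \<and> x' \<in> I \<and> y \<in> I} \<union>
       {e x (y + y') - e x y - e x y' | x y y'. x \<in> I \<and> y \<in> I \<and> y' \<in> I} \<union>
       {e (r * x) y - pscale r (e x y) | r x y. r \<in> R \<and> x \<in> I \<and> y \<in> I} \<union>
       {e x (r * y) - pscale r (e x y) | r x y. r \<in> R \<and> x \<in> I \<and> y \<in> I} \<union>
       {e x x | x. x \<in> I}))"

definition ext_class ::
  "'k::field set \<Rightarrow> 'k set \<Rightarrow> ('k \<times> 'k \<Rightarrow>\<^sub>0 'k) \<Rightarrow> ('k \<times> 'k \<Rightarrow>\<^sub>0 'k) set" where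
  "ext_class R I f = {h \<in> free_module R (I \<times> I). h - f \<in> ext_relations R I}"

section \<open>The determinant and the group of determinants of multipliers\<close>

definition generating_pairs :: "'k::field set \<Rightarrow> 'k set \<Rightarrow> ('k \<times> 'k) set" where
  "generating_pairs R I = {(m1, m2). generated R (*) {m1, m2} = I}"

definition fitting_units :: "'k::field set \<Rightarrow> 'k set \<Rightarrow> 'k set monoid" where
  "fitting_units R I = units_of (ring_on R Quot fitting_ideal R 1 I)"

text \<open>
  \<open>det_wrt R I m m'\<close> is the residue class \<open>c\<close> with \<open>m'\<^sub>1 \<and> m'\<^sub>2 = c (m\<^sub>1 \<and> m\<^sub>2)\<close>, where a residue class
  acts on the exterior square through any of its elements \<open>r\<close>.
\<close>

definition det_wrt :: "'k::field set \<Rightarrow> 'k set \<Rightarrow> 'k \<times> 'k \<Rightarrow> 'k \<times> 'k \<Rightarrow> 'k set" where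
  "det_wrt R I m m' =
     (THE c. c \<in> carrier (fitting_units R I) \<and>
        (\<exists>r\<in>c. ext_class R I (Poly_Mapping.single m' 1) =
                ext_class R I (pscale r (Poly_Mapping.single m 1))))"

definition multipliers :: "'k::field set \<Rightarrow> 'k set \<Rightarrow> 'k set" where
  "multipliers R I = {x \<in> fraction_field R. (*) x ` I \<subseteq> I}"

definition det_multiplier :: "'k::field set \<Rightarrow> 'k set \<Rightarrow> 'k \<Rightarrow> 'k set" where
  "det_multiplier R I u =
     (THE c. \<exists>(m1, m2)\<in>generating_pairs R I. c = det_wrt R I (m1, m2) (u * m1, u * m2))"

definition eps :: "'k::field set \<Rightarrow> 'k set \<Rightarrow> 'k set set" where
  "eps R I = det_multiplier R I ` Units (ring_on (multipliers R I))"

definition group_index :: "('a, 'b) monoid_scheme \<Rightarrow> 'a set \<Rightarrow> nat" where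
  "group_index G H = card (rcosets\<^bsub>G\<^esub> H)"

section \<open>Cusps\<close>

definition punctured_plane :: "'k::field set \<Rightarrow> ('k \<times> 'k) set" where
  "punctured_plane R = fraction_field R \<times> fraction_field R - {(0, 0)}"

definition proj_rel :: "'k::field set \<Rightarrow> (('k \<times> 'k) \<times> ('k \<times> 'k)) set" where
  "proj_rel R = {((v1, v2), (w1, w2)).
     (v1, v2) \<in> punctured_plane R \<and> (w1, w2) \<in> punctured_plane R \<and>
     (\<exists>r\<in>R - {0}. \<exists>s\<in>R - {0}. (r * v1, r * v2) = (s * w1, s * w2))}"

definition proj_line :: "'k::field set \<Rightarrow> ('k \<times> 'k) set set" where
  "proj_line R = punctured_plane R // proj_rel R"

definition SL2 :: "'k::field set \<Rightarrow> 'k mat set" where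
  "SL2 R = {A \<in> carrier_mat 2 2. (\<forall>i<2. \<forall>j<2. A $$ (i, j) \<in> R) \<and> det A = 1}"

definition row_mult :: "'k::field \<times> 'k \<Rightarrow> 'k mat \<Rightarrow> 'k \<times> 'k" where
  "row_mult v A = (case v of (r, s) \<Rightarrow>
     (A $$ (0, 0) * r + A $$ (1, 0) * s, A $$ (0, 1) * r + A $$ (1, 1) * s))"

text \<open>Points of the projective line are sets of vectors, and a matrix acts on them elementwise.\<close>

definition cusp_rel :: "'k::field set \<Rightarrow> (('k \<times> 'k) set \<times> ('k \<times> 'k) set) set" where
  "cusp_rel R = {(p, q). p \<in> proj_line R \<and> q \<in> proj_line R \<and>
     (\<exists>A\<in>SL2 R. q = (\<lambda>v. row_mult v A) ` p)}"

definition cusps :: "'k::field set \<Rightarrow> ('k \<times> 'k) set set set" where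
  "cusps R = proj_line R // cusp_rel R"

end

theory Submission
  imports Defs
begin

text \<open>
  A point \<open>[v\<^sub>1 : v\<^sub>2]\<close> is mapped to the class of the ideal \<open>I = R v\<^sub>1 + R v\<^sub>2\<close>. Up to scaling, the points
  over the class of \<open>I\<close> are the generating pairs of \<open>I\<close> modulo the units of the multiplier ring, so
  the claim amounts to a bijection between the \<open>SL\<^sub>2\<close>-orbits of generating pairs and the units modulo
  \<open>Fitt\<^sub>1(I)\<close>, given by the determinant of a transition matrix. Here \<open>Fitt\<^sub>1(I) = (R : I) I\<close>, because
  the relations of \<open>(v\<^sub>1, v\<^sub>2)\<close> are the multiples of \<open>(- v\<^sub>2, v\<^sub>1)\<close> by elements of \<open>(R : I)\<close>. Adding such
  relations to the columns of a transition matrix changes its determinant by an arbitrary element of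
  \<open>Fitt\<^sub>1(I)\<close>, whence injectivity. Surjectivity holds because \<open>I / R v\<^sub>2\<close> is cyclic with a finite
  quotient ring \<open>R / A\<close> acting on it, and units lift along quotients of finite rings. Finally, the
  number of ideal classes is finite by a pigeonhole argument with the norm.
\<close>

section \<open>Modules over a subring\<close>

text \<open>The entries of a generating pair satisfy relations, so a transition matrix between two
  pairs, and with it its determinant, is not unique. \<open>Fitt_1(I)\<close> is exactly this
  indeterminacy: other choices of coordinates alter a determinant by elements of it, and every
  element of it arises in this way. This is why a determinant that is 1 modulo
  \<open>Fitt_1(I)\<close> can be improved to the determinant 1 that \<open>SL_2\<close> demands. If
  \<open>I\<close> is invertible, then \<open>(R : I) I = R\<close> and the class of
  \<open>I\<close> carries a single cusp; larger terms can only come from ideals that are not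
  invertible.

  \<open>fitting_ideal\<close>, \<open>det_wrt\<close> and \<open>det_multiplier\<close> are
  definite descriptions, so each evaluation includes a proof of well-definedness. For the Fitting
  ideal this means comparing presentations with different numbers of generators and possibly
  infinitely many relations. Finiteness has to accompany the counting, since infinite sets have
  cardinality 0 and sums over them are 0. It comes from the norm: an order has no nonzero elements
  with very small coordinates, because nonzero integers are at least 1 in absolute value.\<close>

lemma generated_superset: "S \<subseteq> generated R scale S"
  unfolding generated_def by (rule hull_subset)

lemma generated_minimal: "S \<subseteq> M \<Longrightarrow> is_submodule R scale M \<Longrightarrow> generated R scale S \<subseteq> M"
  unfolding generated_def by (rule hull_minimal)

lemma is_submodule_generated: "is_submodule R scale (generated R scale S)"
  unfolding generated_def by (rule hull_in) (auto simp: is_submodule_def)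

lemma generated_submodule: "is_submodule R scale M \<Longrightarrow> generated R scale M = M"
  unfolding generated_def by (rule hull_same)

lemma submodule_zero: "is_submodule R scale M \<Longrightarrow> 0 \<in> M"
  and submodule_add: "is_submodule R scale M \<Longrightarrow> x \<in> M \<Longrightarrow> y \<in> M \<Longrightarrow> x + y \<in> M"
  and submodule_scale: "is_submodule R scale M \<Longrightarrow> r \<in> R \<Longrightarrow> x \<in> M \<Longrightarrow> scale r x \<in> M"
  by (auto simp: is_submodule_def)

lemma submodule_sum:
  assumes "is_submodule R scale M" "\<And>i. i \<in> A \<Longrightarrow> f i \<in> M"
  shows "sum f A \<in> M"
  using assms(2) by (induction A rule: infinite_finite_induct)
    (auto intro: submodule_zero[OF assms(1)] submodule_add[OF assms(1)])

lemma lookup_pscale [simp]: "Poly_Mapping.lookup (pscale r f) x = r * Poly_Mapping.lookup f x"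
  by (simp add: pscale_def Poly_Mapping.map.rep_eq when_def)

section \<open>Subrings of a field and modules over them\<close>

locale field_subring =
  fixes R :: "'k::field set"
  assumes one_mem [simp, intro]: "1 \<in> R"
    and diff_mem [intro]: "x \<in> R \<Longrightarrow> y \<in> R \<Longrightarrow> x - y \<in> R"
    and mult_mem [intro]: "x \<in> R \<Longrightarrow> y \<in> R \<Longrightarrow> x * y \<in> R"
begin

lemma zero_mem [simp, intro]: "0 \<in> R"
  using diff_mem[OF one_mem one_mem] by simp

lemma uminus_mem [intro]: "x \<in> R \<Longrightarrow> - x \<in> R"
  using diff_mem[of 0 x] by simp

lemma add_mem [intro]: "x \<in> R \<Longrightarrow> y \<in> R \<Longrightarrow> x + y \<in> R"
  using diff_mem[of x "- y"] uminus_mem[of y] by simp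

lemma sum_mem: "(\<And>i. i \<in> A \<Longrightarrow> f i \<in> R) \<Longrightarrow> sum f A \<in> R"
  by (induction A rule: infinite_finite_induct) auto

lemma prod_mem: "(\<And>i. i \<in> A \<Longrightarrow> f i \<in> R) \<Longrightarrow> prod f A \<in> R"
  by (induction A rule: infinite_finite_induct) auto

lemma power_mem [intro]: "x \<in> R \<Longrightarrow> x ^ n \<in> R"
  by (induction n) auto

lemma of_nat_mem [simp, intro]: "of_nat n \<in> R"
  by (induction n) auto

lemma of_int_mem [simp, intro]: "of_int n \<in> R"
  by (cases n) auto

lemma is_submodule_self: "is_submodule R (*) R"
  by (auto simp: is_submodule_def)

lemma det_mem:
  assumes "A \<in> carrier_mat n n" "\<And>i j. i < n \<Longrightarrow> j < n \<Longrightarrow> A $$ (i, j) \<in> R"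
  shows "det A \<in> R"
  unfolding det_def'[OF assms(1)]
proof (rule sum_mem, rule mult_mem)
  fix p assume p: "p \<in> {p. p permutes {0..<n}}"
  show "signof p \<in> R" by (simp add: sign_def uminus_mem)
  show "(\<Prod>i = 0..<n. A $$ (i, p i)) \<in> R"
    by (rule prod_mem) (use p assms(2) in \<open>auto simp: permutes_in_image\<close>)
qed

lemma submodule_uminus:
  assumes "is_submodule R (*) M" "x \<in> M"
  shows "- x \<in> M"
  using submodule_scale[OF assms(1) uminus_mem[OF one_mem] assms(2)] by simp

lemma submodule_diff:
  assumes "is_submodule R (*) M" "x \<in> M" "y \<in> M"
  shows "x - y \<in> M"
  using submodule_add[OF assms(1,2) submodule_uminus[OF assms(1,3)]] by simp

lemma generated_image:
  "generated R (*) (m ` {..<g::nat}) = {\<Sum>i<g. r i * m i | r. \<forall>i<g. r i \<in> R}" (is "_ = ?S")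
proof
  show "generated R (*) (m ` {..<g}) \<subseteq> ?S"
  proof (rule generated_minimal)
    show "m ` {..<g} \<subseteq> ?S"
    proof safe
      fix j assume "j < g"
      then show "\<exists>r. m j = (\<Sum>i<g. r i * m i) \<and> (\<forall>i<g. r i \<in> R)"
        by (intro exI[of _ "\<lambda>i. if i = j then 1 else 0"])
          (auto simp: if_distrib[of "\<lambda>x. x * _"] cong: if_cong)
    qed
    show "is_submodule R (*) ?S"
      unfolding is_submodule_def
    proof (safe, goal_cases)
      case 1 then show ?case by (intro exI[of _ "\<lambda>_. 0"]) auto
    next
      case (2 _ _ r s) then show ?case
        by (intro exI[of _ "\<lambda>i. r i + s i"]) (auto simp: distrib_right sum.distrib)
    next
      case (3 c _ r) then show ?case
        by (intro exI[of _ "\<lambda>i. c * r i"]) (auto simp: sum_distrib_left mult.assoc)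
    qed
  qed
  show "?S \<subseteq> generated R (*) (m ` {..<g})"
  proof safe
    fix r :: "nat \<Rightarrow> 'k" assume r: "\<forall>i<g. r i \<in> R"
    have "m i \<in> generated R (*) (m ` {..<g})" if "i < g" for i
      using that generated_superset[of "m ` {..<g}" R "(*)"] by auto
    then show "(\<Sum>i<g. r i * m i) \<in> generated R (*) (m ` {..<g})"
      using r by (intro submodule_sum[OF is_submodule_generated] submodule_scale[OF is_submodule_generated]) auto
  qed
qed

lemma generated_pair: "generated R (*) {a, b} = {r * a + s * b | r s. r \<in> R \<and> s \<in> R}"
proof -
  have "{a, b} = (\<lambda>i. if i = 0 then a else b) ` {..<2::nat}"
    by (auto simp: numeral_2_eq_2 lessThan_Suc)
  then show ?thesis
    by (simp only: generated_image)
      (auto simp: numeral_2_eq_2 lessThan_Suc add.commute,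
        rule exI[of _ "case_nat _ (\<lambda>_. _)"], auto split: nat.splits)
qed

section \<open>Independence of the first Fitting ideal from the presentation\<close>

definition relations :: "nat \<Rightarrow> (nat \<Rightarrow> 'k) \<Rightarrow> (nat \<Rightarrow>\<^sub>0 'k) set" where
  "relations g m =
     {f \<in> free_module R {..<g}. (\<Sum>i<g. Poly_Mapping.lookup f i * m i) = 0}"

text \<open>Bordering a matrix of \<open>g - 1\<close> relations by an arbitrary column turns the \<open>(g - 1)\<close>-minors
  into \<open>g \<times> g\<close> determinants, for which a change of generators is a matrix multiplication.\<close>

definition relation_dets :: "nat \<Rightarrow> (nat \<Rightarrow> 'k) \<Rightarrow> 'k set" where
  "relation_dets g m = {det A | A. A \<in> carrier_mat g g \<and>
     (\<forall>i<g. \<forall>j<g. A $$ (i, j) \<in> R) \<and> (\<forall>j. 0 < j \<and> j < g \<longrightarrow> (\<Sum>i<g. m i * A $$ (i, j)) = 0)}"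

text \<open>Laplace expansion along the top \<open>d\<close> rows, one at a time. Deleting column
  \<open>j\<close> keeps the relation condition: every column of the minor except its first is an
  old column of positive index, also when \<open>j = 0\<close>.\<close>

lemma relation_dets_padded:
  assumes "W \<in> carrier_mat (d + h) (d + h)"
    and "\<And>i j. i < d + h \<Longrightarrow> j < d + h \<Longrightarrow> W $$ (i, j) \<in> R"
    and "\<And>j. 0 < j \<Longrightarrow> j < d + h \<Longrightarrow> (\<Sum>i<h. m i * W $$ (d + i, j)) = 0"
  shows "det W \<in> generated R (*) (relation_dets h m)"
  using assms
proof (induction d arbitrary: W)
  case 0
  then show ?case
    by (intro subsetD[OF generated_superset]) (auto simp: relation_dets_def)
next
  case (Suc d)
  have "W $$ (0, j) * cofactor W 0 j \<in> generated R (*) (relation_dets h m)" if j: "j < Suc d + h" for j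
  proof -
    let ?D = "mat_delete W 0 j"
    have "det ?D \<in> generated R (*) (relation_dets h m)"
    proof (rule Suc.IH)
      show "?D \<in> carrier_mat (d + h) (d + h)"
        using Suc.prems(1) mat_delete_carrier[of W "Suc d + h" "Suc d + h" 0 j] by simp
      show "?D $$ (i, j') \<in> R" if "i < d + h" "j' < d + h" for i j'
        using Suc.prems that by (auto simp: mat_delete_def)
      show "(\<Sum>i<h. m i * ?D $$ (d + i, j')) = 0" if "0 < j'" "j' < d + h" for j'
      proof -
        have "(\<Sum>i<h. m i * ?D $$ (d + i, j')) =
          (\<Sum>i<h. m i * W $$ (Suc d + i, if j' < j then j' else Suc j'))"
          using Suc.prems(1) that by (intro sum.cong) (auto simp: mat_delete_def)
        also have "\<dots> = 0" using that by (intro Suc.prems(3)) auto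
        finally show ?thesis .
      qed
    qed
    moreover have "W $$ (0, j) * (- 1) ^ j \<in> R"
      using Suc.prems(2)[of 0 j] j by (intro mult_mem power_mem uminus_mem) auto
    ultimately show ?thesis
      unfolding cofactor_def using submodule_scale[OF is_submodule_generated]
      by (fastforce simp: mult.assoc[symmetric])
  qed
  then have "(\<Sum>j<Suc d + h. W $$ (0, j) * cofactor W 0 j) \<in> generated R (*) (relation_dets h m)"
    by (intro submodule_sum[OF is_submodule_generated]) auto
  then show ?case
    using laplace_expansion_row[OF Suc.prems(1), of 0] by simp
qed

text \<open>If \<open>m = m' B\<close> and \<open>m' = m C\<close>, then the product of the unimodular matrix with rows
  \<open>(1, 0)\<close>, \<open>(B, 1)\<close> and the matrix with rows \<open>(A, - C)\<close>, \<open>(0, 1)\<close> has determinant \<open>det A\<close>,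
  and the columns of its lower half are relations of \<open>m'\<close> except for the first one.\<close>

lemma relation_dets_subset:
  assumes "m ` {..<g} \<subseteq> generated R (*) (m' ` {..<h})"
    and "m' ` {..<h} \<subseteq> generated R (*) (m ` {..<g})"
  shows "relation_dets g m \<subseteq> generated R (*) (relation_dets h m')"
proof
  fix x assume "x \<in> relation_dets g m"
  then obtain A where x: "x = det A" and A: "A \<in> carrier_mat g g"
    and AR: "\<And>i j. i < g \<Longrightarrow> j < g \<Longrightarrow> A $$ (i, j) \<in> R"
    and A0: "\<And>j. 0 < j \<Longrightarrow> j < g \<Longrightarrow> (\<Sum>i<g. m i * A $$ (i, j)) = 0"
    by (auto simp: relation_dets_def)
  have "\<forall>l<g. \<exists>r. m l = (\<Sum>i<h. r i * m' i) \<and> (\<forall>i<h. r i \<in> R)"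
    using assms(1) by (auto simp: generated_image)
  then obtain b where b: "\<And>l. l < g \<Longrightarrow> m l = (\<Sum>i<h. b l i * m' i)"
    and bR: "\<And>l i. l < g \<Longrightarrow> i < h \<Longrightarrow> b l i \<in> R" by metis
  have "\<forall>j<h. \<exists>r. m' j = (\<Sum>l<g. r l * m l) \<and> (\<forall>i<g. r i \<in> R)"
    using assms(2) by (auto simp: generated_image)
  then obtain c where c: "\<And>j. j < h \<Longrightarrow> m' j = (\<Sum>l<g. c j l * m l)"
    and cR: "\<And>j l. j < h \<Longrightarrow> l < g \<Longrightarrow> c j l \<in> R" by metis
  define B where "B = mat h g (\<lambda>(i, l). b l i)"
  define C where "C = mat g h (\<lambda>(l, j). c j l)"
  have carr [simp]: "B \<in> carrier_mat h g" "C \<in> carrier_mat g h" by (auto simp: B_def C_def)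
  have idx: "i < h \<Longrightarrow> l < g \<Longrightarrow> B $$ (i, l) = b l i" "l < g \<Longrightarrow> j < h \<Longrightarrow> C $$ (l, j) = c j l" for i j l
    by (auto simp: B_def C_def)
  have mult_idx: "(P * Q) $$ (i, j) = (\<Sum>l<g. P $$ (i, l) * Q $$ (l, j))"
    if "P \<in> carrier_mat p g" "Q \<in> carrier_mat g q" "i < p" "j < q" for P Q :: "'k mat" and p q i j
    using that by (auto simp: scalar_prod_def atLeast0LessThan)
  let ?U = "four_block_mat (1\<^sub>m g) (0\<^sub>m g h) B (1\<^sub>m h)"
  let ?T = "four_block_mat A (- C) (0\<^sub>m h g) (1\<^sub>m h)"
  let ?W = "four_block_mat A (- C) (B * A) (1\<^sub>m h - B * C)"
  have W: "?U * ?T = ?W"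
  proof (subst mult_four_block_mat[of _ g g _ h _ h _ _ g _ h])
    have "B * (- C) + 1\<^sub>m h * 1\<^sub>m h = 1\<^sub>m h - B * C"
    proof -
      have "B * (- C) = - (B * C)"
        using carrier_matD[OF carr(1)] carrier_matD[OF carr(2)]
        by (intro eq_matI) (simp_all add: scalar_prod_def sum_negf)
      then show ?thesis
        using mult_carrier_mat[OF carr] by (simp add: comm_add_mat[of _ h h] minus_add_uminus_mat[of _ h h])
    qed
    moreover have "1\<^sub>m g * (- C) + 0\<^sub>m g h * 1\<^sub>m h = - C"
      using carr by (simp add: left_mult_one_mat[of _ g h] right_add_zero_mat[of _ g h])
    moreover have "1\<^sub>m g * A + 0\<^sub>m g h * 0\<^sub>m h g = A" "B * A + 1\<^sub>m h * 0\<^sub>m h g = B * A"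
      using A mult_carrier_mat[OF carr(1) A] by (simp_all add: right_add_zero_mat[of _ h g])
    ultimately show "four_block_mat (1\<^sub>m g * A + 0\<^sub>m g h * 0\<^sub>m h g) (1\<^sub>m g * (- C) + 0\<^sub>m g h * 1\<^sub>m h)
      (B * A + 1\<^sub>m h * 0\<^sub>m h g) (B * (- C) + 1\<^sub>m h * 1\<^sub>m h) = ?W" by simp
  qed (use A in auto)
  have "det ?W = det ?U * det ?T"
    unfolding W[symmetric] by (rule det_mult[of _ "g + h"]) (use A in auto)
  also have "det ?U = 1"
    by (subst det_four_block_mat_upper_right_zero[of _ g _ h]) auto
  also have "det ?T = det A"
    using A by (subst det_four_block_mat_lower_left_zero[of _ g _ h]) auto
  finally have "det ?W = x" using x by simp
  moreover have "det ?W \<in> generated R (*) (relation_dets h m')"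
  proof (rule relation_dets_padded)
    show "?W \<in> carrier_mat (g + h) (g + h)"
      using mult_carrier_mat[OF carr] by (intro four_block_carrier_mat A minus_carrier_mat)
    have BA: "(B * A) $$ (i, j) = (\<Sum>l<g. b l i * A $$ (l, j))" if "i < h" "j < g" for i j
      using that A by (subst mult_idx[of _ h _ g]) (auto simp: idx)
    have BC: "(B * C) $$ (i, j) = (\<Sum>l<g. b l i * c j l)" if "i < h" "j < h" for i j
      using that A by (subst mult_idx[of _ h _ h]) (auto simp: idx)
    have dims [simp]: "dim_row A = g" "dim_col A = g" "dim_row B = h" "dim_col B = g"
      "dim_row C = g" "dim_col C = h"
      using carrier_matD[OF A] carrier_matD[OF carr(1)] carrier_matD[OF carr(2)] by auto
    have BAR: "(B * A) $$ (i, j) \<in> R" if "i < h" "j < g" for i j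
      unfolding BA[OF that] by (intro sum_mem mult_mem bR AR) (use that in auto)
    have BCR: "(B * C) $$ (i, j) \<in> R" if "i < h" "j < h" for i j
      unfolding BC[OF that] by (intro sum_mem mult_mem bR cR) (use that in auto)
    show "?W $$ (i, j) \<in> R" if "i < g + h" "j < g + h" for i j
    proof (cases "i < g"; cases "j < g")
      assume "\<not> i < g" "\<not> j < g"
      then have "?W $$ (i, j) = (1\<^sub>m h) $$ (i - g, j - g) - (B * C) $$ (i - g, j - g)"
        using that by (simp del: index_mult_mat(1) index_one_mat(1))
      also have "\<dots> \<in> R" using \<open>\<not> i < g\<close> \<open>\<not> j < g\<close> that by (intro diff_mem BCR) auto
      finally show ?thesis .
    qed (use that in \<open>simp_all del: index_mult_mat(1) add: AR BAR idx uminus_mem[OF cR]\<close>)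
    show "(\<Sum>i<h. m' i * ?W $$ (g + i, j)) = 0" if "0 < j" "j < g + h" for j
    proof (cases "j < g")
      case True
      have "(\<Sum>i<h. m' i * ?W $$ (g + i, j)) = (\<Sum>i<h. m' i * (\<Sum>l<g. b l i * A $$ (l, j)))"
        using True A carr by (intro sum.cong) (auto simp: BA simp del: index_mult_mat(1))
      also have "\<dots> = (\<Sum>l<g. (\<Sum>i<h. b l i * m' i) * A $$ (l, j))"
        by (simp add: sum_distrib_left sum_distrib_right mult_ac) (rule sum.swap)
      also have "\<dots> = (\<Sum>l<g. m l * A $$ (l, j))" by (simp add: b)
      finally show ?thesis using A0 True that by simp
    next
      \<comment> \<open>These columns give \<open>m' (1 - B C) = m' - m C = 0\<close>.\<close>
      case False
      define j' where "j' = j - g"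
      have j': "j' < h" "j = g + j'" using False that by (auto simp: j'_def)
      have "(\<Sum>i<h. m' i * ?W $$ (g + i, j)) =
        (\<Sum>i<h. m' i * ((if i = j' then 1 else 0) - (\<Sum>l<g. b l i * c j' l)))"
        using j' A carr by (intro sum.cong) (auto simp: BC simp del: index_mult_mat(1))
      also have "\<dots> = (\<Sum>i<h. m' i * (if i = j' then 1 else 0)) - (\<Sum>i<h. m' i * (\<Sum>l<g. b l i * c j' l))"
        by (simp add: right_diff_distrib sum_subtractf)
      also have "(\<Sum>i<h. m' i * (if i = j' then 1 else 0)) = m' j'"
        using j' by (simp add: if_distrib[of "\<lambda>x. _ * x"] cong: if_cong)
      also have "(\<Sum>i<h. m' i * (\<Sum>l<g. b l i * c j' l)) = (\<Sum>l<g. c j' l * (\<Sum>i<h. b l i * m' i))"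
        by (simp add: sum_distrib_left sum_distrib_right mult_ac) (rule sum.swap)
      also have "\<dots> = (\<Sum>l<g. c j' l * m l)" by (simp add: b)
      finally show ?thesis using c j' by simp
    qed
  qed
  ultimately show "x \<in> generated R (*) (relation_dets h m')" by simp
qed

lemma free_module_iff: "f \<in> free_module R B \<longleftrightarrow>
    (\<forall>x. Poly_Mapping.lookup f x \<in> R \<and> (x \<notin> B \<longrightarrow> Poly_Mapping.lookup f x = 0))"
  by (auto simp: free_module_def in_keys_iff)

lemma is_submodule_relations: "is_submodule R pscale (relations g m)"
  unfolding is_submodule_def relations_def
  by (auto simp: free_module_iff lookup_add distrib_right sum.distrib mult.assoc
      simp flip: sum_distrib_left)

text \<open>A row selection of size \<open>g - 1\<close> deletes exactly one row \<open>p\<close>,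
  so that the \<open>(g - 1)\<close>-minors are determinants of a \<open>mat_delete\<close>. In the
  induction either the last value is the largest possible one and \<open>p\<close> is inherited, or
  monotonicity squeezes \<open>row\<close> to the identity and the largest value is the omitted
  one.\<close>

lemma strict_mono_on_omits_one:
  fixes row :: "nat \<Rightarrow> nat"
  assumes "row ` {..<k} \<subseteq> {..<Suc k}" "strict_mono_on {..<k} row"
  shows "\<exists>p\<le>k. \<forall>a<k. row a = (if a < p then a else Suc a)"
  using assms
proof (induction k)
  case (Suc k)
  have mono: "a < b \<Longrightarrow> b < Suc k \<Longrightarrow> row a < row b" for a b
    using Suc.prems(2) by (auto simp: strict_mono_on_def)
  have le: "row k \<le> Suc k" using Suc.prems(1) by auto
  have sub: "row ` {..<k} \<subseteq> {..<Suc k}"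
    using mono[OF _ lessI] le by fastforce
  have "strict_mono_on {..<k} row" using mono by (auto simp: strict_mono_on_def)
  then obtain p where p: "p \<le> k" "\<forall>a<k. row a = (if a < p then a else Suc a)"
    using Suc.IH[OF sub] by blast
  show ?case
  proof (cases "row k = Suc k")
    case True
    then show ?thesis using p by (intro exI[of _ p]) (auto simp: less_Suc_eq)
  next
    case False
    have ge: "a < Suc k \<Longrightarrow> a \<le> row a" for a
    proof (induction a)
      case (Suc a) then show ?case using mono[of a "Suc a"] by auto
    qed auto
    have "row k = k" using ge[of k] le False by auto
    \<comment> \<open>An omission below \<open>k\<close> would already shift the value at
      \<open>k - 1\<close> to \<open>k\<close>.\<close>
    moreover have "row a = a" if "a < k" for a
      using p(2)[rule_format, OF that] mono[of a k] ge[of a] that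
        p(2)[rule_format, of "k - 1"] mono[of "k - 1" k] \<open>row k = k\<close> by (auto split: if_splits)
    ultimately show ?thesis by (intro exI[of _ "Suc k"]) (auto simp: less_Suc_eq)
  qed
qed auto

lemma minors_subset_relation_dets:
  assumes "0 < g" "generated R pscale \<Phi> = relations g m"
  shows "minors g \<Phi> (g - 1) \<subseteq> generated R (*) (relation_dets g m)"
proof
  define k where "k = g - 1"
  have g: "g = Suc k" using assms by (simp add: k_def)
  fix x assume "x \<in> minors g \<Phi> (g - 1)"
  then obtain row :: "nat \<Rightarrow> nat" and col :: "nat \<Rightarrow> nat \<Rightarrow>\<^sub>0 'k" where x: "x = det (mat k k (\<lambda>(a, b). Poly_Mapping.lookup (col b) (row a)))"
    and row: "row ` {..<k} \<subseteq> {..<g}" "strict_mono_on {..<k} row" and col: "col ` {..<k} \<subseteq> \<Phi>"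
    unfolding minors_def k_def by blast
  obtain p where p: "p \<le> k" "\<forall>a<k. row a = (if a < p then a else Suc a)"
    using strict_mono_on_omits_one row g by blast
  have rel: "col b \<in> relations g m" if "b < k" for b
    using that col generated_superset[of \<Phi> R pscale] assms(2) by auto
  \<comment> \<open>The border is the unit vector of the deleted row \<open>p\<close>, so that
    expanding along column 0 leaves only the cofactor at \<open>p\<close>, which is the given minor
    up to sign.\<close>
  define A where "A = mat g g (\<lambda>(i, j). if j = 0 then (if i = p then 1 else 0) else Poly_Mapping.lookup (col (j - 1)) i)"
  have A: "A \<in> carrier_mat g g" by (simp add: A_def)
  have del: "mat_delete A p 0 = mat k k (\<lambda>(a, b). Poly_Mapping.lookup (col b) (row a))"
    using p by (intro eq_matI) (auto simp: mat_delete_def A_def g)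
  have "det A = (\<Sum>i<g. A $$ (i, 0) * cofactor A i 0)"
    using laplace_expansion_column[OF A] g by simp
  also have "\<dots> = (\<Sum>i<g. if i = p then cofactor A p 0 else 0)"
    by (intro sum.cong) (auto simp: A_def)
  also have "\<dots> = (- 1) ^ p * x"
    using p g by (auto simp: cofactor_def del x)
  finally have "x = (- 1) ^ p * det A" by (simp flip: power_mult_distrib mult.assoc)
  moreover have "det A \<in> relation_dets g m"
    unfolding relation_dets_def
  proof (intro CollectI exI[of _ A] conjI allI impI)
    show "A $$ (i, j) \<in> R" if "i < g" "j < g" for i j
      using that rel[of "j - 1"] by (auto simp: A_def g relations_def free_module_def)
    show "(\<Sum>i<g. m i * A $$ (i, j)) = 0" if "0 < j \<and> j < g" for j
    proof -
      have "(\<Sum>i<g. m i * A $$ (i, j)) = (\<Sum>i<g. Poly_Mapping.lookup (col (j - 1)) i * m i)"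
        using that by (intro sum.cong) (auto simp: A_def)
      then show ?thesis using rel[of "j - 1"] that by (auto simp: g relations_def)
    qed
  qed (use A in auto)
  ultimately have "x = (- 1) ^ p * det A" "det A \<in> generated R (*) (relation_dets g m)"
    using generated_superset by auto
  then show "x \<in> generated R (*) (relation_dets g m)"
    by (simp only:) (intro submodule_scale[OF is_submodule_generated] power_mem uminus_mem one_mem)
qed

text \<open>By multilinearity, minors with columns in the span of \<open>\<Phi>\<close> lie in the
  ideal generated by the minors with columns in \<open>\<Phi>\<close> itself. The induction on
  \<open>j\<close> releases one column at a time: the vectors admissible in that column form a
  submodule, which contains \<open>\<Phi>\<close>.\<close>

lemma det_generated_columns:
  fixes row :: "nat \<Rightarrow> nat" and col :: "nat \<Rightarrow> nat \<Rightarrow>\<^sub>0 'k"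
  assumes row: "row ` {..<k} \<subseteq> {..<g}" "strict_mono_on {..<k} row"
    and "j \<le> k"
    and "\<And>b. b < j \<Longrightarrow> col b \<in> generated R pscale \<Phi>"
    and "\<And>b. j \<le> b \<Longrightarrow> b < k \<Longrightarrow> col b \<in> \<Phi>"
    and \<Phi>: "generated R pscale \<Phi> = relations g m"
  shows "det (mat k k (\<lambda>(a, b). Poly_Mapping.lookup (col b) (row a))) \<in> generated R (*) (minors g \<Phi> k)"
  using assms(3-5)
proof (induction j arbitrary: col)
  case 0
  let ?A = "mat k k (\<lambda>(a, b). Poly_Mapping.lookup (col b) (row a))"
  show ?case
  proof (cases "inj_on col {..<k}")
    case True
    have "det ?A \<in> minors g \<Phi> k"
      unfolding minors_def using row True 0 by blast
    then show ?thesis using generated_superset by blast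
  next
    \<comment> \<open>\<open>minors\<close> asks for distinct columns; a repeated column gives
      determinant 0.\<close>
    case False
    then obtain a b where "a < k" "b < k" "a \<noteq> b" "col a = col b" by (auto simp: inj_on_def)
    then have "det ?A = 0"
      by (intro det_identical_columns[of ?A k a b]) auto
    then show ?thesis using submodule_zero[OF is_submodule_generated] by simp
  qed
next
  case (Suc j)
  let ?A = "\<lambda>f. mat k k (\<lambda>(a, b). Poly_Mapping.lookup ((col(j := f)) b) (row a))"
  \<comment> \<open>The cofactors along column \<open>j\<close> do not see its entries, so they may
    be taken from the matrix with the zero vector in that column. This displays the linearity in
    \<open>f\<close>.\<close>
  have exp: "det (?A f) = (\<Sum>i<k. Poly_Mapping.lookup f (row i) * cofactor (?A 0) i j)" for f
  proof -
    have del: "mat_delete (?A f) i j = mat_delete (?A 0) i j" if "i < k" for i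
      using that Suc.prems(1) by (intro eq_matI) (auto simp: mat_delete_def)
    have "det (?A f) = (\<Sum>i<k. ?A f $$ (i, j) * cofactor (?A f) i j)"
      by (rule laplace_expansion_column) (use Suc.prems in auto)
    also have "\<dots> = (\<Sum>i<k. Poly_Mapping.lookup f (row i) * cofactor (?A 0) i j)"
    proof (intro sum.cong refl)
      fix i assume "i \<in> {..<k}"
      then have "?A f $$ (i, j) = Poly_Mapping.lookup f (row i)" "cofactor (?A f) i j = cofactor (?A 0) i j"
        unfolding cofactor_def using del[of i] Suc.prems(1) by auto
      then show "?A f $$ (i, j) * cofactor (?A f) i j = Poly_Mapping.lookup f (row i) * cofactor (?A 0) i j"
        by simp
    qed
    finally show ?thesis .
  qed
  let ?J = "generated R (*) (minors g \<Phi> k)"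
  have "generated R pscale \<Phi> \<subseteq> {f. det (?A f) \<in> ?J}"
  proof (rule generated_minimal)
    show "\<Phi> \<subseteq> {f. det (?A f) \<in> ?J}"
    proof (intro subsetI CollectI Suc.IH)
      fix f b assume "f \<in> \<Phi>" "j \<le> b" "b < k"
      then show "(col(j := f)) b \<in> \<Phi>" using Suc.prems(3)[of b] by (cases "b = j") auto
    qed (use Suc.prems in auto)
    show "is_submodule R pscale {f. det (?A f) \<in> ?J}"
      unfolding is_submodule_def exp
      using is_submodule_generated[of R "(*)" "minors g \<Phi> k"]
      by (auto simp: lookup_add distrib_right sum.distrib mult.assoc is_submodule_def
          simp flip: sum_distrib_left)
  qed
  then have "det (?A (col j)) \<in> ?J" using Suc.prems(2)[of j] by blast
  then show ?case unfolding fun_upd_triv .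
qed

text \<open>Expansion along the free first column: its cofactors are \<open>(g - 1)\<close>-minors
  whose columns are relations, hence combinations of \<open>\<Phi>\<close>.\<close>

lemma relation_dets_subset_minors:
  assumes "0 < g" and \<Phi>: "generated R pscale \<Phi> = relations g m"
  shows "relation_dets g m \<subseteq> generated R (*) (minors g \<Phi> (g - 1))"
proof
  define k where "k = g - 1"
  have g: "g = Suc k" using assms by (simp add: k_def)
  fix x assume "x \<in> relation_dets g m"
  then obtain A where x: "x = det A" and A: "A \<in> carrier_mat g g"
    and AR: "\<And>i j. i < g \<Longrightarrow> j < g \<Longrightarrow> A $$ (i, j) \<in> R"
    and A0: "\<And>j. 0 < j \<Longrightarrow> j < g \<Longrightarrow> (\<Sum>i<g. m i * A $$ (i, j)) = 0"
    by (auto simp: relation_dets_def)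
  define col where "col = (\<lambda>b. Abs_poly_mapping (\<lambda>i. if i < g then A $$ (i, Suc b) else 0))"
  have lk: "Poly_Mapping.lookup (col b) i = (if i < g then A $$ (i, Suc b) else 0)" for b i
    unfolding col_def by (subst lookup_Abs_poly_mapping) (auto intro: finite_subset[of _ "{..<g}"])
  have col: "col b \<in> relations g m" if "b < k" for b
    using A0[of "Suc b"] that AR
    by (auto simp: relations_def free_module_def lk g in_keys_iff mult.commute split: if_splits)
  have "cofactor A p 0 \<in> generated R (*) (minors g \<Phi> k)" if p: "p < g" for p
  proof -
    have del: "mat_delete A p 0 = mat k k (\<lambda>(a, b). Poly_Mapping.lookup (col b) (if a < p then a else Suc a))"
      using p A by (intro eq_matI) (auto simp: mat_delete_def lk g)
    have "det (mat_delete A p 0) \<in> generated R (*) (minors g \<Phi> k)"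
      unfolding del
      by (rule det_generated_columns[where j = k, OF _ _ _ _ _ \<Phi>])
        (use p g col \<Phi> in \<open>auto simp: strict_mono_on_def\<close>)
    then show ?thesis unfolding cofactor_def
      by (intro submodule_scale[OF is_submodule_generated]) auto
  qed
  then have "(\<Sum>i<g. A $$ (i, 0) * cofactor A i 0) \<in> generated R (*) (minors g \<Phi> k)"
    using AR g by (intro submodule_sum[OF is_submodule_generated] submodule_scale[OF is_submodule_generated]) auto
  then show "x \<in> generated R (*) (minors g \<Phi> (g - 1))"
    unfolding x k_def[symmetric] using laplace_expansion_column[OF A, of 0] g by simp
qed

text \<open>\<open>relation_dets\<close> serves as a normal form: it generates the same ideal as the
  minors of any presentation with these generators, and a change of generators does not alter that
  ideal. Since \<open>M \<noteq> {0}\<close>, every presentation has a generator, so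
  \<open>g' - 1\<close> is a genuine difference.\<close>

lemma fitting_ideal_1:
  assumes "0 < g" and gen: "generated R (*) (m ` {..<g}) = M" and "M \<noteq> {0}"
  shows "fitting_ideal R 1 M = generated R (*) (relation_dets g m)"
proof -
  have eq: "generated R (*) (minors g' \<Phi> (g' - 1)) = generated R (*) (relation_dets g m)"
    if "free_presentation R g' m' \<Phi> M" for g' m' \<Phi>
  proof -
    have gen': "generated R (*) (m' ` {..<g'}) = M" and \<Phi>: "generated R pscale \<Phi> = relations g' m'"
      using that by (auto simp: free_presentation_def relations_def)
    have "generated R (*) {} = {0}"
      using generated_minimal[of "{}" "{0}" R "(*)"] is_submodule_generated[of R "(*)" "{}"]
      by (auto simp: is_submodule_def)
    then have "0 < g'" using gen' \<open>M \<noteq> {0}\<close> by (cases g') auto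
    have "m ` {..<g} \<subseteq> generated R (*) (m' ` {..<g'})" "m' ` {..<g'} \<subseteq> generated R (*) (m ` {..<g})"
      unfolding gen gen'
      using gen gen' generated_superset[of "m ` {..<g}" R "(*)"] generated_superset[of "m' ` {..<g'}" R "(*)"] by simp_all
    note sub = relation_dets_subset[OF this] relation_dets_subset[OF this(2,1)]
    note sub' = minors_subset_relation_dets[OF \<open>0 < g'\<close> \<Phi>] relation_dets_subset_minors[OF \<open>0 < g'\<close> \<Phi>]
    have "generated R (*) (minors g' \<Phi> (g' - 1)) = generated R (*) (relation_dets g' m')"
      by (intro equalityI generated_minimal sub' is_submodule_generated)
    also have "\<dots> = generated R (*) (relation_dets g m)"
      by (intro equalityI generated_minimal sub is_submodule_generated)
    finally show ?thesis .
  qed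
  \<comment> \<open>All relations together are an admissible set of columns, so at least one
    presentation exists.\<close>
  have "free_presentation R g m (relations g m) M"
    unfolding free_presentation_def
    by (simp add: gen generated_submodule[OF is_submodule_relations]) (simp add: relations_def)
  then show ?thesis
    unfolding fitting_ideal_def using eq by (intro the_equality) (auto, blast)
qed

section \<open>The trace ideal of a pair as its first Fitting ideal\<close>

definition conductor :: "'k \<Rightarrow> 'k \<Rightarrow> 'k set" where
  "conductor a b = {c. c * a \<in> R \<and> c * b \<in> R}"

text \<open>For a nonzero module \<open>I\<close> spanned by \<open>a\<close> and \<open>b\<close>,
  the homomorphisms from \<open>I\<close> to \<open>R\<close> are the multiplications by elements of
  \<open>(R : I)\<close>, and this is the sum of their images. It is \<open>R\<close> precisely when
  \<open>I\<close> is invertible.\<close>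

definition trace_ideal :: "'k \<Rightarrow> 'k \<Rightarrow> 'k set" where
  "trace_ideal a b = {c * a + d * b | c d. c \<in> conductor a b \<and> d \<in> conductor a b}"

lemma trace_idealI: "c \<in> conductor a b \<Longrightarrow> d \<in> conductor a b \<Longrightarrow> c * a + d * b \<in> trace_ideal a b"
  by (auto simp: trace_ideal_def)

lemma trace_idealE:
  assumes "x \<in> trace_ideal a b"
  obtains c d where "c \<in> conductor a b" "d \<in> conductor a b" "x = c * a + d * b"
  using assms by (auto simp: trace_ideal_def)

lemma is_submodule_conductor: "is_submodule R (*) (conductor a b)"
  by (auto simp: is_submodule_def conductor_def distrib_right mult.assoc)

lemma is_submodule_trace_ideal: "is_submodule R (*) (trace_ideal a b)"
  unfolding is_submodule_def
proof (intro conjI ballI)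
  note conductor = submodule_zero[OF is_submodule_conductor] submodule_add[OF is_submodule_conductor]
    submodule_scale[OF is_submodule_conductor]
  show "0 \<in> trace_ideal a b"
    using trace_idealI[OF conductor(1) conductor(1)] by simp
  show "x + y \<in> trace_ideal a b" if "x \<in> trace_ideal a b" "y \<in> trace_ideal a b" for x y
  proof -
    obtain c d where x: "c \<in> conductor a b" "d \<in> conductor a b" "x = c * a + d * b"
      using \<open>x \<in> _\<close> by (rule trace_idealE)
    obtain c' d' where y: "c' \<in> conductor a b" "d' \<in> conductor a b" "y = c' * a + d' * b"
      using \<open>y \<in> _\<close> by (rule trace_idealE)
    show ?thesis
      using trace_idealI[OF conductor(2)[OF x(1) y(1)] conductor(2)[OF x(2) y(2)]] x y
      by (simp add: algebra_simps)
  qed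
  show "r * x \<in> trace_ideal a b" if "r \<in> R" "x \<in> trace_ideal a b" for r x
  proof -
    obtain c d where x: "c \<in> conductor a b" "d \<in> conductor a b" "x = c * a + d * b"
      using \<open>x \<in> _\<close> by (rule trace_idealE)
    show ?thesis
      using trace_idealI[OF conductor(3)[OF that(1) x(1)] conductor(3)[OF that(1) x(2)]] x
      by (simp add: algebra_simps)
  qed
qed

lemma det_mat_2: "A \<in> carrier_mat 2 2 \<Longrightarrow> det A = A $$ (0, 0) * A $$ (1, 1) - A $$ (0, 1) * A $$ (1, 0)"
  for A :: "'a::comm_ring_1 mat"
  by (simp add: laplace_expansion_column[of _ 2 0] cofactor_def det_single mat_delete_def numeral_2_eq_2 lessThan_Suc)

lemma fitting_ideal_pair:
  assumes "(a, b) \<noteq> (0, 0)" "generated R (*) {a, b} = M"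
  shows "fitting_ideal R 1 M = trace_ideal a b"
proof -
  let ?m = "\<lambda>i::nat. if i = 0 then a else b"
  have "?m ` {..<2} = {a, b}" by (auto simp: numeral_2_eq_2 lessThan_Suc)
  moreover have "M \<noteq> {0}" using assms generated_superset[of "{a, b}" R "(*)"] by auto
  ultimately have "fitting_ideal R 1 M = generated R (*) (relation_dets 2 ?m)"
    using assms by (intro fitting_ideal_1) auto
  also have "\<dots> = trace_ideal a b"
  proof (intro equalityI generated_minimal is_submodule_trace_ideal subsetI)
    fix x assume "x \<in> relation_dets 2 ?m"
    then obtain A where x: "x = det A" and A: "A \<in> carrier_mat 2 2"
      and AR: "\<And>i j. i < 2 \<Longrightarrow> j < 2 \<Longrightarrow> A $$ (i, j) \<in> R"
      and A1: "\<And>j. 0 < j \<Longrightarrow> j < 2 \<Longrightarrow> (\<Sum>i<2. ?m i * A $$ (i, j)) = 0"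
      unfolding relation_dets_def by blast
    have A0: "a * A $$ (0, 1) + b * A $$ (1, 1) = 0"
      using A1[of 1] by (simp add: numeral_2_eq_2 lessThan_Suc add.commute)
    \<comment> \<open>Over the field the solutions are the multiples of \<open>(- b, a)\<close>; the
      factor \<open>l\<close> is read off at a nonzero one of \<open>a\<close> and
      \<open>b\<close>.\<close>
    obtain l where l: "A $$ (0, 1) = - l * b" "A $$ (1, 1) = l * a"
    proof (cases "a = 0")
      case True
      then show ?thesis using that[of "- A $$ (0, 1) / b"] A0 assms(1) by auto
    next
      case False
      have "A $$ (0, 1) = - (A $$ (1, 1) / a) * b" using A0 False
        by (simp add: field_simps eq_neg_iff_add_eq_0)
      then show ?thesis using that[of "A $$ (1, 1) / a"] False by auto
    qed
    then have "l \<in> conductor a b"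
      using AR[of 0 1] AR[of 1 1] uminus_mem[of "- (l * b)"] by (auto simp: conductor_def)
    then have "A $$ (0, 0) * l \<in> conductor a b" "A $$ (1, 0) * l \<in> conductor a b"
      using AR[of 0 0] AR[of 1 0] by (auto simp: conductor_def mult.assoc)
    moreover have "x = (A $$ (0, 0) * l) * a + (A $$ (1, 0) * l) * b"
      unfolding x det_mat_2[OF A] l by (simp add: algebra_simps)
    ultimately show "x \<in> trace_ideal a b" unfolding trace_ideal_def by blast
  next
    fix x assume "x \<in> trace_ideal a b"
    then obtain c d where x: "x = c * a + d * b" and c: "c \<in> conductor a b" and d: "d \<in> conductor a b"
      by (auto simp: trace_ideal_def)
    \<comment> \<open>The free first column is \<open>v\<close>; the unit vectors give the summands
      \<open>c a\<close> and \<open>d b\<close> separately.\<close>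
    have gen: "v 0 * l * a + v 1 * l * b \<in> generated R (*) (relation_dets 2 ?m)"
      if "l \<in> conductor a b" "\<And>i. v i \<in> R" for l and v :: "nat \<Rightarrow> 'k"
    proof -
      let ?A = "mat 2 2 (\<lambda>(i, j). if j = 0 then v i else if i = 0 then - (l * b) else l * a)"
      have "det ?A \<in> relation_dets 2 ?m"
        unfolding relation_dets_def using that
        by (intro CollectI exI conjI refl)
          (auto simp: conductor_def numeral_2_eq_2 less_Suc_eq lessThan_Suc)
      moreover have "det ?A = v 0 * l * a + v 1 * l * b"
        by (subst det_mat_2) (auto simp: algebra_simps)
      ultimately show ?thesis using generated_superset by auto
    qed
    show "x \<in> generated R (*) (relation_dets 2 ?m)"
      unfolding x using gen[OF c, of "\<lambda>i. if i = 0 then 1 else 0"] gen[OF d, of "\<lambda>i. if i = 0 then 0 else 1"]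
      by (intro submodule_add[OF is_submodule_generated]) auto
  qed
  finally show ?thesis .
qed

section \<open>The exterior square of a module with two generators\<close>

lemma is_submodule_ext_relations: "is_submodule R pscale (ext_relations R I)"
  unfolding ext_relations_def Let_def by (rule is_submodule_generated)

text \<open>The 2 by 2 determinant rule for alternating bilinear maps, derived from the relations
  that define the exterior square. Congruence modulo them is membership of a difference.\<close>

lemma ext_square_minor:
  assumes I: "is_submodule R (*) I" "x \<in> I" "y \<in> I"
    and R: "a \<in> R" "b \<in> R" "c \<in> R" "d \<in> R"
  shows "Poly_Mapping.single (a * x + c * y, b * x + d * y) 1 -
    pscale (a * d - b * c) (Poly_Mapping.single (x, y) 1) \<in> ext_relations R I"
proof -
  define w :: "'k \<Rightarrow> 'k \<Rightarrow> 'k \<times> 'k \<Rightarrow>\<^sub>0 'k" where "w = (\<lambda>x y. Poly_Mapping.single (x, y) 1)"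
  let ?E = "ext_relations R I"
  define eq where "eq = (\<lambda>f g. f - g \<in> ?E)"
  note I_add = submodule_add[OF I(1)] and I_scale = submodule_scale[OF I(1)]
  note E = is_submodule_ext_relations
  have refl: "eq f f" for f
    using submodule_zero[OF E] by (simp add: eq_def)
  have add: "eq (f + f') (g + g')" if "eq f g" "eq f' g'" for f f' g g'
  proof -
    have "f + f' - (g + g') = (f - g) + (f' - g')" by simp
    then show ?thesis using submodule_add[OF E] that unfolding eq_def by metis
  qed
  have scale: "eq (pscale r f) (pscale r g)" if "r \<in> R" "eq f g" for r f g
  proof -
    have "pscale r f - pscale r g = pscale r (f - g)"
      by (rule poly_mapping_eqI) (simp add: lookup_minus algebra_simps)
    then show ?thesis using submodule_scale[OF E that(1)] that(2) unfolding eq_def by metis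
  qed
  have trans: "eq f h" if "eq f g" "eq g h" for f g h
  proof -
    have "f - h = (f - g) + (g - h)" by simp
    then show ?thesis using submodule_add[OF E] that unfolding eq_def by metis
  qed
  have gen: "eq (w (x + x') y) (w x y + w x' y)" "eq (w y (x + x')) (w y x + w y x')" "eq (w x x) 0"
    if "x \<in> I" "x' \<in> I" "y \<in> I" for x x' y
    unfolding ext_relations_def Let_def w_def eq_def diff_diff_eq[symmetric] diff_zero
    by (rule subsetD[OF generated_superset]; use that in blast)+
  have gen': "eq (w (r * x) y) (pscale r (w x y))" "eq (w y (r * x)) (pscale r (w y x))"
    if "r \<in> R" "x \<in> I" "y \<in> I" for r x y
    unfolding ext_relations_def Let_def w_def eq_def
    by (rule subsetD[OF generated_superset]; use that in blast)+
  have linear: "eq (w u (b * x + d * y)) (pscale b (w u x) + pscale d (w u y))"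
    "eq (w (a * x + c * y) u) (pscale a (w x u) + pscale c (w y u))" if "u \<in> I" for u
    using I R that by (auto intro!: trans[OF gen(2) add[OF gen'(2,2)]] trans[OF gen(1) add[OF gen'(1,1)]] I_scale)
  \<comment> \<open>Antisymmetry is not among the relations; it comes from expanding the alternating
    relation at \<open>x + y\<close>.\<close>
  have alt: "eq (w y x) (pscale (- 1) (w x y))"
  proof -
    have "eq (w (x + y) (x + y)) (w x x + w x y + (w y x + w y y))"
      using I by (intro trans[OF gen(1) add] gen(2) I_add)
    moreover have "eq (w x x + w x y + (w y x + w y y)) (0 + w x y + (w y x + 0))"
      using I by (intro add gen(3) refl)
    ultimately have "eq (w (x + y) (x + y)) (0 + w x y + (w y x + 0))" by (rule trans)
    moreover have "eq (w (x + y) (x + y)) 0"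
      using I I_add by (intro gen(3)) auto
    ultimately have "w (x + y) (x + y) - (w x y + w y x) \<in> ?E" "w (x + y) (x + y) \<in> ?E"
      by (simp_all add: eq_def)
    then have "w (x + y) (x + y) + pscale (- 1) (w (x + y) (x + y) - (w x y + w y x)) \<in> ?E"
      by (intro submodule_add[OF E] submodule_scale[OF E]) auto
    moreover have "w (x + y) (x + y) + pscale (- 1) (w (x + y) (x + y) - (w x y + w y x)) = w y x - pscale (- 1) (w x y)"
      by (rule poly_mapping_eqI) (simp add: lookup_minus lookup_add)
    ultimately show ?thesis by (simp add: eq_def)
  qed
  let ?z = "b * x + d * y"
  have z: "?z \<in> I" using I R by (intro I_add I_scale)
  have "eq (w x ?z) (pscale b 0 + pscale d (w x y))"
    by (intro trans[OF linear(1)] add scale gen(3)[OF I(2,2,2)] refl I R)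
  moreover have "eq (w y ?z) (pscale b (pscale (- 1) (w x y)) + pscale d 0)"
    by (intro trans[OF linear(1)] add scale gen(3)[OF I(3,3,3)] alt I R)
  ultimately have "eq (w (a * x + c * y) ?z)
    (pscale a (pscale b 0 + pscale d (w x y)) + pscale c (pscale b (pscale (- 1) (w x y)) + pscale d 0))"
    by (intro trans[OF linear(2)] add scale z R)
  also have "pscale a (pscale b 0 + pscale d (w x y)) + pscale c (pscale b (pscale (- 1) (w x y)) + pscale d 0)
      = pscale (a * d - b * c) (w x y)"
    by (rule poly_mapping_eqI) (simp add: lookup_minus lookup_add algebra_simps)
  finally show ?thesis by (simp add: eq_def w_def)
qed

lemma is_submodule_pair: "generated R (*) {a, b} = I \<Longrightarrow> is_submodule R (*) I"
  using is_submodule_generated by blast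

lemma trace_ideal_subset: "trace_ideal a b \<subseteq> R"
  by (auto simp: trace_ideal_def conductor_def)

lemma pair_relationE:
  assumes "(a, b) \<noteq> (0, 0)" "s * a + t * b = 0" "s \<in> R" "t \<in> R"
  obtains l where "l \<in> conductor a b" "s = - (l * b)" "t = l * a"
proof (cases "a = 0")
  case True
  then show ?thesis
    using assms that[of "- s / b"] uminus_mem[of s] by (auto simp: conductor_def)
next
  case False
  have s: "s = - (t / a * b)"
    using assms(2) False by (simp add: field_simps eq_neg_iff_add_eq_0)
  then have "t / a * b \<in> R" using uminus_mem[OF assms(3)] by simp
  then show ?thesis using False s assms that[of "t / a"] by (auto simp: conductor_def)
qed

text \<open>A determinant with the relation \<open>l (- b, a)\<close> as one column and
  \<open>(u, v)\<close> as the other is \<open>- l (u a + v b)\<close>. So replacing the coordinates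
  of an element by other coordinates of the same element changes determinants only within the trace
  ideal.\<close>

lemma pair_relation_minor:
  assumes "(a, b) \<noteq> (0, 0)" "s * a + t * b = 0" "s \<in> R" "t \<in> R" "u \<in> R" "v \<in> R"
  shows "s * v - t * u \<in> trace_ideal a b"
proof -
  obtain l where l: "l \<in> conductor a b" "s = - (l * b)" "t = l * a"
    using assms(1-4) by (rule pair_relationE)
  have "(- v * l) * b + (- u * l) * a \<in> trace_ideal a b"
    unfolding add.commute[of "_ * b"]
    using l(1) assms by (intro trace_idealI submodule_scale[OF is_submodule_conductor] uminus_mem)
  then show ?thesis by (simp add: l mult_ac)
qed

lemma pair_relation_mem:
  assumes "(a, b) \<noteq> (0, 0)" "s * a + t * b = 0" "s \<in> R" "t \<in> R"
  shows "s \<in> trace_ideal a b" "t \<in> trace_ideal a b"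
  using pair_relation_minor[OF assms, of 0 1] pair_relation_minor[OF assms, of "- 1" 0] by auto

text \<open>The functional \<open>f \<mapsto> \<Sum> f(x, y) (p x q y - p y q x)\<close> with arbitrarily chosen coordinates
  \<open>x = p x a + q x b\<close> maps the relations of the exterior square into the trace ideal.\<close>

lemma ext_square_annihilator:
  assumes ab: "(a, b) \<noteq> (0, 0)" and gen: "generated R (*) {a, b} = I" and "r \<in> R"
    and mem: "pscale r (Poly_Mapping.single (a, b) 1) \<in> ext_relations R I"
  shows "r \<in> trace_ideal a b"
proof -
  let ?F = "trace_ideal a b"
  note F = is_submodule_trace_ideal[of a b]
  have I: "I = {r * a + s * b | r s. r \<in> R \<and> s \<in> R}"
    using gen generated_pair by simp
  then have "\<forall>x\<in>I. \<exists>p q. p \<in> R \<and> q \<in> R \<and> x = p * a + q * b" by blast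
  then obtain p q where pq: "\<And>x. x \<in> I \<Longrightarrow> p x \<in> R" "\<And>x. x \<in> I \<Longrightarrow> q x \<in> R" "\<And>x. x \<in> I \<Longrightarrow> x = p x * a + q x * b"
    by metis
  have Iadd: "x + y \<in> I" and Iscale: "c \<in> R \<Longrightarrow> c * x \<in> I" if "x \<in> I" "y \<in> I" for x y c
    using that is_submodule_pair[OF gen] by (auto simp: is_submodule_def)
  define D where "D = (\<lambda>x y. p x * q y - p y * q x)"
  have D_swap: "D y x = - D x y" for x y by (simp add: D_def)
  have D_R: "D x y \<in> R" if "x \<in> I" "y \<in> I" for x y
    using that pq by (auto simp: D_def intro!: diff_mem mult_mem)
  \<comment> \<open>The choice of coordinates is not additive, but the defect is a relation, and its
    determinant with any column is in \<open>?F\<close>.\<close>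
  have D_add: "D (x + x') y - D x y - D x' y \<in> ?F" if "x \<in> I" "x' \<in> I" "y \<in> I" for x x' y
  proof -
    have "(p (x + x') - p x - p x') * a + (q (x + x') - q x - q x') * b = 0"
      using pq(3)[OF that(1)] pq(3)[OF that(2)] pq(3)[OF Iadd[OF that(1,2)]] by (simp add: algebra_simps)
    then have "(p (x + x') - p x - p x') * q y - (q (x + x') - q x - q x') * p y \<in> ?F"
      using that Iadd by (intro pair_relation_minor[OF ab] diff_mem pq) auto
    then show ?thesis by (simp add: D_def algebra_simps)
  qed
  have D_scale: "D (c * x) y - c * D x y \<in> ?F" if "c \<in> R" "x \<in> I" "y \<in> I" for c x y
  proof -
    have "(p (c * x) - c * p x) * a + (q (c * x) - c * q x) * b = c * x - c * x"
      using pq(3)[OF that(2)] pq(3)[OF Iscale[OF that(2,2,1)]]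
      by (simp add: left_diff_distrib mult.assoc add_diff_add[symmetric] distrib_left[symmetric] del: diff_self)
    then have "(p (c * x) - c * p x) * q y - (q (c * x) - c * q x) * p y \<in> ?F"
      using that Iscale by (intro pair_relation_minor[OF ab] diff_mem mult_mem pq) auto
    then show ?thesis by (simp add: D_def algebra_simps)
  qed
  define L where "L = (\<lambda>f. \<Sum>k\<in>Poly_Mapping.keys f. Poly_Mapping.lookup f k * (case k of (x, y) \<Rightarrow> D x y))"
  have L_add: "L (f + g) = L f + L g" for f g
    unfolding L_def by (rule setsum_keys_plus_distrib) (auto simp: distrib_right)
  have L_scale: "L (pscale c f) = c * L f" for c f
    unfolding L_def sum_distrib_left
    by (rule sum.mono_neutral_cong_left) (auto simp: in_keys_iff)
  have L_diff: "L (f - g) = L f - L g" for f g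
    using L_add[of "f - g" g] by simp
  have L_single: "L (Poly_Mapping.single (x, y) 1) = D x y" for x y
    by (simp add: L_def)
  have "ext_relations R I \<subseteq> {f. L f \<in> ?F}"
    unfolding ext_relations_def Let_def
  proof (rule generated_minimal)
    show "is_submodule R pscale {f. L f \<in> ?F}"
      using F by (auto simp: is_submodule_def L_add L_scale) (simp add: L_def)
    have "D x (y + y') - D x y - D x y' \<in> ?F" if "x \<in> I" "y \<in> I" "y' \<in> I" for x y y'
      using submodule_uminus[OF F D_add[OF that(2,3,1)]] by (simp add: D_swap[of x] algebra_simps)
    moreover have "D x (c * y) - c * D x y \<in> ?F" if "c \<in> R" "x \<in> I" "y \<in> I" for c x y
      using submodule_uminus[OF F D_scale[OF that(1,3,2)]] by (simp add: D_swap[of x])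
    moreover have "D x x \<in> ?F" for x
      using submodule_zero[OF F] by (simp add: D_def)
    ultimately show "{Poly_Mapping.single (x + x', y) 1 - Poly_Mapping.single (x, y) 1 - Poly_Mapping.single (x', y) 1 | x x' y. x \<in> I \<and> x' \<in> I \<and> y \<in> I} \<union>
       {Poly_Mapping.single (x, y + y') 1 - Poly_Mapping.single (x, y) 1 - Poly_Mapping.single (x, y') 1 | x y y'. x \<in> I \<and> y \<in> I \<and> y' \<in> I} \<union>
       {Poly_Mapping.single (r * x, y) 1 - pscale r (Poly_Mapping.single (x, y) 1) | r x y. r \<in> R \<and> x \<in> I \<and> y \<in> I} \<union>
       {Poly_Mapping.single (x, r * y) 1 - pscale r (Poly_Mapping.single (x, y) 1) | r x y. r \<in> R \<and> x \<in> I \<and> y \<in> I} \<union>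
       {Poly_Mapping.single (x, x) 1 | x. x \<in> I} \<subseteq> {f. L f \<in> ?F}"
      using D_add D_scale by (auto simp: L_diff L_scale L_single)
  qed
  then have rD: "r * D a b \<in> ?F" using mem L_scale L_single by auto
  have abI: "a \<in> I" "b \<in> I" using gen generated_superset[of "{a, b}" R "(*)"] by auto
  \<comment> \<open>The chosen coordinates of \<open>a\<close> and \<open>b\<close> need not be
    \<open>(1, 0)\<close> and \<open>(0, 1)\<close>, but they differ from these by relations, so
    \<open>D a b\<close> is 1 modulo \<open>?F\<close>.\<close>
  have rel: "(p a - 1) * a + q a * b = 0" "p b * a + (q b - 1) * b = 0"
    using pq(3)[OF abI(1)] pq(3)[OF abI(2)] by (simp_all add: algebra_simps)
  have m1: "p a - 1 \<in> ?F" "q a \<in> ?F"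
    by (rule pair_relation_mem[OF ab rel(1)]; use pq abI in auto)+
  have m2: "p b \<in> ?F" "q b - 1 \<in> ?F"
    by (rule pair_relation_mem[OF ab rel(2)]; use pq abI in auto)+
  have "D a b - 1 = q b * (p a - 1) + (q b - 1) - p b * q a"
    by (simp add: D_def algebra_simps)
  also have "\<dots> \<in> ?F"
    by (rule submodule_diff[OF F submodule_add[OF F submodule_scale[OF F _ m1(1)] m2(2)] submodule_scale[OF F _ m1(2)]])
      (use pq abI in auto)
  finally have "r * D a b - r * (D a b - 1) \<in> ?F"
    by (intro submodule_diff[OF F rD] submodule_scale[OF F \<open>r \<in> R\<close>])
  then show ?thesis by (simp add: algebra_simps)
qed

lemma ext_class_eq_iff:
  assumes "f \<in> free_module R (I \<times> I)" "g \<in> free_module R (I \<times> I)"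
  shows "ext_class R I f = ext_class R I g \<longleftrightarrow> f - g \<in> ext_relations R I"
proof
  note E = is_submodule_ext_relations[of I]
  assume "ext_class R I f = ext_class R I g"
  moreover have "f \<in> ext_class R I f" using assms submodule_zero[OF E] by (simp add: ext_class_def)
  ultimately show "f - g \<in> ext_relations R I" by (auto simp: ext_class_def)
next
  note E = is_submodule_ext_relations[of I]
  assume fg: "f - g \<in> ext_relations R I"
  have "pscale (- 1) (f - g) \<in> ext_relations R I"
    using fg by (intro submodule_scale[OF E]) auto
  moreover have "pscale (- 1) (f - g) = g - f"
    by (rule poly_mapping_eqI) (simp add: lookup_minus)
  ultimately have gf: "g - f \<in> ext_relations R I" by simp
  have "h - f \<in> ext_relations R I \<longleftrightarrow> h - g \<in> ext_relations R I" for h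
    using submodule_add[OF E fg, of "h - f"] submodule_add[OF E gf, of "h - g"] by auto
  then show "ext_class R I f = ext_class R I g" by (simp add: ext_class_def)
qed

section \<open>Transition matrices between generating pairs\<close>

text \<open>The rows of the matrix are \<open>(a, b)\<close> and \<open>(c, d)\<close>, acting on
  row vectors as in \<open>row_mult\<close>. The entries are quantified away because orbits depend
  on the determinant alone. It is not unique, whence a relation and not a function.\<close>

definition transition :: "'k \<times> 'k \<Rightarrow> 'k \<times> 'k \<Rightarrow> 'k \<Rightarrow> bool" where
  "transition v w \<delta> \<longleftrightarrow> (\<exists>a\<in>R. \<exists>b\<in>R. \<exists>c\<in>R. \<exists>d\<in>R.
     w = (a * fst v + c * snd v, b * fst v + d * snd v) \<and> \<delta> = a * d - b * c)"

lemma transitionI: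
  "a \<in> R \<Longrightarrow> b \<in> R \<Longrightarrow> c \<in> R \<Longrightarrow> d \<in> R \<Longrightarrow> fst w = a * fst v + c * snd v \<Longrightarrow>
   snd w = b * fst v + d * snd v \<Longrightarrow> \<delta> = a * d - b * c \<Longrightarrow> transition v w \<delta>"
  unfolding transition_def by (metis prod.collapse)

lemma transitionE:
  assumes "transition v w \<delta>"
  obtains a b c d where "a \<in> R" "b \<in> R" "c \<in> R" "d \<in> R" "fst w = a * fst v + c * snd v"
    "snd w = b * fst v + d * snd v" "\<delta> = a * d - b * c"
  using assms unfolding transition_def by auto

lemma transition_mem: "transition v w \<delta> \<Longrightarrow> \<delta> \<in> R"
  by (auto simp: transition_def)

lemma transition_refl: "transition v v 1"
  by (rule transitionI[of 1 0 0 1]) auto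

lemma transition_trans:
  assumes "transition u v \<delta>" "transition v w \<epsilon>"
  shows "transition u w (\<delta> * \<epsilon>)"
proof -
  obtain a b c d where 1: "a \<in> R" "b \<in> R" "c \<in> R" "d \<in> R" "fst v = a * fst u + c * snd u"
    "snd v = b * fst u + d * snd u" "\<delta> = a * d - b * c" using assms(1) by (rule transitionE)
  obtain a' b' c' d' where 2: "a' \<in> R" "b' \<in> R" "c' \<in> R" "d' \<in> R" "fst w = a' * fst v + c' * snd v"
    "snd w = b' * fst v + d' * snd v" "\<epsilon> = a' * d' - b' * c'" using assms(2) by (rule transitionE)
  show ?thesis
    by (rule transitionI[of "a' * a + c' * b" "b' * a + d' * b" "a' * c + c' * d" "b' * c + d' * d"])
      (use 1(1-4) 2(1-4) in \<open>auto simp: 1(5-7) 2(5-7) algebra_simps\<close>)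
qed

definition scale_pair :: "'k \<Rightarrow> 'k \<times> 'k \<Rightarrow> 'k \<times> 'k" where
  "scale_pair k v = (k * fst v, k * snd v)"

lemma scale_pair_simps [simp]: "fst (scale_pair k v) = k * fst v" "snd (scale_pair k v) = k * snd v"
  by (simp_all add: scale_pair_def)

lemma scale_pair_scale_pair [simp]: "scale_pair k (scale_pair l v) = scale_pair (k * l) v"
  by (simp add: scale_pair_def mult.assoc)

lemma scale_pair_1 [simp]: "scale_pair 1 v = v"
  by (simp add: scale_pair_def)

lemma scale_pair_eq_0 [simp]: "scale_pair k v = (0, 0) \<longleftrightarrow> k = 0 \<or> v = (0, 0)"
  by (cases v) (auto simp: scale_pair_def)

lemma transition_scale:
  assumes "transition v w \<delta>"
  shows "transition (scale_pair k v) (scale_pair k w) \<delta>"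
  using assms
proof (rule transitionE)
  fix a b c d
  assume *: "a \<in> R" "b \<in> R" "c \<in> R" "d \<in> R" "fst w = a * fst v + c * snd v"
    "snd w = b * fst v + d * snd v" "\<delta> = a * d - b * c"
  show ?thesis
    by (rule transitionI[of a b c d]) (use * in \<open>auto simp: algebra_simps\<close>)
qed

section \<open>Modules spanned by a pair\<close>

definition pair_span :: "'k \<times> 'k \<Rightarrow> 'k set" where
  "pair_span v = generated R (*) {fst v, snd v}"

lemma pair_span_eq: "pair_span v = {r * fst v + s * snd v | r s. r \<in> R \<and> s \<in> R}"
  unfolding pair_span_def by (rule generated_pair)

lemma generating_pairs_eq: "generating_pairs R I = {v. pair_span v = I}"
  by (auto simp: generating_pairs_def pair_span_def)

lemma is_submodule_pair_span: "is_submodule R (*) (pair_span v)"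
  unfolding pair_span_def by (rule is_submodule_generated)

lemma fst_mem_pair_span: "fst v \<in> pair_span v" and snd_mem_pair_span: "snd v \<in> pair_span v"
  using generated_superset[of "{fst v, snd v}" R "(*)"] by (auto simp: pair_span_def)

lemma pair_span_subset: "is_submodule R (*) I \<Longrightarrow> fst v \<in> I \<Longrightarrow> snd v \<in> I \<Longrightarrow> pair_span v \<subseteq> I"
  unfolding pair_span_def by (rule generated_minimal) auto

lemma pair_span_scale: "pair_span (scale_pair k v) = (*) k ` pair_span v"
proof -
  have "r * (k * a) + s * (k * b) = k * (r * a + s * b)" for r s a b by (simp add: algebra_simps)
  then show ?thesis by (simp add: pair_span_eq image_Collect) blast
qed

lemma pair_span_eq_0_iff: "pair_span v = {0} \<longleftrightarrow> v = (0, 0)"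
  using fst_mem_pair_span[of v] snd_mem_pair_span[of v] by (cases v) (auto simp: pair_span_eq)

lemma transition_exists: "pair_span w \<subseteq> pair_span v \<Longrightarrow> \<exists>\<delta>. transition v w \<delta>"
proof -
  assume "pair_span w \<subseteq> pair_span v"
  then have "fst w \<in> pair_span v" "snd w \<in> pair_span v"
    using fst_mem_pair_span[of w] snd_mem_pair_span[of w] by auto
  then obtain a b c d where "a \<in> R" "b \<in> R" "c \<in> R" "d \<in> R" "fst w = a * fst v + c * snd v"
    "snd w = b * fst v + d * snd v" by (auto simp: pair_span_eq)
  then show ?thesis by (intro exI transitionI[of a b c d]) auto
qed

lemma transition_pair_span: "transition v w \<delta> \<Longrightarrow> pair_span w \<subseteq> pair_span v"
  by (erule transitionE, rule pair_span_subset[OF is_submodule_pair_span])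
    (simp_all add: submodule_add[OF is_submodule_pair_span] submodule_scale[OF is_submodule_pair_span]
      fst_mem_pair_span snd_mem_pair_span)

definition Fit :: "'k \<times> 'k \<Rightarrow> 'k set" where
  "Fit v = trace_ideal (fst v) (snd v)"

lemma is_submodule_Fit: "is_submodule R (*) (Fit v)"
  unfolding Fit_def by (rule is_submodule_trace_ideal)

lemma Fit_subset: "Fit v \<subseteq> R"
  unfolding Fit_def by (rule trace_ideal_subset)

lemma fitting_ideal_pair_span: "v \<noteq> (0, 0) \<Longrightarrow> fitting_ideal R 1 (pair_span v) = Fit v"
  unfolding pair_span_def Fit_def by (rule fitting_ideal_pair) auto

lemma Fit_cong: "v \<noteq> (0, 0) \<Longrightarrow> pair_span v = pair_span w \<Longrightarrow> Fit v = Fit w"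
  by (metis fitting_ideal_pair_span pair_span_eq_0_iff)

text \<open>Makes visible that the conductor depends on the module alone, so that its elements can
  be moved from one generating pair to another.\<close>

lemma conductor_eq: "conductor (fst v) (snd v) = {c. \<forall>x\<in>pair_span v. c * x \<in> R}"
proof
  show "{c. \<forall>x\<in>pair_span v. c * x \<in> R} \<subseteq> conductor (fst v) (snd v)"
    using fst_mem_pair_span[of v] snd_mem_pair_span[of v] by (auto simp: conductor_def)
  show "conductor (fst v) (snd v) \<subseteq> {c. \<forall>x\<in>pair_span v. c * x \<in> R}"
    by (auto simp: conductor_def pair_span_eq distrib_left) (metis add_mem mult_mem mult.left_commute)
qed

text \<open>If \<open>v = v A\<close>, then the columns of \<open>A - 1\<close> are relations of
  \<open>v\<close>, hence \<open>A\<close> is the identity modulo \<open>Fit v\<close> in every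
  entry.\<close>

lemma transition_self:
  assumes "v \<noteq> (0, 0)" "transition v v \<delta>"
  shows "\<delta> - 1 \<in> Fit v"
  using assms(2)
proof (rule transitionE)
  fix a b c d
  assume *: "a \<in> R" "b \<in> R" "c \<in> R" "d \<in> R" "fst v = a * fst v + c * snd v"
    "snd v = b * fst v + d * snd v" "\<delta> = a * d - b * c"
  note F = is_submodule_Fit[of v]
  have v: "(fst v, snd v) \<noteq> (0, 0)" using assms(1) by simp
  have "(a - 1) * fst v + c * snd v = 0" "b * fst v + (d - 1) * snd v = 0"
    using *(5,6) by (simp_all add: algebra_simps)
  note rel = pair_relation_mem[OF v this(1)] pair_relation_mem[OF v this(2)]
  have "d * (a - 1) + (d - 1) - b * c \<in> Fit v"
    by (rule submodule_diff[OF F submodule_add[OF F submodule_scale[OF F]] submodule_scale[OF F]])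
      (use rel * in \<open>auto simp: Fit_def\<close>)
  then show ?thesis by (simp add: *(7) algebra_simps)
qed

lemma transition_unit:
  assumes "v \<noteq> (0, 0)" "transition v w \<delta>" "transition w v \<epsilon>"
  shows "\<delta> * \<epsilon> - 1 \<in> Fit v"
  using transition_self[OF assms(1) transition_trans[OF assms(2,3)]] .

text \<open>Both determinants are inverse to the determinant of a transition back, and inverses
  modulo \<open>Fit v\<close> are unique.\<close>

lemma transition_unique:
  assumes "v \<noteq> (0, 0)" "pair_span v = pair_span w" "transition v w \<delta>" "transition v w \<delta>'"
  shows "\<delta> - \<delta>' \<in> Fit v"
proof -
  obtain \<epsilon> where \<epsilon>: "transition w v \<epsilon>" using transition_exists assms(2) by blast
  note F = is_submodule_Fit[of v]
  have "\<delta> * (\<delta>' * \<epsilon> - 1) \<in> Fit v" "\<delta>' * (\<delta> * \<epsilon> - 1) \<in> Fit v"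
    using assms \<epsilon> by (auto intro!: submodule_scale[OF F] transition_unit elim: transition_mem)
  from submodule_diff[OF F this(2,1)] show ?thesis by (simp add: algebra_simps)
qed

text \<open>If \<open>w = v A\<close>, adding the rank one matrix with columns \<open>l (- v\<^sub>2, v\<^sub>1)\<close> and \<open>k (- v\<^sub>2, v\<^sub>1)\<close>
  to \<open>A\<close> preserves this equation and changes the determinant by \<open>k w\<^sub>1 - l w\<^sub>2\<close>.\<close>

lemma transition_adjust:
  assumes "v \<noteq> (0, 0)" "pair_span v = pair_span w" "transition v w \<delta>" "\<delta>' - \<delta> \<in> Fit v"
  shows "transition v w \<delta>'"
  using assms(3)
proof (rule transitionE)
  fix a b c d
  assume *: "a \<in> R" "b \<in> R" "c \<in> R" "d \<in> R" "fst w = a * fst v + c * snd v"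
    "snd w = b * fst v + d * snd v" "\<delta> = a * d - b * c"
  \<comment> \<open>The determinant will change by a combination of the entries of \<open>w\<close>,
    so the difference is expanded over \<open>w\<close>, whereas the new matrix has entries in
    \<open>R\<close> because of a condition on \<open>v\<close>. The two pairs share their Fitting
    ideal and their conductor.\<close>
  have "\<delta>' - \<delta> \<in> trace_ideal (fst w) (snd w)"
    using assms Fit_cong[of v w] by (simp add: Fit_def)
  then obtain k l where kl: "k \<in> conductor (fst w) (snd w)" "l \<in> conductor (fst w) (snd w)"
    and \<delta>': "\<delta>' - \<delta> = k * fst w + l * snd w" by (rule trace_idealE)
  have "k \<in> conductor (fst v) (snd v)" "l \<in> conductor (fst v) (snd v)"
    using kl assms(2) by (simp_all add: conductor_eq)
  then have mem: "k * fst v \<in> R" "k * snd v \<in> R" "l * fst v \<in> R" "l * snd v \<in> R"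
    by (auto simp: conductor_def)
  show ?thesis
    by (rule transitionI[of "a + l * snd v" "b - k * snd v" "c - l * fst v" "d + k * fst v"])
      (use * mem \<delta>' in \<open>auto simp: algebra_simps\<close>)
qed

section \<open>The group of units of the quotient ring\<close>

definition coset :: "'k set \<Rightarrow> 'k \<Rightarrow> 'k set" where
  "coset F a = F +>\<^bsub>ring_on R\<^esub> a"

lemma ring_on_sel [simp]: "carrier (ring_on S) = S" "x \<otimes>\<^bsub>ring_on S\<^esub> y = x * y" "\<one>\<^bsub>ring_on S\<^esub> = 1"
  "\<zero>\<^bsub>ring_on S\<^esub> = 0" "x \<oplus>\<^bsub>ring_on S\<^esub> y = x + y"
  by (simp_all add: ring_on_def)

lemma cring_ring_on: "cring (ring_on R)"
proof (rule cringI)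
  show "abelian_group (ring_on R)"
  proof (rule abelian_groupI)
    fix x assume "x \<in> carrier (ring_on R)"
    then show "\<exists>y\<in>carrier (ring_on R). y \<oplus>\<^bsub>ring_on R\<^esub> x = \<zero>\<^bsub>ring_on R\<^esub>"
      by (intro bexI[of _ "- x"]) auto
  qed (auto simp: algebra_simps)
  show "comm_monoid (ring_on R)"
    by (rule comm_monoidI) (auto simp: algebra_simps)
qed (simp add: distrib_right)

lemma ideal_ring_on:
  assumes F: "is_submodule R (*) F" "F \<subseteq> R"
  shows "ideal F (ring_on R)"
proof -
  interpret cring "ring_on R" by (rule cring_ring_on)
  have inv: "inv\<^bsub>add_monoid (ring_on R)\<^esub> x = - x" if "x \<in> R" for x
    using that minus_equality[of "- x" x] by (auto simp: a_inv_def)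
  show ?thesis
  proof (rule idealI)
    show "subgroup F (add_monoid (ring_on R))"
    proof (rule subgroup.intro)
      show "inv\<^bsub>add_monoid (ring_on R)\<^esub> x \<in> F" if "x \<in> F" for x
        using that F(2) by (subst inv) (auto intro: submodule_uminus[OF F(1)])
    qed (simp_all add: F(2) submodule_zero[OF F(1)] submodule_add[OF F(1)])
    show "a \<otimes>\<^bsub>ring_on R\<^esub> x \<in> F" "x \<otimes>\<^bsub>ring_on R\<^esub> a \<in> F" if "a \<in> F" "x \<in> carrier (ring_on R)" for a x
      using that submodule_scale[OF F(1), of x a] by (simp_all add: mult.commute)
  qed (rule ring_axioms)
qed

context
  fixes F assumes F: "is_submodule R (*) F" "F \<subseteq> R"
begin

lemma coset_alt: "coset F a = {f + a | f. f \<in> F}"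
  by (auto simp: coset_def a_r_coset_def r_coset_def ring_on_def)

lemma mem_coset_iff: "x \<in> coset F a \<longleftrightarrow> x - a \<in> F"
  unfolding coset_alt by (auto intro: exI[of _ "x - a"])

lemma coset_eq_iff: "coset F a = coset F b \<longleftrightarrow> a - b \<in> F"
proof
  assume "coset F a = coset F b"
  moreover have "a \<in> coset F a" using submodule_zero[OF F(1)] by (simp add: mem_coset_iff)
  ultimately show "a - b \<in> F" by (simp add: mem_coset_iff)
next
  assume ab: "a - b \<in> F"
  have "x - a \<in> F \<longleftrightarrow> x - b \<in> F" for x
    using submodule_add[OF F(1) _ ab, of "x - a"] submodule_diff[OF F(1) _ ab, of "x - b"] by auto
  then show "coset F a = coset F b" by (auto simp: mem_coset_iff)
qed

abbreviation "units_mod \<equiv> units_of (ring_on R Quot F)"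

lemma Quot_sel:
  "carrier (ring_on R Quot F) = coset F ` R"
  "a \<in> R \<Longrightarrow> b \<in> R \<Longrightarrow> coset F a \<otimes>\<^bsub>ring_on R Quot F\<^esub> coset F b = coset F (a * b)"
  "\<one>\<^bsub>ring_on R Quot F\<^esub> = coset F 1"
proof -
  interpret ideal F "ring_on R" by (rule ideal_ring_on[OF F])
  show "carrier (ring_on R Quot F) = coset F ` R"
    by (auto simp: FactRing_def A_RCOSETS_def' a_r_coset_def' coset_def)
  show "a \<in> R \<Longrightarrow> b \<in> R \<Longrightarrow> coset F a \<otimes>\<^bsub>ring_on R Quot F\<^esub> coset F b = coset F (a * b)"
    using rcoset_mult_add[of a b] by (simp add: FactRing_simps coset_def)
  show "\<one>\<^bsub>ring_on R Quot F\<^esub> = coset F 1"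
    by (simp add: FactRing_simps coset_def)
qed

lemma carrier_units_mod: "carrier units_mod = {coset F a | a. a \<in> R \<and> (\<exists>b\<in>R. a * b - 1 \<in> F)}"
proof -
  have "(\<exists>y\<in>carrier (ring_on R Quot F). y \<otimes>\<^bsub>ring_on R Quot F\<^esub> coset F a = \<one>\<^bsub>ring_on R Quot F\<^esub> \<and>
      coset F a \<otimes>\<^bsub>ring_on R Quot F\<^esub> y = \<one>\<^bsub>ring_on R Quot F\<^esub>) \<longleftrightarrow> (\<exists>b\<in>R. a * b - 1 \<in> F)" if "a \<in> R" for a
    using that by (simp add: Quot_sel coset_eq_iff mult.commute[of _ a] cong: bex_cong)
  note key = this
  have "carrier units_mod = {coset F a | a. a \<in> R \<and>
    (\<exists>y\<in>carrier (ring_on R Quot F). y \<otimes>\<^bsub>ring_on R Quot F\<^esub> coset F a = \<one>\<^bsub>ring_on R Quot F\<^esub> \<and>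
      coset F a \<otimes>\<^bsub>ring_on R Quot F\<^esub> y = \<one>\<^bsub>ring_on R Quot F\<^esub>)}"
    unfolding units_of_carrier Units_def Quot_sel(1) image_def by fast
  also have "\<dots> = {coset F a | a. a \<in> R \<and> (\<exists>b\<in>R. a * b - 1 \<in> F)}"
    by (simp only: key cong: conj_cong)
  finally show ?thesis .
qed

lemma mult_units_mod: "a \<in> R \<Longrightarrow> b \<in> R \<Longrightarrow> coset F a \<otimes>\<^bsub>units_mod\<^esub> coset F b = coset F (a * b)"
  by (simp add: units_of_mult Quot_sel)

lemma one_units_mod: "\<one>\<^bsub>units_mod\<^esub> = coset F 1"
  by (simp add: units_of_one Quot_sel)

lemma comm_group_units_mod: "comm_group units_mod"
proof -
  interpret cring "ring_on R Quot F"
    using ideal.quotient_is_cring[OF ideal_ring_on[OF F] cring_ring_on] .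
  show ?thesis by (rule units_comm_group)
qed

end

section \<open>Determinants of generating pairs and of multipliers\<close>

text \<open>Here the exterior square is eliminated in favour of transition matrices. If the classes
  agree, then \<open>r - \<delta>\<close> annihilates the class of \<open>v\<close> and so lies in
  \<open>Fit v\<close>. Conversely, \<open>r\<close> is itself the determinant of an adjusted
  matrix, and the minor rule applies to that matrix.\<close>

lemma ext_class_transition:
  assumes v: "v \<noteq> (0, 0)" and vw: "pair_span v = pair_span w" and \<delta>: "transition v w \<delta>" and r: "r \<in> R"
  shows "ext_class R (pair_span v) (Poly_Mapping.single w 1) =
      ext_class R (pair_span v) (pscale r (Poly_Mapping.single v 1)) \<longleftrightarrow> r - \<delta> \<in> Fit v"
proof -
  let ?I = "pair_span v"
  let ?E = "ext_relations R ?I"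
  note E = is_submodule_ext_relations[of ?I]
  have minor: "Poly_Mapping.single w 1 - pscale \<epsilon> (Poly_Mapping.single v 1) \<in> ?E" if "transition v w \<epsilon>" for \<epsilon>
    using that
  proof (rule transitionE)
    fix a b c d
    assume *: "a \<in> R" "b \<in> R" "c \<in> R" "d \<in> R" "fst w = a * fst v + c * snd v"
      "snd w = b * fst v + d * snd v" "\<epsilon> = a * d - b * c"
    show ?thesis
      using ext_square_minor[OF is_submodule_pair_span fst_mem_pair_span snd_mem_pair_span *(1-4), of v]
      unfolding *(5-7)[symmetric] by simp
  qed
  have mem: "w \<in> ?I \<times> ?I" "v \<in> ?I \<times> ?I"
    using fst_mem_pair_span[of v] snd_mem_pair_span[of v] fst_mem_pair_span[of w] snd_mem_pair_span[of w]
    by (simp_all add: vw mem_Times_iff)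
  have free: "Poly_Mapping.single w 1 \<in> free_module R (?I \<times> ?I)"
    "pscale r (Poly_Mapping.single v 1) \<in> free_module R (?I \<times> ?I)"
    using mem r by (auto simp: free_module_iff lookup_single when_def)
  have "Poly_Mapping.single w 1 - pscale r (Poly_Mapping.single v 1) \<in> ?E \<longleftrightarrow> r - \<delta> \<in> Fit v"
  proof
    assume "Poly_Mapping.single w 1 - pscale r (Poly_Mapping.single v 1) \<in> ?E"
    then have "(Poly_Mapping.single w 1 - pscale \<delta> (Poly_Mapping.single v 1)) +
        pscale (- 1) (Poly_Mapping.single w 1 - pscale r (Poly_Mapping.single v 1)) \<in> ?E"
      by (rule submodule_add[OF E minor[OF \<delta>] submodule_scale[OF E uminus_mem[OF one_mem]]])
    also have "(Poly_Mapping.single w 1 - pscale \<delta> (Poly_Mapping.single v 1)) +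
        pscale (- 1) (Poly_Mapping.single w 1 - pscale r (Poly_Mapping.single v 1)) =
        pscale (r - \<delta>) (Poly_Mapping.single (fst v, snd v) 1)"
      by (rule poly_mapping_eqI) (simp add: lookup_add lookup_minus algebra_simps)
    finally show "r - \<delta> \<in> Fit v"
      unfolding Fit_def using v transition_mem[OF \<delta>] r
      by (intro ext_square_annihilator[where I = ?I]) (auto simp: pair_span_def)
  next
    assume "r - \<delta> \<in> Fit v"
    then show "Poly_Mapping.single w 1 - pscale r (Poly_Mapping.single v 1) \<in> ?E"
      by (intro minor transition_adjust[OF v vw \<delta>])
  qed
  then show ?thesis by (simp only: ext_class_eq_iff[OF free])
qed

lemma fitting_units_pair_span: "v \<noteq> (0, 0) \<Longrightarrow> fitting_units R (pair_span v) = units_mod (Fit v)"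
  unfolding fitting_units_def
  by (rule arg_cong[of _ _ "\<lambda>F. units_mod F"], rule fitting_ideal_pair_span)

lemmas coset_Fit_eq_iff = coset_eq_iff[OF is_submodule_Fit Fit_subset]
  and carrier_units_mod_Fit = carrier_units_mod[OF is_submodule_Fit Fit_subset]

lemma coset_transition_mem_units:
  assumes "v \<noteq> (0, 0)" "pair_span v = pair_span w" "transition v w \<delta>"
  shows "coset (Fit v) \<delta> \<in> carrier (units_mod (Fit v))"
proof -
  obtain \<epsilon> where "transition w v \<epsilon>" using transition_exists assms(2) by blast
  then have "\<delta> * \<epsilon> - 1 \<in> Fit v" "\<delta> \<in> R" "\<epsilon> \<in> R"
    using transition_unit[OF assms(1,3)] assms(3) by (auto elim: transition_mem)
  then show ?thesis unfolding carrier_units_mod_Fit by blast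
qed

text \<open>The definite description is unique since any representative that acts correctly is
  congruent to \<open>\<delta>\<close>, which fixes its class.\<close>

lemma det_wrt_eq:
  assumes "v \<noteq> (0, 0)" "pair_span v = pair_span w" "transition v w \<delta>"
  shows "det_wrt R (pair_span v) v w = coset (Fit v) \<delta>"
  unfolding det_wrt_def fitting_units_pair_span[OF assms(1)]
proof (rule the_equality)
  note F = is_submodule_Fit[of v] Fit_subset[of v]
  have "\<delta> \<in> coset (Fit v) \<delta>" using submodule_zero[OF F(1)] by (simp add: mem_coset_iff[OF F])
  then show "coset (Fit v) \<delta> \<in> carrier (units_mod (Fit v)) \<and>
    (\<exists>r\<in>coset (Fit v) \<delta>. ext_class R (pair_span v) (Poly_Mapping.single w 1) =
      ext_class R (pair_span v) (pscale r (Poly_Mapping.single v 1)))"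
    using coset_transition_mem_units[OF assms] ext_class_transition[OF assms transition_mem[OF assms(3)]]
      submodule_zero[OF F(1)] by auto
next
  note F = is_submodule_Fit[of v] Fit_subset[of v]
  fix c
  assume "c \<in> carrier (units_mod (Fit v)) \<and>
    (\<exists>r\<in>c. ext_class R (pair_span v) (Poly_Mapping.single w 1) =
      ext_class R (pair_span v) (pscale r (Poly_Mapping.single v 1)))"
  then obtain a r where a: "c = coset (Fit v) a" "a \<in> R" and r: "r \<in> c"
    and eq: "ext_class R (pair_span v) (Poly_Mapping.single w 1) =
      ext_class R (pair_span v) (pscale r (Poly_Mapping.single v 1))"
    by (auto simp: carrier_units_mod_Fit)
  have ra: "r - a \<in> Fit v" using r a by (simp add: mem_coset_iff[OF F])
  then have "r - a + a \<in> R" using F(2) a(2) by blast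
  then have "r - \<delta> \<in> Fit v" using ext_class_transition[OF assms, of r] eq by simp
  then have "(r - \<delta>) - (r - a) \<in> Fit v" using submodule_diff[OF F(1)] ra by blast
  then show "c = coset (Fit v) \<delta>" by (simp add: a coset_Fit_eq_iff)
qed

text \<open>Another generating pair \<open>w\<close> yields the conjugate
  \<open>\<alpha> * \<delta> * \<beta>\<close>, where \<open>\<beta> * \<alpha>\<close> is 1 modulo
  \<open>Fit v\<close>. The class is thus the same for all pairs, as the definite description
  demands.\<close>

lemma det_multiplier_eq:
  assumes v: "v \<noteq> (0, 0)" and u: "(*) u ` pair_span v = pair_span v"
    and \<delta>: "transition v (scale_pair u v) \<delta>"
  shows "det_multiplier R (pair_span v) u = coset (Fit v) \<delta>"
proof -
  have eq: "det_wrt R (pair_span v) w (scale_pair u w) = coset (Fit v) \<delta>" if w: "pair_span w = pair_span v" for w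
  proof -
    note F = is_submodule_Fit[of v]
    have w0: "w \<noteq> (0, 0)" using w v pair_span_eq_0_iff by metis
    have uw: "pair_span w = pair_span (scale_pair u w)" by (simp add: pair_span_scale w u)
    obtain \<alpha> \<beta> where \<alpha>: "transition w v \<alpha>" and \<beta>: "transition v w \<beta>"
      using transition_exists w by blast
    have tr: "transition w (scale_pair u w) (\<alpha> * \<delta> * \<beta>)"
      by (intro transition_trans[OF transition_trans[OF \<alpha> \<delta>]] transition_scale \<beta>)
    have "det_wrt R (pair_span w) w (scale_pair u w) = coset (Fit w) (\<alpha> * \<delta> * \<beta>)"
      by (rule det_wrt_eq[OF w0 uw tr])
    moreover have "\<delta> * (\<beta> * \<alpha> - 1) \<in> Fit v"
      using transition_unit[OF v \<beta> \<alpha>] transition_mem[OF \<delta>] by (intro submodule_scale[OF F])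
    then have "\<alpha> * \<delta> * \<beta> - \<delta> \<in> Fit v" by (simp add: algebra_simps)
    ultimately show ?thesis
      using Fit_cong[OF v w[symmetric]] by (simp add: w coset_Fit_eq_iff)
  qed
  show ?thesis
    unfolding det_multiplier_def
  proof (rule the_equality)
    show "\<exists>(m1, m2)\<in>generating_pairs R (pair_span v). coset (Fit v) \<delta> =
        det_wrt R (pair_span v) (m1, m2) (u * m1, u * m2)"
      using eq[of v] by (intro bexI[of _ "(fst v, snd v)"]) (simp_all add: generating_pairs_eq scale_pair_def case_prod_unfold)
    show "c = coset (Fit v) \<delta>" if c: "\<exists>(m1, m2)\<in>generating_pairs R (pair_span v). c =
        det_wrt R (pair_span v) (m1, m2) (u * m1, u * m2)" for c
    proof -
      obtain m1 m2 where "(m1, m2) \<in> generating_pairs R (pair_span v)"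
        "c = det_wrt R (pair_span v) (m1, m2) (u * m1, u * m2)"
        using c by auto
      then show ?thesis using eq[of "(m1, m2)"] by (simp add: generating_pairs_eq scale_pair_def)
    qed
  qed
qed

text \<open>The condition \<open>u I = I\<close> sums up that both \<open>u\<close> and its inverse
  map \<open>I\<close> into itself.\<close>

lemma Units_multipliers:
  assumes "fraction_field R = UNIV" "I \<noteq> {0}" "is_submodule R (*) I"
  shows "Units (ring_on (multipliers R I)) = {u. u \<noteq> 0 \<and> (*) u ` I = I}"
proof (intro equalityI subsetI)
  fix u assume "u \<in> Units (ring_on (multipliers R I))"
  then obtain y where u: "(*) u ` I \<subseteq> I" and y: "(*) y ` I \<subseteq> I" "u * y = 1"
    by (auto simp: Units_def multipliers_def)
  have "x \<in> (*) u ` I" if "x \<in> I" for x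
    using y that by (intro image_eqI[of _ _ "y * x"]) (auto simp flip: mult.assoc)
  then show "u \<in> {u. u \<noteq> 0 \<and> (*) u ` I = I}" using u y by auto
next
  fix u assume "u \<in> {u. u \<noteq> 0 \<and> (*) u ` I = I}"
  then have u: "u \<noteq> 0" "(*) u ` I = I" by auto
  have "inverse u * x \<in> I" if x: "x \<in> I" for x
  proof -
    obtain z where "z \<in> I" "x = u * z" using u(2) x by blast
    then show ?thesis using u(1) by (simp add: mult.assoc[symmetric])
  qed
  then show "u \<in> Units (ring_on (multipliers R I))"
    using u assms(1) by (simp add: Units_def multipliers_def) (intro exI[of _ "inverse u"], auto)
qed

lemma eps_pair_span:
  assumes "fraction_field R = UNIV" "v \<noteq> (0, 0)"
  shows "eps R (pair_span v) = {coset (Fit v) \<delta> | u \<delta>. u \<noteq> 0 \<and> (*) u ` pair_span v = pair_span v \<and>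
    transition v (scale_pair u v) \<delta>}"
proof -
  have "pair_span v \<noteq> {0}" using assms pair_span_eq_0_iff by simp
  note U = Units_multipliers[OF assms(1) this is_submodule_pair_span]
  have ex: "\<exists>\<delta>. transition v (scale_pair u v) \<delta>" if "(*) u ` pair_span v = pair_span v" for u
    by (rule transition_exists) (simp add: pair_span_scale that)
  show ?thesis
    unfolding eps_def U
  proof (intro equalityI subsetI)
    fix c assume "c \<in> det_multiplier R (pair_span v) ` {u. u \<noteq> 0 \<and> (*) u ` pair_span v = pair_span v}"
    then obtain u where u: "u \<noteq> 0" "(*) u ` pair_span v = pair_span v" "c = det_multiplier R (pair_span v) u"
      by blast
    obtain \<delta> where \<delta>: "transition v (scale_pair u v) \<delta>" using ex[OF u(2)] by blast
    have "c = coset (Fit v) \<delta>" unfolding u(3) by (rule det_multiplier_eq[OF assms(2) u(2) \<delta>])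
    then show "c \<in> {coset (Fit v) \<delta> | u \<delta>. u \<noteq> 0 \<and> (*) u ` pair_span v = pair_span v \<and>
        transition v (scale_pair u v) \<delta>}" using u(1,2) \<delta> by blast
  next
    fix c assume "c \<in> {coset (Fit v) \<delta> | u \<delta>. u \<noteq> 0 \<and> (*) u ` pair_span v = pair_span v \<and>
        transition v (scale_pair u v) \<delta>}"
    then obtain u \<delta> where u: "u \<noteq> 0" "(*) u ` pair_span v = pair_span v" and \<delta>: "transition v (scale_pair u v) \<delta>"
      and c: "c = coset (Fit v) \<delta>" by blast
    show "c \<in> det_multiplier R (pair_span v) ` {u. u \<noteq> 0 \<and> (*) u ` pair_span v = pair_span v}"
      using det_multiplier_eq[OF assms(2) u(2) \<delta>] u by (intro image_eqI[of _ _ u]) (simp_all add: c)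
  qed
qed

end

section \<open>Surjectivity of the determinant\<close>

text \<open>The two arithmetic properties of an order behind surjectivity and counting: every field
  element is a fraction, and \<open>R / c R\<close> is finite. The latter is expressed by a finite
  set of representatives.\<close>

locale residually_finite_subring = field_subring R for R :: "'k::field set" +
  assumes fraction_field_UNIV: "fraction_field R = UNIV"
    and finite_residues: "c \<in> R \<Longrightarrow> c \<noteq> 0 \<Longrightarrow>
      \<exists>T. finite T \<and> T \<subseteq> R \<and> (\<forall>x\<in>R. \<exists>t\<in>T. \<exists>y\<in>R. x - t = c * y)"
begin

text \<open>Two powers of \<open>r\<close> agree in the finite ring \<open>R / c R\<close>, hence
  modulo \<open>A\<close>. From there on the powers are periodic, and some positive power is
  idempotent.\<close>

lemma power_idempotent:
  assumes A: "is_submodule R (*) A" and c: "c \<in> A" "c \<in> R" "c \<noteq> 0" and r: "r \<in> R"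
  shows "\<exists>n. r ^ Suc n * (1 - r ^ Suc n) \<in> A"
proof -
  obtain T where T: "finite T" "\<forall>x\<in>R. \<exists>t\<in>T. \<exists>y\<in>R. x - t = c * y"
    using finite_residues[OF c(2,3)] by blast
  have "\<forall>i. \<exists>t\<in>T. \<exists>y\<in>R. r ^ i - t = c * y" using T r by blast
  then obtain f g where f: "\<And>i::nat. f i \<in> T" and g: "\<And>i. g i \<in> R" "\<And>i. r ^ i - f i = c * g i"
    by metis
  have "finite (range f)" using f T(1) by (auto intro: finite_subset)
  then have "\<not> inj f" using finite_imageD[of f UNIV] by auto
  then obtain i j where ij: "i < j" "f i = f j"
    by (metis linorder_neqE_nat inj_onI)
  define d where "d = j - i"
  have d: "j = i + d" "d > 0" using ij by (auto simp: d_def)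
  have "r ^ i - r ^ j = (r ^ i - f i) - (r ^ j - f j)" using ij by simp
  also have "\<dots> = (g i - g j) * c" using g by (simp add: algebra_simps)
  finally have "r ^ i - r ^ j \<in> A"
    using submodule_scale[OF A diff_mem[OF g(1) g(1)] c(1)] by simp
  then have base: "r ^ i * (1 - r ^ d) \<in> A"
    by (simp add: d power_add right_diff_distrib)
  have step: "r ^ i * (1 - r ^ (d * k)) \<in> A" for k
  proof (induction k)
    case (Suc k)
    have "r ^ i * (1 - r ^ (d * Suc k)) = r ^ (d * k) * (r ^ i * (1 - r ^ d)) + r ^ i * (1 - r ^ (d * k))"
      by (simp add: power_add algebra_simps)
    then show ?case using Suc base r by (auto intro!: submodule_add[OF A] submodule_scale[OF A])
  qed (simp add: submodule_zero[OF A])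
  \<comment> \<open>A positive multiple of the period \<open>d\<close> that is at least the
    preperiod \<open>i\<close>.\<close>
  define n where "n = d * Suc i"
  have "n > 0" using d by (simp add: n_def)
  have "1 * i \<le> d * Suc i" using d by (intro mult_le_mono) auto
  then have "n \<ge> i" by (simp only: n_def mult_1)
  have "r ^ (n - i) * (r ^ i * (1 - r ^ n)) \<in> A"
    by (rule submodule_scale[OF A power_mem[OF r] step[of "Suc i", folded n_def]])
  moreover have "r ^ (n - i) * r ^ i = r ^ n" using \<open>n \<ge> i\<close> by (simp flip: power_add)
  ultimately have "r ^ n * (1 - r ^ n) \<in> A" by (simp flip: mult.assoc)
  then show ?thesis using \<open>n > 0\<close> by (metis gr0_implies_Suc)
qed

text \<open>Modulo the annihilator \<open>A\<close> of \<open>(Ra + Rb) / Rb\<close>, a power \<open>e\<close> of \<open>r\<close> is idempotent, so that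
  \<open>r' = r e + 1 - e\<close> is a unit modulo \<open>A\<close> and congruent to \<open>r\<close> modulo the Fitting ideal. Hence
  \<open>(r' a, b)\<close> is a generating pair.\<close>

lemma transition_surj:
  assumes v: "v \<noteq> (0, 0)" and r: "r \<in> R" and s: "s \<in> R" and rs: "r * s - 1 \<in> Fit v"
  shows "\<exists>w. pair_span w = pair_span v \<and> transition v w r"
proof (cases "snd v = 0")
  \<comment> \<open>With one zero generator the module is principal, so \<open>Fit v\<close>
    contains 1 and every \<open>r\<close> is congruent to 1.\<close>
  case True
  then have a: "fst v \<noteq> 0" using v by (cases v) auto
  have "inverse (fst v) * fst v + 0 * snd v \<in> Fit v"
    unfolding Fit_def by (rule trace_idealI) (use a True in \<open>auto simp: conductor_def\<close>)
  then have "1 \<in> Fit v" using a by simp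
  then have "(r - 1) * 1 \<in> Fit v" using r by (intro submodule_scale[OF is_submodule_Fit]) auto
  then have "transition v v r" by (intro transition_adjust[OF v refl transition_refl]) simp
  then show ?thesis by blast
next
  case False
  note F = is_submodule_Fit[of v]
  define a b where "a = fst v" and "b = snd v"
  have ab: "(a, b) \<noteq> (0, 0)" "b \<noteq> 0" using v False by (auto simp: a_def b_def)
  define A where "A = {x \<in> R. \<exists>y\<in>R. x * a = y * b}"
  have A: "is_submodule R (*) A"
    unfolding is_submodule_def
  proof (intro conjI ballI)
    show "0 \<in> A" by (auto simp: A_def)
    fix x assume "x \<in> A"
    then obtain y where x: "x \<in> R" "y \<in> R" "x * a = y * b" unfolding A_def by blast
    show "c * x \<in> A" if "c \<in> R" for c
      unfolding A_def using that x by (intro CollectI conjI bexI[of _ "c * y"]) (auto simp: mult.assoc)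
    fix x' assume "x' \<in> A"
    then obtain y' where "x' \<in> R" "y' \<in> R" "x' * a = y' * b" unfolding A_def by blast
    then show "x + x' \<in> A"
      unfolding A_def using x by (intro CollectI conjI bexI[of _ "y + y'"]) (auto simp: distrib_right)
  qed
  \<comment> \<open>If \<open>x a = y b\<close>, then \<open>x\<close> is the first entry of the
    relation \<open>(x, - y)\<close>.\<close>
  have A_Fit: "x \<in> Fit v" if x: "x \<in> A" for x
  proof -
    obtain y where "x \<in> R" "y \<in> R" "x * a = y * b" using x unfolding A_def by blast
    then show ?thesis
      using pair_relation_mem(1)[OF ab(1), of x "- y"] by (auto simp: Fit_def a_def b_def)
  qed
  \<comment> \<open>A denominator of \<open>a / b\<close> is a nonzero element of \<open>A\<close>,
    which makes the quotient by \<open>A\<close> finite.\<close>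
  have "a / b \<in> fraction_field R" using fraction_field_UNIV by simp
  then obtain p q where "p \<in> R" "q \<in> R" "q \<noteq> 0" "a / b = p / q" by (auto simp: fraction_field_def)
  then have "q \<in> A" "q \<in> R" "q \<noteq> 0" using ab(2) by (auto simp: A_def field_simps)
  then obtain n where n: "r ^ Suc n * (1 - r ^ Suc n) \<in> A"
    using power_idempotent[OF A _ _ _ r] by blast
  define e g where "e = r ^ Suc n" and "g = r ^ n"
  have eg: "e = r * g" "e \<in> R" "g \<in> R" "e * (1 - e) \<in> A"
    using r n by (auto simp: e_def g_def)
  \<comment> \<open>\<open>s'\<close> is the inverse of \<open>r'\<close> modulo \<open>A\<close>.
    On the component of the idempotent \<open>e\<close> it is \<open>g\<close>, the inverse of
    \<open>r\<close> there; on the component of \<open>1 - e\<close> both are 1.\<close>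
  define r' s' where "r' = r * e + (1 - e)" and "s' = g * e + (1 - e)"
  have mem: "r' \<in> R" "s' \<in> R" using r eg by (auto simp: r'_def s'_def)
  have "r' * s' - 1 = (r + g - e - 2) * (e * (1 - e))"
    by (simp add: r'_def s'_def eg(1) algebra_simps)
  moreover have "r + g - e - 2 \<in> R" using r eg of_nat_mem[of 2] by auto
  ultimately have unit: "r' * s' - 1 \<in> A" using submodule_scale[OF A _ eg(4)] by simp
  have pow: "r ^ k * s ^ k - 1 \<in> Fit v" for k
  proof (induction k)
    case (Suc k)
    have "r ^ Suc k * s ^ Suc k - 1 = (r * s) * (r ^ k * s ^ k - 1) + (r * s - 1)"
      by (simp add: algebra_simps)
    then show ?case
      using submodule_add[OF F submodule_scale[OF F mult_mem[OF r s] Suc] rs] by (simp only:)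
  qed (simp add: submodule_zero[OF F])
  \<comment> \<open>As \<open>r\<close> is a unit modulo \<open>Fit v\<close>, so is its power
    \<open>e\<close>; being idempotent there, it is 1. Cancelling \<open>e\<close> means multiplying
    by \<open>s ^ Suc n\<close>.\<close>
  have "s ^ Suc n * (e * (1 - e)) - (1 - e) * (r ^ Suc n * s ^ Suc n - 1) \<in> Fit v"
    by (rule submodule_diff[OF F submodule_scale[OF F power_mem[OF s] A_Fit[OF eg(4)]]
          submodule_scale[OF F diff_mem[OF one_mem eg(2)] pow]])
  also have "s ^ Suc n * (e * (1 - e)) - (1 - e) * (r ^ Suc n * s ^ Suc n - 1) = 1 - e"
    unfolding e_def[symmetric] by (simp add: algebra_simps)
  finally have "(r - 1) * (1 - e) \<in> Fit v" using r by (intro submodule_scale[OF F]) auto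
  then have r'r: "r - r' \<in> Fit v" by (simp add: r'_def algebra_simps)
  let ?w = "(r' * a, b)"
  have tr: "transition v ?w r'"
    by (rule transitionI[of r' 0 0 1]) (use mem in \<open>auto simp: a_def b_def\<close>)
  have "pair_span v \<subseteq> pair_span ?w"
  proof (rule pair_span_subset[OF is_submodule_pair_span])
    \<comment> \<open>Since \<open>r' * s' - 1\<close> maps \<open>a\<close> into
      \<open>R b\<close>, the generator \<open>a\<close> is recovered from \<open>r' * a\<close> and
      \<open>b\<close>.\<close>
    obtain y where y: "y \<in> R" "(r' * s' - 1) * a = y * b" using unit by (auto simp: A_def)
    have "s' * (r' * a) + (- y) * b \<in> pair_span ?w"
      unfolding pair_span_eq fst_conv snd_conv using mem y(1) uminus_mem by blast
    also have "s' * (r' * a) + (- y) * b = fst v"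
      using y(2) by (simp add: a_def algebra_simps)
    finally show "fst v \<in> pair_span ?w" .
    show "snd v \<in> pair_span ?w" using snd_mem_pair_span[of ?w] by (simp add: b_def)
  qed
  then have "pair_span ?w = pair_span v" using transition_pair_span[OF tr] by blast
  then show ?thesis using transition_adjust[OF v _ tr r'r] by metis
qed

end

section \<open>Algebraic integers and coordinates in a number field\<close>

text \<open>Multiplying the relation by \<open>c d ^ (d - 1) * n ^ d\<close> turns it into a monic
  equation for \<open>c d * n * x\<close>. The spare factor \<open>n\<close> makes the same
  computation cover integer multiples of algebraic integers.\<close>

lemma algebraic_int_clear_denominators:
  fixes x :: "'k::field_char_0"
  assumes "0 < d" "(\<Sum>i\<le>d. of_int (c i) * x ^ i) = 0"
  shows "algebraic_int (of_int (c d * n) * x)"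
proof -
  define q :: "'k::field_char_0 poly" where
    "q = (\<Sum>i<d. monom (of_int (c i * c d ^ (d - 1 - i) * n ^ (d - i))) i) + monom 1 d"
  have cq: "coeff q j = (if j < d then of_int (c j * c d ^ (d - 1 - j) * n ^ (d - j)) else if j = d then 1 else 0)" for j
  proof -
    have "coeff q j = (\<Sum>i<d. if i = j then of_int (c i * c d ^ (d - 1 - i) * n ^ (d - i)) else 0) + (if d = j then 1 else 0)"
      unfolding q_def by (simp add: coeff_sum)
    then show ?thesis by auto
  qed
  have "degree q = d"
    by (intro antisym degree_le le_degree) (auto simp: cq)
  moreover have "poly q (of_int (c d * n) * x) = 0"
  proof -
    have "poly q (of_int (c d * n) * x) =
      (\<Sum>i<d. of_int (c i * c d ^ (d - 1 - i) * n ^ (d - i)) * (of_int (c d * n) * x) ^ i) + (of_int (c d * n) * x) ^ d"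
      unfolding q_def by (simp add: poly_sum poly_monom)
    also have "(\<Sum>i<d. of_int (c i * c d ^ (d - 1 - i) * n ^ (d - i)) * (of_int (c d * n) * x) ^ i) =
      (\<Sum>i<d. of_int (c d ^ (d - 1) * n ^ d) * (of_int (c i) * x ^ i))"
    proof (rule sum.cong[OF refl])
      fix i assume "i \<in> {..<d}"
      then have "c d ^ (d - 1) = c d ^ (d - 1 - i) * c d ^ i" "n ^ d = n ^ (d - i) * n ^ i"
        by (simp_all flip: power_add)
      then show "of_int (c i * c d ^ (d - 1 - i) * n ^ (d - i)) * (of_int (c d * n) * x) ^ i =
          of_int (c d ^ (d - 1) * n ^ d) * (of_int (c i) * x ^ i)"
        by (simp only:) (simp add: power_mult_distrib)
    qed
    also have "(of_int (c d * n) * x) ^ d = of_int (c d ^ (d - 1) * n ^ d) * (of_int (c d) * x ^ d)"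
      using assms(1) by (cases d) (simp_all add: power_mult_distrib mult_ac)
    also have "(\<Sum>i<d. of_int (c d ^ (d - 1) * n ^ d) * (of_int (c i) * x ^ i)) + \<dots> =
        of_int (c d ^ (d - 1) * n ^ d) * (\<Sum>i\<le>d. of_int (c i) * x ^ i)"
      by (simp add: sum_distrib_left distrib_left lessThan_Suc_atMost[symmetric])
    finally show ?thesis using assms(2) by simp
  qed
  ultimately show ?thesis
    by (intro algebraic_int.intros[of q]) (auto simp: cq)
qed

lemma algebraic_int_powers:
  assumes "algebraic_int x"
  obtains d c where "0 < d" "(x::'k::field_char_0) ^ d = (\<Sum>i<d. of_int (c i) * x ^ i)"
proof -
  obtain p where p: "lead_coeff p = 1" "\<forall>i. coeff p i \<in> \<int>" "poly p x = 0"
    using assms by (auto elim: algebraic_int.cases)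
  have "\<forall>i. \<exists>c. coeff p i = of_int c" using p(2) by (auto elim: Ints_cases)
  then obtain c where c: "\<And>i. coeff p i = of_int (c i)" by metis
  have "degree p \<noteq> 0"
  proof
    assume "degree p = 0"
    then obtain a where "p = [:a:]" using degree_eq_zeroE by blast
    then show False using p by auto
  qed
  moreover have "x ^ degree p = (\<Sum>i<degree p. of_int (- c i) * x ^ i)"
  proof -
    have "(\<Sum>i<degree p. coeff p i * x ^ i) + x ^ degree p = poly p x"
      unfolding poly_altdef using p(1) by (simp flip: lessThan_Suc_atMost)
    then have "(\<Sum>i<degree p. of_int (c i) * x ^ i) + x ^ degree p = 0"
      unfolding c p(3) .
    then show ?thesis by (simp add: sum_negf eq_neg_iff_add_eq_0 add.commute)
  qed
  ultimately show ?thesis by (intro that[of "degree p" "\<lambda>i. - c i"]) simp_all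
qed

lemma common_denominator:
  assumes "finite S"
  shows "\<exists>D::nat. D > 0 \<and> (\<forall>q\<in>S. of_nat D * q \<in> (\<int> :: rat set))"
  using assms
proof (induction S)
  case empty
  show ?case by (intro exI[of _ 1]) auto
next
  case (insert q S)
  then obtain D :: nat where D: "D > 0" "\<forall>q\<in>S. of_nat D * q \<in> \<int>" by blast
  obtain a b where q: "q = Rat.Fract a b" "b > 0" by (cases q)
  have "of_nat (nat b) * q = of_int a"
    using q by (simp add: Fract_of_int_quotient)
  then have "of_nat (D * nat b) * q \<in> \<int>"
    by (simp add: mult.assoc)
  moreover have "of_nat (D * nat b) * r \<in> \<int>" if "r \<in> S" for r
  proof -
    have "of_nat (D * nat b) * r = of_nat (nat b) * (of_nat D * r)" by simp
    then show ?thesis using D that by (metis Ints_mult Ints_of_nat)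
  qed
  ultimately show ?case using D q by (intro exI[of _ "D * nat b"]) auto
qed

text \<open>If \<open>b\<close> is the reduced denominator of \<open>q\<close>, then
  \<open>b ^ k\<close> divides \<open>D\<close> for all \<open>k\<close>, and these divisors outgrow
  the nonzero \<open>D\<close> unless \<open>b = 1\<close>.\<close>

lemma rat_bounded_power_denominators:
  fixes q :: rat
  assumes "D \<noteq> 0" "\<And>k. of_int D * q ^ k \<in> \<int>"
  shows "q \<in> \<int>"
proof -
  obtain a b where q: "q = Rat.Fract a b" "b > 0" "coprime a b" by (cases q)
  have dvd: "b ^ k dvd D" for k
  proof -
    obtain z where "of_int D * q ^ k = of_int z" using assms(2)[of k] by (auto elim: Ints_cases)
    then have "of_int (D * a ^ k) = (of_int (z * b ^ k) :: rat)"
      using q(2) by (simp add: q(1) Fract_of_int_quotient power_divide field_simps)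
    then have "D * a ^ k = z * b ^ k" by (simp only: of_int_eq_iff)
    then have "b ^ k dvd D * a ^ k" by simp
    moreover have "coprime (b ^ k) (a ^ k)" using q(3) by (simp add: coprime_commute)
    ultimately show ?thesis by (simp add: coprime_dvd_mult_left_iff)
  qed
  have "b = 1"
  proof (rule ccontr)
    assume "b \<noteq> 1"
    then have "b \<ge> 2" using q(2) by simp
    then have "2 ^ nat \<bar>D\<bar> \<le> b ^ nat \<bar>D\<bar>" by (intro power_mono) auto
    moreover have "int (nat \<bar>D\<bar>) < 2 ^ nat \<bar>D\<bar>" using of_nat_less_two_power by blast
    ultimately have "\<bar>D\<bar> < b ^ nat \<bar>D\<bar>" by simp
    then show False using dvd_imp_le_int[OF assms(1) dvd[of "nat \<bar>D\<bar>"]] q(2) by simp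
  qed
  then show ?thesis using q by (simp add: Fract_of_int_quotient)
qed

interpretation rat_vs: vector_space "\<lambda>q (x::'k::field_char_0). of_rat q * x"
  by unfold_locales (simp_all add: algebra_simps of_rat_add of_rat_mult)

lemma number_field_coordinates:
  assumes "number_field TYPE('k::field_char_0)"
  obtains n :: nat and b :: "nat \<Rightarrow> 'k::field_char_0" and co :: "'k::field_char_0 \<Rightarrow> nat \<Rightarrow> rat"
  where "\<And>x. x = (\<Sum>i<n. of_rat (co x i) * b i)"
    and "\<And>x y i. co (x + y) i = co x i + co y i"
    and "\<And>q x i. co (of_rat q * x) i = q * co x i"
    and "\<And>i j. i < n \<Longrightarrow> j < n \<Longrightarrow> co (b j) i = (if i = j then 1 else 0)"
proof -
  obtain B :: "'k::field_char_0 set" where B: "finite B" "rat_vs.span B = UNIV"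
    using assms unfolding number_field_def by blast
  obtain B0 where B0: "B0 \<subseteq> B" "rat_vs.independent B0" "B \<subseteq> rat_vs.span B0"
    using rat_vs.maximal_independent_subset by blast
  have span: "rat_vs.span B0 = UNIV"
    using rat_vs.span_minimal[OF B0(3) rat_vs.subspace_span] B(2) by auto
  have "finite B0" using B0(1) B(1) finite_subset by blast
  then obtain b where b: "bij_betw b {..<card B0} B0"
    using ex_bij_betw_nat_finite by (auto simp: atLeast0LessThan)
  let ?co = "\<lambda>x i. rat_vs.representation B0 x (b i)"
  show ?thesis
  proof (rule that[where n = "card B0" and co = ?co and b = b])
    show "x = (\<Sum>i<card B0. of_rat (?co x i) * b i)" for x
    proof -
      have "(\<Sum>v\<in>B0. of_rat (rat_vs.representation B0 x v) * v) = x"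
        by (rule rat_vs.sum_representation_eq) (use B0 span \<open>finite B0\<close> in auto)
      then show ?thesis using sum.reindex_bij_betw[OF b, of "\<lambda>v. of_rat (rat_vs.representation B0 x v) * v"] by simp
    qed
    show "?co (x + y) i = ?co x i + ?co y i" for x y i
      by (subst rat_vs.representation_add) (use B0 span in auto)
    show "?co (of_rat q * x) i = q * ?co x i" for q x i
      by (subst rat_vs.representation_scale) (use B0 span in auto)
    show "?co (b j) i = (if i = j then 1 else 0)" if "i < card B0" "j < card B0" for i j
      using that b B0(2) by (subst rat_vs.representation_basis) (auto simp: bij_betw_def inj_on_def)
  qed
qed

section \<open>The norm and the geometry of an order\<close>

text \<open>The vectors \<open>b\<close> form a rational basis inside \<open>R\<close>, whose
  integral span may be smaller than \<open>R\<close>. Elements of \<open>R\<close> may thus have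
  fractional coordinates, and the integrality of their norms is derived from
  \<open>algebraic\<close>.\<close>

locale coordinate_order = field_subring R for R :: "'k::field_char_0 set" +
  fixes n :: nat and b :: "nat \<Rightarrow> 'k" and co :: "'k \<Rightarrow> nat \<Rightarrow> rat"
  assumes repr: "x = (\<Sum>i<n. of_rat (co x i) * b i)"
    and co_add: "co (x + y) i = co x i + co y i"
    and co_scale: "co (of_rat q * x) i = q * co x i"
    and co_basis: "i < n \<Longrightarrow> j < n \<Longrightarrow> co (b j) i = (if i = j then 1 else 0)"
    and basis_mem: "i < n \<Longrightarrow> b i \<in> R"
    and algebraic: "x \<in> R \<Longrightarrow> algebraic_int x"
    and denominator: "\<exists>m>0. of_nat m * x \<in> R"
begin

lemma co_zero [simp]: "co 0 i = 0"
  using co_scale[of 0 0 i] by simp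

lemma co_sum: "co (sum f A) i = (\<Sum>a\<in>A. co (f a) i)"
  by (induction A rule: infinite_finite_induct) (auto simp: co_add)

lemma co_of_int: "co (of_int z * x) i = of_int z * co x i"
  using co_scale[of "of_int z" x i] by simp

lemma co_diff: "co (x - y) i = co x i - co y i"
  using co_add[of "x - y" y i] by simp

definition mult_mat :: "'k \<Rightarrow> rat mat" where
  "mult_mat x = mat n n (\<lambda>(i, j). co (x * b j) i)"

lemma mult_mat_carrier [simp]: "mult_mat x \<in> carrier_mat n n"
  by (simp add: mult_mat_def)

lemma co_mult: "co (x * y) i = (\<Sum>l<n. co y l * co (x * b l) i)"
proof -
  have "x * y = (\<Sum>l<n. of_rat (co y l) * (x * b l))"
    by (subst repr[of y]) (simp add: sum_distrib_left mult_ac)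
  then show ?thesis by (simp only: co_sum co_scale)
qed

lemma mult_mat_mult: "mult_mat (x * y) = mult_mat x * mult_mat y"
proof (rule eq_matI)
  fix i j assume "i < dim_row (mult_mat x * mult_mat y)" "j < dim_col (mult_mat x * mult_mat y)"
  then have ij: "i < n" "j < n" by (simp_all add: mult_mat_def)
  then have "(mult_mat x * mult_mat y) $$ (i, j) = (\<Sum>l<n. co (x * b l) i * co (y * b j) l)"
    by (simp add: mult_mat_def scalar_prod_def atLeast0LessThan)
  also have "\<dots> = co (x * (y * b j)) i"
    unfolding co_mult[of x "y * b j"] by (intro sum.cong refl mult.commute)
  finally show "mult_mat (x * y) $$ (i, j) = (mult_mat x * mult_mat y) $$ (i, j)"
    using ij by (simp only:) (simp add: mult_mat_def mult.assoc)
qed (simp_all add: mult_mat_def)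

lemma mult_mat_one: "mult_mat 1 = 1\<^sub>m n"
  by (rule eq_matI) (auto simp: mult_mat_def co_basis)

definition norm :: "'k \<Rightarrow> rat" where
  "norm x = det (mult_mat x)"

lemma norm_mult: "norm (x * y) = norm x * norm y"
  unfolding norm_def mult_mat_mult by (rule det_mult[of _ n]) auto

lemma norm_one: "norm 1 = 1"
  by (simp add: norm_def mult_mat_one)

lemma norm_power: "norm (x ^ k) = norm x ^ k"
  by (induction k) (auto simp: norm_one norm_mult)

lemma norm_nonzero: "x \<noteq> 0 \<Longrightarrow> norm x \<noteq> 0"
  using norm_mult[of x "inverse x"] norm_one by auto

text \<open>The powers of an algebraic integer have bounded denominators, and so do the powers of its
  norm.\<close>

lemma norm_Ints:
  assumes "x \<in> R"
  shows "norm x \<in> \<int>"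
proof -
  obtain d c where d: "0 < d" "x ^ d = (\<Sum>i<d. of_int (c i) * x ^ i)"
    using algebraic_int_powers[OF algebraic[OF assms]] by blast
  have "finite ((\<lambda>(k, i, j). co (x ^ k * b j) i) ` ({..<d} \<times> {..<n} \<times> {..<n}))" by simp
  from common_denominator[OF this] obtain D :: nat where D: "D > 0"
    "\<forall>k<d. \<forall>i<n. \<forall>j<n. of_nat D * co (x ^ k * b j) i \<in> \<int>" by fastforce
  \<comment> \<open>Higher powers of \<open>x\<close> are integral combinations of lower ones, so
    the denominator \<open>D\<close> of the powers below \<open>d\<close> works for all of
    them.\<close>
  have int: "of_nat D * co (x ^ k * b j) i \<in> \<int>" if "i < n" "j < n" for k i j
  proof (induction k rule: less_induct)
    case (less k)
    show ?case
    proof (cases "k < d")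
      case True
      then show ?thesis using D that by blast
    next
      case False
      then have "x ^ k * b j = x ^ d * x ^ (k - d) * b j" by (simp flip: power_add)
      also have "\<dots> = (\<Sum>l<d. of_int (c l) * (x ^ (l + (k - d)) * b j))"
        by (simp add: d(2) sum_distrib_right sum_distrib_left power_add mult_ac)
      finally have "of_nat D * co (x ^ k * b j) i =
          (\<Sum>l<d. of_int (c l) * (of_nat D * co (x ^ (l + (k - d)) * b j) i))"
        by (simp only: co_sum co_of_int sum_distrib_left mult.left_commute)
      also have "\<dots> \<in> \<int>"
      proof (rule Ints_sum)
        fix l assume "l \<in> {..<d}"
        then have "l + (k - d) < k" using False by auto
        then show "of_int (c l) * (of_nat D * co (x ^ (l + (k - d)) * b j) i) \<in> \<int>"
          by (intro Ints_mult[OF Ints_of_int] less.IH)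
      qed
      finally show ?thesis .
    qed
  qed
  have ints: "field_subring (\<int> :: rat set)" by unfold_locales auto
  \<comment> \<open>A determinant of size \<open>n\<close> whose entries have denominator
    \<open>D\<close> has denominator \<open>D ^ n\<close>, whatever the exponent
    \<open>k\<close>.\<close>
  have "of_int (int D ^ n) * norm x ^ k \<in> \<int>" for k
  proof -
    have "det (of_nat D \<cdot>\<^sub>m mult_mat (x ^ k)) \<in> \<int>"
      by (rule field_subring.det_mem[OF ints, of _ n]) (auto simp: mult_mat_def int)
    moreover have "det (of_nat D \<cdot>\<^sub>m mult_mat (x ^ k)) = of_nat D ^ n * norm (x ^ k)"
      unfolding norm_def det_smult carrier_matD(2)[OF mult_mat_carrier] ..
    ultimately show ?thesis by (simp add: norm_power)
  qed
  then show ?thesis by (rule rat_bounded_power_denominators[rotated]) (use D in auto)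
qed

section \<open>Small coordinates, boxes and residues\<close>

lemma dim_pos: "0 < n"
  using repr[of 1] by (cases n) auto

lemma abs_det_le:
  fixes A :: "rat mat"
  assumes "A \<in> carrier_mat n n" "\<And>i j. i < n \<Longrightarrow> j < n \<Longrightarrow> \<bar>A $$ (i, j)\<bar> \<le> c"
  shows "\<bar>det A\<bar> \<le> fact n * c ^ n"
proof -
  have "\<bar>det A\<bar> \<le> (\<Sum>p\<in>{p. p permutes {0..<n}}. \<bar>signof p * (\<Prod>i=0..<n. A $$ (i, p i))\<bar>)"
    unfolding det_def'[OF assms(1)] by (rule sum_abs)
  also have "\<dots> \<le> (\<Sum>p\<in>{p. p permutes {0..<n}}. c ^ n)"
  proof (rule sum_mono)
    fix p assume p: "p \<in> {p. p permutes {0..<n}}"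
    have "\<bar>signof p * (\<Prod>i=0..<n. A $$ (i, p i))\<bar> = (\<Prod>i=0..<n. \<bar>A $$ (i, p i)\<bar>)"
      by (simp add: abs_mult abs_prod sign_def)
    also have "\<dots> \<le> (\<Prod>i=0..<n. c)"
      by (rule prod_mono) (use p assms(2) in \<open>auto simp: permutes_in_image\<close>)
    finally show "\<bar>signof p * (\<Prod>i=0..<n. A $$ (i, p i))\<bar> \<le> c ^ n" by simp
  qed
  also have "\<dots> = fact n * c ^ n"
    by (simp add: card_permutations[of _ n])
  finally show ?thesis .
qed

text \<open>The entries of \<open>mult_mat x\<close> are linear in the coordinates of
  \<open>x\<close>. Once they are at most \<open>1 / (2 * fact n)\<close>, the Leibniz formula
  bounds the determinant by \<open>1 / 2\<close>; this dictates \<open>\<epsilon>\<close>.\<close>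

lemma norm_small: "\<exists>\<epsilon>>0. \<forall>x. (\<forall>i<n. \<bar>co x i\<bar> < \<epsilon>) \<longrightarrow> \<bar>norm x\<bar> < 1"
proof -
  \<comment> \<open>The sum bounds the structure constants of the multiplication; the summand 1
    keeps \<open>C\<close> positive, so that one may divide by it.\<close>
  define C where "C = 1 + (\<Sum>l<n. \<Sum>j<n. \<Sum>i<n. \<bar>co (b l * b j) i\<bar>)"
  define \<epsilon> where "\<epsilon> = 1 / (2 * C * fact n)"
  have C: "C \<ge> 1" unfolding C_def by (simp add: sum_nonneg)
  then have \<epsilon>: "\<epsilon> > 0" by (simp add: \<epsilon>_def)
  have "\<bar>norm x\<bar> < 1" if x: "\<forall>i<n. \<bar>co x i\<bar> < \<epsilon>" for x
  proof -
    have entry: "\<bar>mult_mat x $$ (i, j)\<bar> \<le> \<epsilon> * C" if "i < n" "j < n" for i j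
    proof -
      have "\<bar>mult_mat x $$ (i, j)\<bar> = \<bar>\<Sum>l<n. co x l * co (b l * b j) i\<bar>"
        using that co_mult[of "b j" x i] by (simp add: mult_mat_def mult.commute)
      also have "\<dots> \<le> (\<Sum>l<n. \<bar>co x l\<bar> * \<bar>co (b l * b j) i\<bar>)"
        by (rule order.trans[OF sum_abs]) (simp add: abs_mult)
      also have "\<dots> \<le> (\<Sum>l<n. \<epsilon> * \<bar>co (b l * b j) i\<bar>)"
        using x by (intro sum_mono mult_right_mono) (auto intro: less_imp_le)
      also have "\<dots> \<le> (\<Sum>l<n. \<epsilon> * (\<Sum>j<n. \<Sum>i<n. \<bar>co (b l * b j) i\<bar>))"
      proof (intro sum_mono mult_left_mono)
        fix l
        have "\<bar>co (b l * b j) i\<bar> \<le> (\<Sum>i<n. \<bar>co (b l * b j) i\<bar>)"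
          using that by (intro member_le_sum) auto
        also have "\<dots> \<le> (\<Sum>j<n. \<Sum>i<n. \<bar>co (b l * b j) i\<bar>)"
          using that by (intro member_le_sum[of j]) (auto intro: sum_nonneg)
        finally show "\<bar>co (b l * b j) i\<bar> \<le> (\<Sum>j<n. \<Sum>i<n. \<bar>co (b l * b j) i\<bar>)" .
      qed (use \<epsilon> in auto)
      also have "\<dots> \<le> \<epsilon> * C" using \<epsilon> by (simp add: C_def sum_distrib_left[symmetric])
      finally show ?thesis .
    qed
    have le: "1 / (2 * fact n :: rat) \<le> 1"
      using fact_ge_1[of n, where 'a = rat] by (subst divide_le_eq_1_pos) linarith+
    have "\<bar>norm x\<bar> \<le> fact n * (\<epsilon> * C) ^ n"
      unfolding norm_def by (rule abs_det_le) (auto simp: entry)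
    also have "\<epsilon> * C = 1 / (2 * fact n)" using C by (simp add: \<epsilon>_def)
    also have "fact n * (1 / (2 * fact n :: rat)) ^ n \<le> fact n * (1 / (2 * fact n)) ^ 1"
      using dim_pos le by (intro mult_left_mono power_decreasing) auto
    also have "\<dots> < 1" by simp
    finally show ?thesis .
  qed
  then show ?thesis using \<epsilon> by blast
qed

text \<open>Coordinates are reduced modulo \<open>m\<close> to the interval from 0 to
  \<open>m\<close>, and the resulting cube is cut into cells of side
  \<open>1 / Q < \<epsilon>\<close>, named by \<open>box\<close>. The part split off is
  \<open>m\<close> times an integral combination of the basis, which lies in
  \<open>R\<close>.\<close>

lemma box_pigeonhole:
  assumes "0 < (m::nat)" "0 < (\<epsilon>::rat)"
  shows "\<exists>box :: 'k \<Rightarrow> nat \<Rightarrow> int. finite (range box) \<and>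
    (\<forall>x y. box x = box y \<longrightarrow> (\<exists>z\<in>R. \<forall>i<n. \<bar>co (x - y - of_nat m * z) i\<bar> < \<epsilon>))"
proof -
  obtain Q :: nat where Q: "Q > 0" "1 / of_nat Q < \<epsilon>"
    using reals_Archimedean2 assms(2) ex_inverse_of_nat_less[of \<epsilon>] by (auto simp: inverse_eq_divide)
  define fl where "fl = (\<lambda>x i. \<lfloor>co x i / of_nat m\<rfloor>)"
  define red where "red = (\<lambda>x i. co x i - of_nat m * of_int (fl x i))"
  \<comment> \<open>The default 0 outside \<open>{..<n}\<close> leaves only finitely many
    names.\<close>
  define box where "box = (\<lambda>x i. if i < n then \<lfloor>of_nat Q * red x i\<rfloor> else 0)"
  have red: "0 \<le> red x i" "red x i < of_nat m" for x i
  proof -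
    have "of_int (fl x i) \<le> co x i / of_nat m" "co x i / of_nat m < of_int (fl x i) + 1"
      unfolding fl_def by linarith+
    then show "0 \<le> red x i" "red x i < of_nat m"
      using assms(1) by (simp_all add: red_def field_simps)
  qed
  have "range box \<subseteq> {f. \<forall>i. (i \<in> {..<n} \<longrightarrow> f i \<in> {0..int (Q * m)}) \<and> (i \<notin> {..<n} \<longrightarrow> f i = 0)}"
  proof
    fix f assume "f \<in> range box"
    then obtain x where f: "f = box x" by blast
    have "box x i \<in> {0..int (Q * m)}" if "i \<in> {..<n}" for i
    proof -
      have "of_nat Q * red x i \<le> of_nat Q * of_nat m"
        using red[of x i] by (intro mult_left_mono) auto
      then have "\<lfloor>of_nat Q * red x i\<rfloor> \<le> int (Q * m)"
        by (metis floor_mono floor_of_nat of_nat_mult)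
      then show "box x i \<in> {0..int (Q * m)}"
        using red[of x i] that by (simp add: box_def)
    qed
    moreover have "box x i = 0" if "i \<notin> {..<n}" for i using that by (simp add: box_def)
    ultimately show "f \<in> {f. \<forall>i. (i \<in> {..<n} \<longrightarrow> f i \<in> {0..int (Q * m)}) \<and> (i \<notin> {..<n} \<longrightarrow> f i = 0)}"
      unfolding f by simp
  qed
  then have "finite (range box)"
    by (rule finite_subset) (rule finite_set_of_finite_funs; simp)
  moreover have "\<exists>z\<in>R. \<forall>i<n. \<bar>co (x - y - of_nat m * z) i\<bar> < \<epsilon>" if eq: "box x = box y" for x y
  proof (intro bexI allI impI)
    define z where "z = (\<Sum>j<n. of_int (fl x j - fl y j) * b j)"
    show "z \<in> R" unfolding z_def using basis_mem by (intro sum_mem mult_mem of_int_mem) auto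
    fix i assume i: "i < n"
    have "co z i = (\<Sum>j<n. of_int (fl x j - fl y j) * (if i = j then 1 else 0))"
      unfolding z_def co_sum co_of_int using i by (intro sum.cong) (auto simp: co_basis)
    also have "\<dots> = of_int (fl x i - fl y i)"
      using i by (simp add: if_distrib[of "\<lambda>x. _ * x"] cong: if_cong)
    finally have "co (x - y - of_nat m * z) i = red x i - red y i"
      using co_of_int[of "int m" z i] by (simp add: co_diff red_def right_diff_distrib)
    moreover have "\<lfloor>of_nat Q * red x i\<rfloor> = \<lfloor>of_nat Q * red y i\<rfloor>"
      using fun_cong[OF eq, of i] i by (simp add: box_def)
    then have "\<bar>of_nat Q * red x i - of_nat Q * red y i\<bar> < 1" by linarith
    then have "of_nat Q * \<bar>red x i - red y i\<bar> < 1"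
      by (simp add: abs_mult flip: right_diff_distrib)
    then have "\<bar>red x i - red y i\<bar> < 1 / of_nat Q" using Q(1) by (simp add: field_simps)
    ultimately show "\<bar>co (x - y - of_nat m * z) i\<bar> < \<epsilon>" using Q(2) by simp
  qed
  ultimately show ?thesis by blast
qed

text \<open>The norm of a nonzero element of \<open>R\<close> is a nonzero integer.\<close>

lemma order_discrete:
  assumes "\<forall>x. (\<forall>i<n. \<bar>co x i\<bar> < \<epsilon>) \<longrightarrow> \<bar>norm x\<bar> < 1" "x \<in> R" "\<forall>i<n. \<bar>co x i\<bar> < \<epsilon>"
  shows "x = 0"
proof (rule ccontr)
  assume "x \<noteq> 0"
  obtain z where z: "norm x = of_int z" using norm_Ints[OF assms(2)] by (auto elim: Ints_cases)
  then show False using assms(1,3) norm_nonzero[OF \<open>x \<noteq> 0\<close>] by auto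
qed

text \<open>One element of \<open>R\<close> is picked from each inhabited box. Any element differs
  from its pick by some \<open>m z\<close> and a remainder in \<open>R\<close> with small
  coordinates, which is 0.\<close>

lemma finite_residues_nat:
  assumes "0 < (m::nat)"
  shows "\<exists>T. finite T \<and> T \<subseteq> R \<and> (\<forall>x\<in>R. \<exists>t\<in>T. \<exists>y\<in>R. x - t = of_nat m * y)"
proof -
  obtain \<epsilon> where \<epsilon>: "\<epsilon> > 0" "\<forall>x. (\<forall>i<n. \<bar>co x i\<bar> < \<epsilon>) \<longrightarrow> \<bar>norm x\<bar> < 1"
    using norm_small by blast
  obtain box :: "'k \<Rightarrow> nat \<Rightarrow> int" where box: "finite (range box)"
    "\<And>x y. box x = box y \<Longrightarrow> \<exists>z\<in>R. \<forall>i<n. \<bar>co (x - y - of_nat m * z) i\<bar> < \<epsilon>"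
    using box_pigeonhole[OF assms \<epsilon>(1)] by blast
  define pick where "pick = (\<lambda>v. SOME x. x \<in> R \<and> box x = v)"
  have pick: "pick (box x) \<in> R" "box (pick (box x)) = box x" if "x \<in> R" for x
    using someI[of "\<lambda>y. y \<in> R \<and> box y = box x" x] that by (auto simp: pick_def)
  have "finite (pick ` box ` R)" using finite_subset[OF _ box(1), of "box ` R"] by auto
  moreover have "\<exists>y\<in>R. x - pick (box x) = of_nat m * y" if x: "x \<in> R" for x
  proof -
    obtain z where z: "z \<in> R" "\<forall>i<n. \<bar>co (x - pick (box x) - of_nat m * z) i\<bar> < \<epsilon>"
      using box(2)[of x "pick (box x)"] pick[OF x] by auto
    then have "x - pick (box x) - of_nat m * z = 0"
      using pick[OF x] x by (intro order_discrete[OF \<epsilon>(2)]) auto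
    then show ?thesis using z by auto
  qed
  ultimately show ?thesis using pick(1) by (intro exI[of _ "pick ` box ` R"]) blast
qed

lemma residually_finite: "residually_finite_subring R"
proof
  have "x \<in> fraction_field R" for x
  proof -
    obtain m where "m > 0" "of_nat m * x \<in> R" using denominator by blast
    then show ?thesis unfolding fraction_field_def
      by (intro CollectI exI[of _ "of_nat m * x"] exI[of _ "of_nat m"]) auto
  qed
  then show "fraction_field R = UNIV" by blast
  fix c assume c: "c \<in> R" "c \<noteq> 0"
  \<comment> \<open>Every nonzero \<open>c\<close> in \<open>R\<close> divides a positive integer
    \<open>m\<close> in \<open>R\<close>, so residues modulo \<open>m\<close> are enough.\<close>
  obtain m where m: "m > 0" "of_nat m * inverse c \<in> R" using denominator by blast
  obtain T where T: "finite T" "T \<subseteq> R" "\<forall>x\<in>R. \<exists>t\<in>T. \<exists>y\<in>R. x - t = of_nat m * y"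
    using finite_residues_nat[OF m(1)] by blast
  have "\<exists>t\<in>T. \<exists>y\<in>R. x - t = c * y" if x: "x \<in> R" for x
  proof -
    obtain t y where "t \<in> T" "y \<in> R" "x - t = of_nat m * y" using T(3) x by blast
    then show ?thesis using m c
      by (intro bexI[of _ t] bexI[of _ "of_nat m * inverse c * y"]) auto
  qed
  then show "\<exists>T. finite T \<and> T \<subseteq> R \<and> (\<forall>x\<in>R. \<exists>t\<in>T. \<exists>y\<in>R. x - t = c * y)"
    using T by blast
qed

text \<open>For \<open>\<beta>\<close> of minimal absolute norm in an ideal \<open>I\<close> and every \<open>\<alpha> \<in> I\<close>, some multiple
  \<open>t \<alpha>\<close> with bounded \<open>t\<close> is in \<open>\<beta> R\<close>.\<close>

lemma multiple_of_minimal: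
  "\<exists>m>0. \<forall>I. is_submodule R (*) I \<and> I \<subseteq> R \<and> I \<noteq> {0} \<longrightarrow>
    (\<exists>\<beta>\<in>I. \<beta> \<noteq> 0 \<and> (\<forall>\<alpha>\<in>I. \<exists>r\<in>R. of_nat m * \<alpha> = r * \<beta>))"
proof -
  obtain \<epsilon> where \<epsilon>: "\<epsilon> > 0" "\<forall>x. (\<forall>i<n. \<bar>co x i\<bar> < \<epsilon>) \<longrightarrow> \<bar>norm x\<bar> < 1"
    using norm_small by blast
  obtain box :: "'k \<Rightarrow> nat \<Rightarrow> int" where box: "finite (range box)"
    "\<And>x y. box x = box y \<Longrightarrow> \<exists>z\<in>R. \<forall>i<n. \<bar>co (x - y - of_nat 1 * z) i\<bar> < \<epsilon>"
    using box_pigeonhole[OF less_numeral_extra(1) \<epsilon>(1)] by blast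
  define M where "M = card (range box)"
  \<comment> \<open>Dirichlet's approximation: among the \<open>M + 1\<close> multiples of
    \<open>x\<close> by \<open>0, ..., M\<close>, two share one of the \<open>M\<close> boxes, and
    their difference is close to \<open>R\<close>.\<close>
  have approx: "\<exists>t>0. t \<le> M \<and> (\<exists>z\<in>R. \<bar>norm (of_nat t * x - z)\<bar> < 1)" for x
  proof -
    let ?f = "\<lambda>t::nat. box (of_nat t * x)"
    have "card (?f ` {..M}) \<le> M"
      unfolding M_def by (rule card_mono[OF box(1)]) auto
    then have "\<not> inj_on ?f {..M}" using card_image[of ?f "{..M}"] by auto
    then obtain s t where st: "s < t" "t \<le> M" "?f t = ?f s"
      by (auto simp: inj_on_def) (metis linorder_neqE_nat)
    obtain z where "z \<in> R" "\<forall>i<n. \<bar>co (of_nat t * x - of_nat s * x - of_nat 1 * z) i\<bar> < \<epsilon>"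
      using box(2)[OF st(3)] by blast
    then have "\<bar>norm (of_nat (t - s) * x - z)\<bar> < 1"
      using \<epsilon>(2) st(1) by (simp add: of_nat_diff left_diff_distrib)
    then show ?thesis using st \<open>z \<in> R\<close> by (intro exI[of _ "t - s"]) auto
  qed
  \<comment> \<open>\<open>fact M\<close> is a common multiple of all possible
    \<open>t\<close>.\<close>
  have "\<exists>\<beta>\<in>I. \<beta> \<noteq> 0 \<and> (\<forall>\<alpha>\<in>I. \<exists>r\<in>R. of_nat (fact M) * \<alpha> = r * \<beta>)"
    if I: "is_submodule R (*) I" "I \<subseteq> R" "I \<noteq> {0}" for I
  proof -
    have "\<exists>x. x \<in> I \<and> x \<noteq> 0" using I(3) submodule_zero[OF I(1)] by auto
    \<comment> \<open>Norms on \<open>I\<close> are integers, so the floor loses nothing and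
      provides a measure in the natural numbers.\<close>
    then obtain \<beta> where \<beta>: "\<beta> \<in> I" "\<beta> \<noteq> 0"
      and min: "\<And>y. y \<in> I \<Longrightarrow> y \<noteq> 0 \<Longrightarrow> nat \<lfloor>\<bar>norm \<beta>\<bar>\<rfloor> \<le> nat \<lfloor>\<bar>norm y\<bar>\<rfloor>"
      using ex_has_least_nat[of "\<lambda>x. x \<in> I \<and> x \<noteq> 0" _ "\<lambda>x. nat \<lfloor>\<bar>norm x\<bar>\<rfloor>"] by blast
    have "\<exists>r\<in>R. of_nat (fact M) * \<alpha> = r * \<beta>" if \<alpha>: "\<alpha> \<in> I" for \<alpha>
    proof -
      obtain t z where t: "t > 0" "t \<le> M" "z \<in> R" "\<bar>norm (of_nat t * (\<alpha> / \<beta>) - z)\<bar> < 1"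
        using approx[of "\<alpha> / \<beta>"] by blast
      \<comment> \<open>The remainder of \<open>t \<alpha>\<close> on division by
        \<open>\<beta>\<close>; its smaller norm forces it to vanish.\<close>
      let ?y = "of_nat t * \<alpha> - z * \<beta>"
      have y: "?y \<in> I" using \<alpha> \<beta> t by (intro submodule_diff[OF I(1)] submodule_scale[OF I(1)]) auto
      have "?y = \<beta> * (of_nat t * (\<alpha> / \<beta>) - z)" using \<beta>(2) by (simp add: field_simps)
      then have "\<bar>norm ?y\<bar> = \<bar>norm \<beta>\<bar> * \<bar>norm (of_nat t * (\<alpha> / \<beta>) - z)\<bar>"
        by (simp only: norm_mult abs_mult)
      also have "\<dots> < \<bar>norm \<beta>\<bar> * 1"
        using t(4) norm_nonzero[OF \<beta>(2)] by (intro mult_strict_left_mono) auto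
      finally have less: "\<bar>norm ?y\<bar> < \<bar>norm \<beta>\<bar>" by simp
      have "norm ?y \<in> \<int>" "norm \<beta> \<in> \<int>" using norm_Ints y \<beta>(1) I(2) by blast+
      then have "nat \<lfloor>\<bar>norm ?y\<bar>\<rfloor> < nat \<lfloor>\<bar>norm \<beta>\<bar>\<rfloor>"
        using less by (auto elim!: Ints_cases simp flip: of_int_abs)
      then have "?y = 0" using min[OF y] by (meson not_le)
      moreover have "fact M = (fact M div t) * t" using t by (simp add: dvd_fact)
      ultimately have "of_nat (fact M) * \<alpha> = of_nat (fact M div t) * z * \<beta>"
        by (metis (no_types, lifting) eq_iff_diff_eq_0 mult.assoc of_nat_mult)
      then show ?thesis using t(3) by blast
    qed
    then show ?thesis using \<beta> by blast
  qed
  then show ?thesis by (intro exI[of _ "fact M"]) auto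
qed

text \<open>Scale \<open>I\<close> so that the minimal element \<open>\<beta>\<close> becomes
  \<open>m\<close>. The scaled ideal lies in \<open>R\<close> and contains \<open>m R\<close>, so it
  is the union of the residue classes modulo \<open>m\<close> of its members in \<open>T\<close>,
  and there are only finitely many such unions.\<close>

lemma finite_ideal_classes:
  "\<exists>\<J>. finite \<J> \<and> (\<forall>I d. is_submodule R (*) I \<and> I \<noteq> {0} \<and> d \<noteq> 0 \<and> (*) d ` I \<subseteq> R \<longrightarrow>
    (\<exists>k. k \<noteq> 0 \<and> (*) k ` I \<in> \<J>))"
proof -
  obtain m :: nat where m: "m > 0" "\<And>I. is_submodule R (*) I \<Longrightarrow> I \<subseteq> R \<Longrightarrow> I \<noteq> {0} \<Longrightarrow>
    \<exists>\<beta>\<in>I. \<beta> \<noteq> 0 \<and> (\<forall>\<alpha>\<in>I. \<exists>r\<in>R. of_nat m * \<alpha> = r * \<beta>)"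
    using multiple_of_minimal by blast
  obtain T where T: "finite T" "T \<subseteq> R" "\<forall>x\<in>R. \<exists>t\<in>T. \<exists>y\<in>R. x - t = of_nat m * y"
    using finite_residues_nat[OF m(1)] by blast
  define \<J> where "\<J> = (\<lambda>S. {x \<in> R. \<exists>t\<in>S. \<exists>y\<in>R. x - t = of_nat m * y}) ` Pow T"
  have key: "\<exists>k. k \<noteq> 0 \<and> (*) k ` I \<in> \<J>"
    if I: "is_submodule R (*) I" "I \<noteq> {0}" and d: "d \<noteq> 0" "(*) d ` I \<subseteq> R" for I d
  proof -
    have scale: "is_submodule R (*) ((*) k ` I)" for k
      unfolding is_submodule_def
    proof (intro conjI ballI)
      show "0 \<in> (*) k ` I" using submodule_zero[OF I(1)] by force
      show "x + y \<in> (*) k ` I" if "x \<in> (*) k ` I" "y \<in> (*) k ` I" for x y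
        using that submodule_add[OF I(1)] by (auto simp flip: distrib_left)
      show "r * x \<in> (*) k ` I" if "r \<in> R" "x \<in> (*) k ` I" for r x
        using that submodule_scale[OF I(1)] by (auto simp: mult.left_commute[of r])
    qed
    have "(*) d ` I \<noteq> {0}"
    proof
      assume *: "(*) d ` I = {0}"
      have "x = 0" if "x \<in> I" for x
        using imageI[OF that, of "(*) d"] d(1) unfolding * by simp
      then show False using I(2) submodule_zero[OF I(1)] by blast
    qed
    from m(2)[OF scale d(2) this] obtain \<beta> where \<beta>: "\<beta> \<in> (*) d ` I" "\<beta> \<noteq> 0"
      "\<forall>\<alpha>\<in>(*) d ` I. \<exists>r\<in>R. of_nat m * \<alpha> = r * \<beta>" by blast
    define k where "k = of_nat m / \<beta> * d"
    have k: "k \<noteq> 0" using m(1) \<beta>(2) d(1) by (simp add: k_def)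
    let ?J = "(*) k ` I"
    note J = scale[of k]
    have JR: "?J \<subseteq> R"
    proof safe
      fix x assume "x \<in> I"
      then obtain r where "r \<in> R" "of_nat m * (d * x) = r * \<beta>" using \<beta>(3) by blast
      then show "k * x \<in> R" using \<beta>(2) by (simp add: k_def field_simps)
    qed
    obtain x0 where x0: "x0 \<in> I" "\<beta> = d * x0" using \<beta>(1) by blast
    have "k * x0 = of_nat m" using x0 \<beta>(2) by (simp add: k_def)
    then have mJ: "of_nat m \<in> ?J" using x0 by force
    have "?J = {x \<in> R. \<exists>t\<in>T \<inter> ?J. \<exists>y\<in>R. x - t = of_nat m * y}"
    proof (intro equalityI subsetI)
      fix x assume x: "x \<in> ?J"
      then obtain t y where t: "t \<in> T" "y \<in> R" "x - t = of_nat m * y" using T(3) JR by blast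
      have "t = x - y * of_nat m" using t(3) by (simp add: algebra_simps)
      then have "t \<in> ?J" using submodule_diff[OF J x submodule_scale[OF J t(2) mJ]] by simp
      then show "x \<in> {x \<in> R. \<exists>t\<in>T \<inter> ?J. \<exists>y\<in>R. x - t = of_nat m * y}" using t x JR by blast
    next
      fix x assume "x \<in> {x \<in> R. \<exists>t\<in>T \<inter> ?J. \<exists>y\<in>R. x - t = of_nat m * y}"
      then obtain t y where t: "t \<in> ?J" "y \<in> R" "x - t = of_nat m * y" by blast
      have "x = t + y * of_nat m" using t(3) by (simp add: algebra_simps)
      then show "x \<in> ?J" using submodule_add[OF J t(1) submodule_scale[OF J t(2) mJ]] by simp
    qed
    then have "?J \<in> \<J>" unfolding \<J>_def by (intro image_eqI[of _ _ "T \<inter> ?J"]) auto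
    then show ?thesis using k by blast
  qed
  show ?thesis
  proof (intro exI[of _ \<J>] conjI allI impI)
    show "finite \<J>" using T(1) by (simp add: \<J>_def)
    fix I d assume "is_submodule R (*) I \<and> I \<noteq> {0} \<and> d \<noteq> 0 \<and> (*) d ` I \<subseteq> R"
    then show "\<exists>k. k \<noteq> 0 \<and> (*) k ` I \<in> \<J>" by (elim conjE) (rule key)
  qed
qed

end

section \<open>Orders have coordinates\<close>

text \<open>The powers of \<open>x\<close> up to \<open>card B\<close> are one too many to be
  independent, unless two of them coincide, which is a relation as well.\<close>

lemma number_field_algebraic_relation:
  fixes x :: "'k::field_char_0"
  assumes "number_field TYPE('k)"
  obtains d c where "0 < d" "c d > 0" "(\<Sum>i\<le>d. of_int (c i) * x ^ i) = 0"
proof -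
  obtain B :: "'k set" where B: "finite B" "rat_vs.span B = UNIV"
    using assms unfolding number_field_def by blast
  have "\<exists>q :: nat \<Rightarrow> rat. (\<exists>i\<le>card B. q i \<noteq> 0) \<and> (\<Sum>i\<le>card B. of_rat (q i) * x ^ i) = 0"
  proof (cases "inj_on (\<lambda>i. x ^ i) {..card B}")
    case True
    let ?S = "(\<lambda>i. x ^ i) ` {..card B}"
    have "rat_vs.dependent ?S"
    proof (rule ccontr)
      assume "rat_vs.independent ?S"
      then have "card ?S \<le> card B"
        using rat_vs.independent_span_bound[of B ?S] B by simp
      then show False using card_image[OF True] by simp
    qed
    then obtain q v where q: "(\<Sum>v\<in>?S. of_rat (q v) * v) = 0" "v \<in> ?S" "q v \<noteq> 0"
      by (auto simp: rat_vs.dependent_finite)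
    then show ?thesis
      by (intro exI[of _ "\<lambda>i. q (x ^ i)"]) (auto simp: sum.reindex[OF True])
  next
    case False
    then obtain i j where ij: "i \<le> card B" "j \<le> card B" "i \<noteq> j" "x ^ i = x ^ j"
      by (auto simp: inj_on_def)
    let ?q = "\<lambda>k. if k = i then 1 else if k = j then - 1 else (0 :: rat)"
    have "(\<Sum>k\<le>card B. of_rat (?q k) * x ^ k) = (\<Sum>k\<in>{i, j}. of_rat (?q k) * x ^ k)"
      by (rule sum.mono_neutral_right) (use ij in auto)
    also have "\<dots> = 0" using ij by (simp add: of_rat_minus)
    finally show ?thesis using ij by (intro exI[of _ ?q]) auto
  qed
  then obtain q i where q: "i \<le> card B" "q i \<noteq> 0" "(\<Sum>i\<le>card B. of_rat (q i) * x ^ i) = 0" by blast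
  obtain D :: nat where D: "D > 0" "\<forall>r\<in>q ` {..card B}. of_nat D * r \<in> \<int>"
    using common_denominator[of "q ` {..card B}"] by auto
  \<comment> \<open>Truncating after the last nonzero coefficient makes it the leading one.\<close>
  define d where "d = (GREATEST i. i \<le> card B \<and> q i \<noteq> 0)"
  have d: "d \<le> card B" "q d \<noteq> 0"
    using GreatestI_nat[of "\<lambda>i. i \<le> card B \<and> q i \<noteq> 0" i "card B"] q by (auto simp: d_def)
  have zero: "q j = 0" if "d < j" "j \<le> card B" for j
    using Greatest_le_nat[of "\<lambda>i. i \<le> card B \<and> q i \<noteq> 0" j "card B"] that by (auto simp: d_def)
  have sum: "(\<Sum>i\<le>d. of_rat (q i) * x ^ i) = 0"
  proof -
    have "(\<Sum>i\<le>card B. of_rat (q i) * x ^ i) = (\<Sum>i\<le>d. of_rat (q i) * x ^ i)"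
      by (rule sum.mono_neutral_right) (use d zero in auto)
    then show ?thesis using q(3) by simp
  qed
  have "0 < d"
  proof (rule ccontr)
    assume "\<not> 0 < d"
    then show False using sum d(2) by simp
  qed
  have "\<forall>i. \<exists>c. i \<le> d \<longrightarrow> of_nat D * q i = of_int c"
    using D(2) d(1) by (meson Ints_cases atMost_iff image_eqI le_trans)
  then obtain c where c: "\<And>i. i \<le> d \<Longrightarrow> of_nat D * q i = of_int (c i)" by metis
  have "c d \<noteq> 0" using c[of d] D(1) d(2) by auto
  have "(\<Sum>i\<le>d. of_int (c i) * x ^ i) = (\<Sum>i\<le>d. of_rat (of_nat D * q i) * x ^ i)"
    by (rule sum.cong) (simp_all add: c)
  also have "\<dots> = of_nat D * (\<Sum>i\<le>d. of_rat (q i) * x ^ i)"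
    by (simp add: of_rat_mult sum_distrib_left mult.assoc)
  finally have c0: "(\<Sum>i\<le>d. of_int (c i) * x ^ i) = 0" using sum by simp
  \<comment> \<open>The sign is normalised so that the leading coefficient can serve as a natural
    number denominator.\<close>
  have "(\<Sum>i\<le>d. of_int (sgn (c d) * c i) * x ^ i) = of_int (sgn (c d)) * (\<Sum>i\<le>d. of_int (c i) * x ^ i)"
    by (simp add: sum_distrib_left mult.assoc)
  moreover have "sgn (c d) * c d > 0" using \<open>c d \<noteq> 0\<close> by (simp add: sgn_if)
  ultimately show ?thesis using that[of d "\<lambda>i. sgn (c d) * c i"] \<open>0 < d\<close> c0 by simp
qed

lemma algebraic_int_of_nat_mult:
  assumes "algebraic_int x"
  shows "algebraic_int (of_nat m * (x::'k::field_char_0))"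
proof -
  obtain d c where d: "0 < d" "x ^ d = (\<Sum>i<d. of_int (c i) * x ^ i)"
    using assms by (rule algebraic_int_powers)
  have "(\<Sum>i\<le>d. of_int (if i = d then - 1 else c i) * x ^ i) =
      (\<Sum>i<d. of_int (if i = d then - 1 else c i) * x ^ i) - x ^ d"
    by (simp flip: lessThan_Suc_atMost)
  also have "(\<Sum>i<d. of_int (if i = d then - 1 else c i) * x ^ i) = (\<Sum>i<d. of_int (c i) * x ^ i)"
    by (rule sum.cong) auto
  finally have "(\<Sum>i\<le>d. of_int (if i = d then - 1 else c i) * x ^ i) = 0" using d(2) by simp
  \<comment> \<open>The relation has leading coefficient \<open>- 1\<close>, so the factor
    \<open>- int m\<close> produces the multiple by \<open>m\<close>.\<close>
  from algebraic_int_clear_denominators[OF d(1) this, of "- int m"] show ?thesis by simp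
qed

lemma field_subring_order:
  assumes "order_in_number_field R"
  shows "field_subring R" "\<And>x. x \<in> R \<Longrightarrow> algebraic_int x"
proof -
  let ?O = "ring_on ring_of_integers :: 'a ring"
  interpret subring R ?O using assms by (simp add: order_in_number_field_def)
  show alg: "algebraic_int x" if "x \<in> R" for x
    using that subset by (auto simp: ring_on_def ring_of_integers_def)
  have inv: "inv\<^bsub>add_monoid ?O\<^esub> x = - x" if "x \<in> R" for x
    unfolding m_inv_def using alg[OF that]
    by (intro the_equality) (auto simp: ring_on_def ring_of_integers_def eq_neg_iff_add_eq_0 add.commute)
  show "field_subring R"
  proof
    show "1 \<in> R" using submonoid.one_closed[OF submonoid_axioms] by (simp add: ring_on_def)
    show "x * y \<in> R" if "x \<in> R" "y \<in> R" for x y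
      using submonoid.m_closed[OF submonoid_axioms that] by (simp add: ring_on_def)
    show "x - y \<in> R" if "x \<in> R" "y \<in> R" for x y
      using subgroup.m_closed[OF subgroup_axioms that(1) subgroup.m_inv_closed[OF subgroup_axioms that(2)]]
        inv[OF that(2)] by (simp add: ring_on_def)
  qed
qed

text \<open>The finite index enters by pigeonhole: some positive integer multiple \<open>y\<close>
  of \<open>x\<close> is an algebraic integer, two of the multiples of \<open>y\<close> lie in the
  same coset of \<open>R\<close>, and their difference is in \<open>R\<close>.\<close>

lemma order_denominator:
  fixes R :: "'k::field_char_0 set"
  assumes "order_in_number_field R"
  shows "\<exists>m>0. of_nat m * x \<in> R"
proof -
  interpret field_subring R by (rule field_subring_order(1)[OF assms])
  let ?O = "ring_on ring_of_integers :: 'k ring"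
  obtain d c where d: "0 < d" "c d > 0" "(\<Sum>i\<le>d. of_int (c i) * x ^ i) = 0"
    using assms by (auto simp: order_in_number_field_def elim: number_field_algebraic_relation[of x])
  define y where "y = of_nat (nat (c d)) * x"
  have "algebraic_int y"
    using algebraic_int_clear_denominators[OF d(1,3), of 1] d(2) by (simp add: y_def)
  then have y: "of_nat i * y \<in> carrier ?O" for i
    using algebraic_int_of_nat_mult by (simp add: ring_on_def ring_of_integers_def)
  have coset: "R +>\<^bsub>?O\<^esub> a = {r + a | r. r \<in> R}" for a
    by (auto simp: a_r_coset_def r_coset_def ring_on_def)
  have "range (\<lambda>i. R +>\<^bsub>?O\<^esub> (of_nat i * y)) \<subseteq> a_rcosets\<^bsub>?O\<^esub> R"
    using y by (auto simp: A_RCOSETS_def')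
  then have "finite (range (\<lambda>i. R +>\<^bsub>?O\<^esub> (of_nat i * y)))"
    using assms finite_subset unfolding order_in_number_field_def by blast
  then have "\<not> inj (\<lambda>i. R +>\<^bsub>?O\<^esub> (of_nat i * y))"
    using finite_imageD[of "\<lambda>i. R +>\<^bsub>?O\<^esub> (of_nat i * y)" UNIV] by auto
  then obtain i j where ij: "i < j" "R +>\<^bsub>?O\<^esub> (of_nat i * y) = R +>\<^bsub>?O\<^esub> (of_nat j * y)"
    unfolding inj_def by (metis linorder_neqE_nat)
  have "0 + of_nat j * y \<in> R +>\<^bsub>?O\<^esub> (of_nat j * y)" unfolding coset by blast
  then have "0 + of_nat j * y \<in> R +>\<^bsub>?O\<^esub> (of_nat i * y)" unfolding ij(2) .
  then have "of_nat j * y \<in> {r + of_nat i * y | r. r \<in> R}" unfolding coset by simp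
  then obtain r where "r \<in> R" "of_nat j * y = r + of_nat i * y" by blast
  then have "of_nat (j - i) * y \<in> R"
    using ij(1) by (simp add: of_nat_diff left_diff_distrib)
  then have "of_nat ((j - i) * nat (c d)) * x \<in> R" by (simp add: y_def mult.assoc)
  then show ?thesis using ij(1) d(2) by (intro exI[of _ "(j - i) * nat (c d)"]) auto
qed

text \<open>A rational basis is moved into \<open>R\<close> by multiplying each vector by a
  denominator; coordinates are divided accordingly.\<close>

lemma order_coordinates:
  fixes R :: "'k::field_char_0 set"
  assumes "order_in_number_field R"
  obtains n b co where "coordinate_order R n b co"
proof -
  interpret field_subring R by (rule field_subring_order(1)[OF assms])
  have "number_field TYPE('k)" using assms by (simp add: order_in_number_field_def)
  then obtain n :: nat and b :: "nat \<Rightarrow> 'k" and co :: "'k \<Rightarrow> nat \<Rightarrow> rat"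
    where repr: "\<And>x. x = (\<Sum>i<n. of_rat (co x i) * b i)"
    and add: "\<And>x y i. co (x + y) i = co x i + co y i"
    and scale: "\<And>q x i. co (of_rat q * x) i = q * co x i"
    and basis: "\<And>i j. i < n \<Longrightarrow> j < n \<Longrightarrow> co (b j) i = (if i = j then 1 else 0)"
    by (rule number_field_coordinates) blast
  have "\<forall>i. \<exists>m>0. of_nat m * b i \<in> R" using order_denominator[OF assms] by blast
  then obtain m where m: "\<And>i. m i > 0" "\<And>i. of_nat (m i) * b i \<in> R" by metis
  have "coordinate_order R n (\<lambda>i. of_nat (m i) * b i) (\<lambda>x i. co x i / of_nat (m i))"
  proof
    show "x = (\<Sum>i<n. of_rat (co x i / of_nat (m i)) * (of_nat (m i) * b i))" for x
      by (subst repr[of x], intro sum.cong) (simp_all add: of_rat_divide m(1)[THEN gr_implies_not0])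
    show "co (x + y) i / of_nat (m i) = co x i / of_nat (m i) + co y i / of_nat (m i)" for x y i
      by (simp add: add add_divide_distrib)
    show "co (of_rat q * x) i / of_nat (m i) = q * (co x i / of_nat (m i))" for q x i
      by (simp add: scale)
    show "co (of_nat (m j) * b j) i / of_nat (m i) = (if i = j then 1 else 0)" if "i < n" "j < n" for i j
      using scale[of "of_nat (m j)" "b j" i] basis[OF that] by (simp add: m(1)[THEN gr_implies_not0])
  qed (use m field_subring_order(2)[OF assms] order_denominator[OF assms] in auto)
  then show ?thesis by (rule that)
qed

context residually_finite_subring
begin

section \<open>Cusps and ideal classes\<close>

definition point :: "'k \<times> 'k \<Rightarrow> ('k \<times> 'k) set" where
  "point v = {scale_pair k v | k. k \<noteq> 0}"

lemma fractionE:
  assumes "k \<noteq> 0"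
  obtains r s where "r \<in> R - {0}" "s \<in> R - {0}" "k = r / s"
proof -
  have "k \<in> fraction_field R" using fraction_field_UNIV by simp
  then obtain r s where "r \<in> R" "s \<in> R - {0}" "k = r / s" by (auto simp: fraction_field_def)
  then show ?thesis using assms that by auto
qed

text \<open>Scalings by fractions \<open>r / s\<close> are scalings by arbitrary nonzero field
  elements, as the whole field consists of fractions.\<close>

lemma proj_rel_iff:
  "(v, w) \<in> proj_rel R \<longleftrightarrow> v \<noteq> (0, 0) \<and> w \<noteq> (0, 0) \<and> (\<exists>k. k \<noteq> 0 \<and> w = scale_pair k v)"
proof -
  have "(\<exists>r\<in>R - {0}. \<exists>s\<in>R - {0}. scale_pair r v = scale_pair s w) \<longleftrightarrow> (\<exists>k. k \<noteq> 0 \<and> w = scale_pair k v)"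
  proof
    assume "\<exists>r\<in>R - {0}. \<exists>s\<in>R - {0}. scale_pair r v = scale_pair s w"
    then obtain r s where rs: "r \<in> R - {0}" "s \<in> R - {0}" "scale_pair r v = scale_pair s w" by blast
    have "scale_pair (inverse s) (scale_pair r v) = w"
      unfolding rs(3) using rs(2) by simp
    then show "\<exists>k. k \<noteq> 0 \<and> w = scale_pair k v"
      using rs(1,2) by (intro exI[of _ "inverse s * r"]) auto
  next
    assume "\<exists>k. k \<noteq> 0 \<and> w = scale_pair k v"
    then obtain k where k: "k \<noteq> 0" "w = scale_pair k v" by blast
    obtain r s where rs: "r \<in> R - {0}" "s \<in> R - {0}" "k = r / s" using fractionE[OF k(1)] .
    then have "scale_pair r v = scale_pair s w" using k by simp
    then show "\<exists>r\<in>R - {0}. \<exists>s\<in>R - {0}. scale_pair r v = scale_pair s w" using rs by blast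
  qed
  then show ?thesis
    by (cases v; cases w) (simp add: proj_rel_def punctured_plane_def fraction_field_UNIV scale_pair_def)
qed

lemma proj_rel_Image: "v \<noteq> (0, 0) \<Longrightarrow> proj_rel R `` {v} = point v"
  by (auto simp: proj_rel_iff point_def)

lemma proj_line_eq: "proj_line R = point ` {v. v \<noteq> (0, 0)}"
proof -
  have "punctured_plane R = {v. v \<noteq> (0, 0)}"
    by (auto simp: punctured_plane_def fraction_field_UNIV)
  then show ?thesis
    unfolding proj_line_def quotient_def by (auto simp: proj_rel_Image)
qed

lemma point_eq_iff: "point v = point w \<longleftrightarrow> (\<exists>k. k \<noteq> 0 \<and> w = scale_pair k v)"
proof
  assume "point v = point w"
  moreover have "w \<in> point w" unfolding point_def by (intro CollectI exI[of _ 1]) simp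
  ultimately show "\<exists>k. k \<noteq> 0 \<and> w = scale_pair k v" by (auto simp: point_def)
next
  assume "\<exists>k. k \<noteq> 0 \<and> w = scale_pair k v"
  then obtain k where k: "k \<noteq> 0" "w = scale_pair k v" by blast
  have "scale_pair l v = scale_pair (l / k) w" for l using k by simp
  moreover have "scale_pair l w = scale_pair (l * k) v" for l using k by simp
  ultimately show "point v = point w"
    using k(1) unfolding point_def
    by (intro equalityI subsetI; elim CollectE exE conjE; intro CollectI) (metis divide_eq_0_iff, metis mult_eq_0_iff)
qed

lemma SL2_transition: "(\<exists>A\<in>SL2 R. w = row_mult v A) \<longleftrightarrow> transition v w 1"
proof
  assume "\<exists>A\<in>SL2 R. w = row_mult v A"
  then obtain A where A: "A \<in> carrier_mat 2 2" "\<And>i j. i < 2 \<Longrightarrow> j < 2 \<Longrightarrow> A $$ (i, j) \<in> R" "det A = 1"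
    and w: "w = row_mult v A" unfolding SL2_def by blast
  show "transition v w 1"
    by (rule transitionI[of "A $$ (0, 0)" "A $$ (0, 1)" "A $$ (1, 0)" "A $$ (1, 1)"])
      (use A det_mat_2[OF A(1)] in \<open>simp_all add: w row_mult_def case_prod_unfold\<close>)
next
  assume "transition v w 1"
  then obtain a b c d where *: "a \<in> R" "b \<in> R" "c \<in> R" "d \<in> R" "fst w = a * fst v + c * snd v"
    "snd w = b * fst v + d * snd v" "1 = a * d - b * c" by (rule transitionE)
  let ?A = "mat 2 2 (\<lambda>(i, j). if i = 0 then (if j = 0 then a else b) else (if j = 0 then c else d))"
  have "?A \<in> SL2 R"
    using * det_mat_2[of ?A] by (auto simp: SL2_def)
  moreover have "w = row_mult v ?A"
    using * by (simp add: row_mult_def case_prod_unfold prod_eq_iff)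
  ultimately show "\<exists>A\<in>SL2 R. w = row_mult v A" by blast
qed

lemma row_mult_point: "(\<lambda>v. row_mult v A) ` point v = point (row_mult v A)"
proof -
  have "row_mult (scale_pair k v) A = scale_pair k (row_mult v A)" for k
    by (simp add: row_mult_def case_prod_unfold scale_pair_def algebra_simps)
  moreover have "(\<lambda>v. row_mult v A) ` point v = {row_mult (scale_pair k v) A | k. k \<noteq> 0}"
    unfolding point_def by blast
  ultimately show ?thesis by (simp add: point_def)
qed

section \<open>Pairs that represent the same cusp\<close>

definition cusp_equiv :: "'k \<times> 'k \<Rightarrow> 'k \<times> 'k \<Rightarrow> bool" where
  "cusp_equiv v w \<longleftrightarrow> (\<exists>k. k \<noteq> 0 \<and> transition (scale_pair k v) w 1)"

text \<open>The inverse of a matrix of determinant 1 is its adjugate, whose entries are again in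
  \<open>R\<close>.\<close>

lemma transition_inverse:
  assumes "transition v w 1"
  shows "transition w v 1"
  using assms
proof (rule transitionE)
  fix a b c d
  assume *: "a \<in> R" "b \<in> R" "c \<in> R" "d \<in> R" "fst w = a * fst v + c * snd v"
    "snd w = b * fst v + d * snd v" "1 = a * d - b * c"
  have "d * fst w - c * snd w = (a * d - b * c) * fst v" "a * snd w - b * fst w = (a * d - b * c) * snd v"
    using *(5,6) by (simp_all add: algebra_simps)
  then show ?thesis
    using *(1-4,7) uminus_mem
    by (intro transitionI[of d "- b" "- c" a]) (simp_all add: algebra_simps)
qed

lemma cusp_equiv_refl: "cusp_equiv v v"
  unfolding cusp_equiv_def by (intro exI[of _ 1]) (simp add: transition_refl)

lemma cusp_equiv_sym:
  assumes "cusp_equiv v w"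
  shows "cusp_equiv w v"
proof -
  obtain k where k: "k \<noteq> 0" "transition (scale_pair k v) w 1" using assms by (auto simp: cusp_equiv_def)
  have "transition (scale_pair (inverse k) w) (scale_pair (inverse k) (scale_pair k v)) 1"
    by (rule transition_scale[OF transition_inverse[OF k(2)]])
  then have "transition (scale_pair (inverse k) w) v 1" using k(1) by simp
  then show ?thesis using k(1) unfolding cusp_equiv_def by (intro exI[of _ "inverse k"]) simp
qed

lemma cusp_equiv_trans:
  assumes "cusp_equiv u v" "cusp_equiv v w"
  shows "cusp_equiv u w"
proof -
  obtain k where k: "k \<noteq> 0" "transition (scale_pair k u) v 1" using assms(1) by (auto simp: cusp_equiv_def)
  obtain l where l: "l \<noteq> 0" "transition (scale_pair l v) w 1" using assms(2) by (auto simp: cusp_equiv_def)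
  have "transition (scale_pair (l * k) u) w 1"
    using transition_trans[OF transition_scale[OF k(2), of l] l(2)] by simp
  then show ?thesis using k(1) l(1) unfolding cusp_equiv_def by (intro exI[of _ "l * k"]) simp
qed

text \<open>Matrices of determinant 1 preserve the span, so a cusp determines an ideal
  class.\<close>

lemma cusp_equiv_pair_span:
  assumes "cusp_equiv v w"
  obtains k where "k \<noteq> 0" "pair_span w = pair_span (scale_pair k v)" "transition (scale_pair k v) w 1"
proof -
  obtain k where k: "k \<noteq> 0" "transition (scale_pair k v) w 1" using assms by (auto simp: cusp_equiv_def)
  then have "pair_span w = pair_span (scale_pair k v)"
    using transition_pair_span[OF k(2)] transition_pair_span[OF transition_inverse[OF k(2)]] by blast
  then show ?thesis using that k by blast
qed

text \<open>Scalars commute with matrices, so all scalings can be collected in a single factor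
  \<open>k\<close>.\<close>

lemma cusp_rel_point_iff:
  assumes "v \<noteq> (0, 0)" "w \<noteq> (0, 0)"
  shows "(point v, point w) \<in> cusp_rel R \<longleftrightarrow> cusp_equiv v w"
proof -
  have "(\<exists>A\<in>SL2 R. point w = (\<lambda>v. row_mult v A) ` point v) \<longleftrightarrow> cusp_equiv v w"
  proof
    assume "\<exists>A\<in>SL2 R. point w = (\<lambda>v. row_mult v A) ` point v"
    then obtain A where A: "A \<in> SL2 R" "point (row_mult v A) = point w" by (auto simp: row_mult_point)
    then obtain k where k: "k \<noteq> 0" "w = scale_pair k (row_mult v A)" by (auto simp: point_eq_iff)
    have "transition v (row_mult v A) 1" using SL2_transition A(1) by blast
    from transition_scale[OF this, of k] show "cusp_equiv v w"
      using k by (auto simp: cusp_equiv_def)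
  next
    assume "cusp_equiv v w"
    then obtain k where k: "k \<noteq> 0" "transition (scale_pair k v) w 1" by (auto simp: cusp_equiv_def)
    then obtain A where A: "A \<in> SL2 R" "w = row_mult (scale_pair k v) A" using SL2_transition by blast
    have "point (scale_pair k v) = point v" using k(1) point_eq_iff by blast
    then have "point w = (\<lambda>v. row_mult v A) ` point v" using A(2) row_mult_point by metis
    then show "\<exists>A\<in>SL2 R. point w = (\<lambda>v. row_mult v A) ` point v" using A(1) by blast
  qed
  then show ?thesis using assms by (simp add: cusp_rel_def proj_line_eq)
qed

lemma equiv_cusp_rel: "equiv (proj_line R) (cusp_rel R)"
proof (rule equivI)
  show "cusp_rel R \<subseteq> proj_line R \<times> proj_line R" by (auto simp: cusp_rel_def)
  show "refl_on (proj_line R) (cusp_rel R)"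
  proof (rule refl_onI)
    fix p assume "p \<in> proj_line R"
    then obtain v where "v \<noteq> (0, 0)" "p = point v" by (auto simp: proj_line_eq)
    then show "(p, p) \<in> cusp_rel R" by (simp add: cusp_rel_point_iff cusp_equiv_refl)
  qed
  have ex: "\<exists>v. v \<noteq> (0, 0) \<and> p = point v" if "(p, q) \<in> cusp_rel R \<or> (q, p) \<in> cusp_rel R" for p q
    using that by (auto simp: cusp_rel_def proj_line_eq)
  show "sym (cusp_rel R)"
  proof (rule symI)
    fix p q assume pq: "(p, q) \<in> cusp_rel R"
    obtain v where v: "v \<noteq> (0, 0)" "p = point v" using ex pq by blast
    obtain w where w: "w \<noteq> (0, 0)" "q = point w" using ex pq by blast
    show "(q, p) \<in> cusp_rel R"
      using pq cusp_equiv_sym[of v w] by (simp add: v w cusp_rel_point_iff)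
  qed
  show "trans (cusp_rel R)"
  proof (rule transI)
    fix p q r assume pq: "(p, q) \<in> cusp_rel R" and qr: "(q, r) \<in> cusp_rel R"
    obtain v where v: "v \<noteq> (0, 0)" "p = point v" using ex pq by blast
    obtain w where w: "w \<noteq> (0, 0)" "q = point w" using ex pq by blast
    obtain u where u: "u \<noteq> (0, 0)" "r = point u" using ex qr by blast
    show "(p, r) \<in> cusp_rel R"
      using pq qr cusp_equiv_trans[of v w u] by (simp add: v w u cusp_rel_point_iff)
  qed
qed

definition cusp :: "'k \<times> 'k \<Rightarrow> ('k \<times> 'k) set set" where
  "cusp v = cusp_rel R `` {point v}"

lemma cusps_eq: "cusps R = cusp ` {v. v \<noteq> (0, 0)}"
  unfolding cusps_def quotient_def proj_line_eq by (auto simp: cusp_def)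

lemma cusp_eq_iff: "v \<noteq> (0, 0) \<Longrightarrow> w \<noteq> (0, 0) \<Longrightarrow> cusp v = cusp w \<longleftrightarrow> cusp_equiv v w"
  unfolding cusp_def
  by (subst eq_equiv_class_iff[OF equiv_cusp_rel]) (auto simp: proj_line_eq cusp_rel_point_iff)

section \<open>Ideal classes of modules with two generators\<close>

lemma common_multiple: "\<exists>d\<in>R - {0}. d * x \<in> R \<and> d * y \<in> R"
proof -
  have den: "\<exists>d\<in>R - {0}. d * x \<in> R" for x
  proof -
    have "x \<in> fraction_field R" using fraction_field_UNIV by simp
    then obtain r s where "r \<in> R" "s \<in> R - {0}" "x = r / s" by (auto simp: fraction_field_def)
    then show ?thesis by (intro bexI[of _ s]) auto
  qed
  obtain d where d: "d \<in> R - {0}" "d * x \<in> R" using den by blast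
  obtain e where e: "e \<in> R - {0}" "e * y \<in> R" using den by blast
  have "e * (d * x) \<in> R" "d * (e * y) \<in> R" using d e by auto
  then show ?thesis using d e by (intro bexI[of _ "d * e"]) (auto simp: mult_ac)
qed

lemma fractional_ideal_pair_span: "fractional_ideal R (pair_span v)"
proof -
  obtain d where d: "d \<in> R - {0}" "d * fst v \<in> R" "d * snd v \<in> R" using common_multiple by blast
  have "pair_span (scale_pair d v) \<subseteq> R"
    using d by (intro pair_span_subset is_submodule_self) auto
  then show ?thesis
    using d(1) by (auto simp: fractional_ideal_def fraction_field_UNIV is_submodule_pair_span pair_span_scale)
qed

lemma same_ideal_class_iff:
  "(I, J) \<in> same_ideal_class R \<longleftrightarrow>
    fractional_ideal R I \<and> fractional_ideal R J \<and> (\<exists>k. k \<noteq> 0 \<and> J = (*) k ` I)"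
proof -
  have "(\<exists>r\<in>R - {0}. \<exists>s\<in>R - {0}. (*) r ` I = (*) s ` J) \<longleftrightarrow> (\<exists>k. k \<noteq> 0 \<and> J = (*) k ` I)"
  proof
    assume "\<exists>r\<in>R - {0}. \<exists>s\<in>R - {0}. (*) r ` I = (*) s ` J"
    then obtain r s where rs: "r \<in> R - {0}" "s \<in> R - {0}" "(*) r ` I = (*) s ` J" by blast
    have "J = (*) (inverse s) ` (*) s ` J" using rs(2) by (simp add: image_image mult.assoc[symmetric])
    then have "J = (*) (inverse s * r) ` I" by (simp add: rs(3)[symmetric] image_image mult.assoc)
    then show "\<exists>k. k \<noteq> 0 \<and> J = (*) k ` I" using rs(1,2) by (intro exI[of _ "inverse s * r"]) simp
  next
    assume "\<exists>k. k \<noteq> 0 \<and> J = (*) k ` I"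
    then obtain k where k: "k \<noteq> 0" "J = (*) k ` I" by blast
    obtain r s where rs: "r \<in> R - {0}" "s \<in> R - {0}" "k = r / s" using fractionE[OF k(1)] .
    have "(*) r ` I = (*) s ` J" using rs by (simp add: k(2) image_image)
    then show "\<exists>r\<in>R - {0}. \<exists>s\<in>R - {0}. (*) r ` I = (*) s ` J" using rs by blast
  qed
  then show ?thesis by (simp add: same_ideal_class_def)
qed

lemma equiv_same_ideal_class: "equiv {I. fractional_ideal R I} (same_ideal_class R)"
proof (rule equivI)
  show "same_ideal_class R \<subseteq> {I. fractional_ideal R I} \<times> {I. fractional_ideal R I}"
    by (auto simp: same_ideal_class_iff)
  show "refl_on {I. fractional_ideal R I} (same_ideal_class R)"
    by (rule refl_onI) (auto simp: same_ideal_class_iff intro!: exI[of _ 1])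
  show "sym (same_ideal_class R)"
  proof (rule symI)
    fix I J assume IJ: "(I, J) \<in> same_ideal_class R"
    then obtain k where k: "k \<noteq> 0" "J = (*) k ` I" by (auto simp: same_ideal_class_iff)
    then have "I = (*) (inverse k) ` J" by (simp add: image_image mult.assoc[symmetric])
    then show "(J, I) \<in> same_ideal_class R"
      using IJ k(1) nonzero_imp_inverse_nonzero[OF k(1)] unfolding same_ideal_class_iff by blast
  qed
  show "trans (same_ideal_class R)"
  proof (rule transI)
    fix I J L assume IJ: "(I, J) \<in> same_ideal_class R" "(J, L) \<in> same_ideal_class R"
    then obtain k l where k: "k \<noteq> 0" "J = (*) k ` I" "l \<noteq> 0" "L = (*) l ` J"
      by (auto simp: same_ideal_class_iff)
    then have "L = (*) (l * k) ` I" "l * k \<noteq> 0" by (simp_all add: image_image mult.assoc)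
    then show "(I, L) \<in> same_ideal_class R" using IJ unfolding same_ideal_class_iff by blast
  qed
qed

definition ideal_class :: "'k \<times> 'k \<Rightarrow> 'k set set" where
  "ideal_class v = same_ideal_class R `` {pair_span v}"

lemma ideal_class_eq_iff:
  "ideal_class v = ideal_class w \<longleftrightarrow> (\<exists>k. k \<noteq> 0 \<and> pair_span w = pair_span (scale_pair k v))"
  unfolding ideal_class_def
  by (subst eq_equiv_class_iff[OF equiv_same_ideal_class])
    (simp_all add: fractional_ideal_pair_span same_ideal_class_iff pair_span_scale)

lemma mem_ideal_class: "I \<in> ideal_class v \<longleftrightarrow> (\<exists>k. k \<noteq> 0 \<and> I = pair_span (scale_pair k v))"
  unfolding ideal_class_def
  using fractional_ideal_pair_span[of v] fractional_ideal_pair_span[of "scale_pair _ v"]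
  by (auto simp: same_ideal_class_iff pair_span_scale)

text \<open>A pair may have equal or zero entries, so it also accounts for one generator and for
  none. The infimum is attained because \<open>enat\<close> is well-ordered and the value
  \<open>\<infinity>\<close> of an empty infimum is excluded.\<close>

lemma min_generators_le_2_iff: "min_generators R I \<le> 2 \<longleftrightarrow> (\<exists>v. I = pair_span v)"
proof
  let ?G = "{S. finite S \<and> generated R (*) S = I}"
  assume le: "min_generators R I \<le> 2"
  have "min_generators R I \<noteq> \<infinity>"
  proof
    assume "min_generators R I = \<infinity>"
    with le show False by (simp add: numeral_eq_enat)
  qed
  then have "(\<lambda>S. enat (card S)) ` ?G \<noteq> {}"
    unfolding min_generators_def Inf_enat_def by metis
  then have "min_generators R I \<in> (\<lambda>S. enat (card S)) ` ?G"
    unfolding min_generators_def Inf_enat_def using LeastI_ex[of "\<lambda>x. x \<in> (\<lambda>S. enat (card S)) ` ?G"]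
    by (simp only: if_False) blast
  then obtain S where S: "finite S" "generated R (*) S = I" "min_generators R I = enat (card S)" by blast
  then have card: "card S \<le> 2" using le by (simp add: numeral_eq_enat)
  have empty: "generated R (*) {} = {0}"
    using generated_minimal[of "{}" "{0}" R "(*)"] submodule_zero[OF is_submodule_generated]
    by (auto simp: is_submodule_def)
  consider "S = {}" | x y where "S = {x, y}"
  proof -
    assume *: "S = {} \<Longrightarrow> thesis" "\<And>x y. S = {x, y} \<Longrightarrow> thesis"
    consider "card S = 0" | "card S = 1" | "card S = 2" using card by linarith
    then show thesis
    proof cases
      case 1 then show thesis using S(1) * by simp
    next
      case 2 then obtain x where "S = {x}" using card_1_singletonE by blast
      then show thesis using *(2)[of x x] by simp
    next
      case 3 then show thesis using * by (auto simp: card_2_iff)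
    qed
  qed
  then show "\<exists>v. I = pair_span v"
  proof cases
    case 1
    have "pair_span (0, 0) = {0}" by (simp add: pair_span_eq_0_iff)
    then show ?thesis using 1 S(2) empty by metis
  next
    case 2 then show ?thesis using S(2) by (intro exI[of _ "(x, y)"]) (simp add: pair_span_def)
  qed
next
  assume "\<exists>v. I = pair_span v"
  then obtain v where v: "I = pair_span v" by blast
  have "min_generators R I \<le> enat (card {fst v, snd v})"
    unfolding min_generators_def by (rule INF_lower) (simp add: v pair_span_def)
  also have "\<dots> \<le> 2" by (simp add: numeral_eq_enat card_insert_if)
  finally show "min_generators R I \<le> 2" .
qed

text \<open>A member with at most two generators is the span of a pair, and any member determines
  its class.\<close>

lemma small_ideal_classes_eq:
  "{C \<in> ideal_classes R. \<exists>I\<in>C. I \<noteq> {0} \<and> min_generators R I \<le> 2} = ideal_class ` {v. v \<noteq> (0, 0)}"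
proof (intro equalityI subsetI)
  fix C assume "C \<in> {C \<in> ideal_classes R. \<exists>I\<in>C. I \<noteq> {0} \<and> min_generators R I \<le> 2}"
  then obtain v where C: "C \<in> ideal_classes R" "pair_span v \<in> C" "pair_span v \<noteq> {0}"
    by (auto simp: min_generators_le_2_iff)
  have "C = ideal_class v"
    using C(1,2) quotientI[of "pair_span v" "{I. fractional_ideal R I}" "same_ideal_class R"]
      quotient_eqI[OF equiv_same_ideal_class] equiv_class_self[OF equiv_same_ideal_class]
    unfolding ideal_classes_def ideal_class_def
    by (metis (no_types, lifting) Image_singleton_iff equiv_class_eq equiv_same_ideal_class quotientE)
  then show "C \<in> ideal_class ` {v. v \<noteq> (0, 0)}" using C(3) pair_span_eq_0_iff by blast
next
  fix C assume "C \<in> ideal_class ` {v. v \<noteq> (0, 0)}"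
  then obtain v where v: "v \<noteq> (0, 0)" "C = ideal_class v" by blast
  have "C \<in> ideal_classes R"
    unfolding v(2) ideal_classes_def ideal_class_def
    by (rule quotientI) (simp add: fractional_ideal_pair_span)
  moreover have "pair_span v \<in> C" unfolding v(2) mem_ideal_class by (intro exI[of _ 1]) simp
  ultimately show "C \<in> {C \<in> ideal_classes R. \<exists>I\<in>C. I \<noteq> {0} \<and> min_generators R I \<le> 2}"
    using v(1) pair_span_eq_0_iff[of v] min_generators_le_2_iff[of "pair_span v"] by blast
qed

section \<open>The fibres over the ideal classes\<close>

lemma Fit_nonzero:
  assumes "v \<noteq> (0, 0)"
  shows "\<exists>c\<in>Fit v. c \<noteq> 0"
proof -
  obtain d where d: "d \<in> R - {0}" "d * fst v \<in> R" "d * snd v \<in> R" using common_multiple by blast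
  then have "d \<in> conductor (fst v) (snd v)" "0 \<in> conductor (fst v) (snd v)"
    by (auto simp: conductor_def)
  then have "d * fst v \<in> Fit v" "d * snd v \<in> Fit v"
    using trace_idealI[of d "fst v" "snd v" 0] trace_idealI[of 0 "fst v" "snd v" d] by (simp_all add: Fit_def)
  moreover have "d * fst v \<noteq> 0 \<or> d * snd v \<noteq> 0" using assms d(1) by (cases v) auto
  ultimately show ?thesis by blast
qed

text \<open>\<open>Fit v\<close> contains a nonzero \<open>c\<close>, so \<open>R / Fit v\<close> is
  a quotient of the finite ring \<open>R / c R\<close>.\<close>

lemma finite_units_mod_Fit:
  assumes "v \<noteq> (0, 0)"
  shows "finite (carrier (units_mod (Fit v)))"
proof -
  note F = is_submodule_Fit[of v] Fit_subset[of v]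
  obtain c where c: "c \<in> Fit v" "c \<noteq> 0" using Fit_nonzero[OF assms] by blast
  then obtain T where T: "finite T" "\<forall>x\<in>R. \<exists>t\<in>T. \<exists>y\<in>R. x - t = c * y"
    using finite_residues[of c] F(2) by blast
  have "carrier (units_mod (Fit v)) \<subseteq> coset (Fit v) ` T"
  proof
    fix C assume "C \<in> carrier (units_mod (Fit v))"
    then obtain a where a: "C = coset (Fit v) a" "a \<in> R" by (auto simp: carrier_units_mod_Fit)
    then obtain t y where t: "t \<in> T" "y \<in> R" "a - t = c * y" using T(2) by blast
    have "y * c \<in> Fit v" by (rule submodule_scale[OF F(1) t(2) c(1)])
    then have "a - t \<in> Fit v" using t(3) by (simp add: mult.commute)
    then show "C \<in> coset (Fit v) ` T" using a t(1) coset_Fit_eq_iff by blast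
  qed
  then show ?thesis using T(1) finite_subset by blast
qed

text \<open>Determinants multiply: a transition for \<open>k\<close>, scaled by \<open>u\<close>,
  continues the one for \<open>u\<close> to a transition for \<open>u * k\<close>.\<close>

lemma subgroup_eps:
  assumes v: "v \<noteq> (0, 0)"
  shows "subgroup (eps R (pair_span v)) (units_mod (Fit v))"
proof -
  note F = is_submodule_Fit[of v] Fit_subset[of v]
  note eps = eps_pair_span[OF fraction_field_UNIV v]
  interpret comm_group "units_mod (Fit v)" by (rule comm_group_units_mod[OF F])
  have carrier: "coset (Fit v) \<delta> \<in> carrier (units_mod (Fit v))"
    if "(*) u ` pair_span v = pair_span v" "transition v (scale_pair u v) \<delta>" for u \<delta>
    using that by (intro coset_transition_mem_units[OF v]) (auto simp: pair_span_scale)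
  show ?thesis
  proof (rule subgroupI)
    show "eps R (pair_span v) \<subseteq> carrier (units_mod (Fit v))"
      unfolding eps using carrier by blast
    have "transition v (scale_pair 1 v) 1" by (simp add: transition_refl)
    then show "eps R (pair_span v) \<noteq> {}"
      unfolding eps by (auto intro!: exI[of _ 1])
    fix x assume "x \<in> eps R (pair_span v)"
    then obtain u \<delta> where u: "u \<noteq> 0" "(*) u ` pair_span v = pair_span v" "transition v (scale_pair u v) \<delta>"
      and x: "x = coset (Fit v) \<delta>" unfolding eps by blast
    have u': "(*) (inverse u) ` pair_span v = pair_span v"
    proof -
      have "(*) (inverse u) ` (*) u ` pair_span v = pair_span v"
        using u(1) by (simp add: image_image mult.assoc[symmetric])
      then show ?thesis by (simp only: u(2))
    qed
    then obtain \<epsilon> where \<epsilon>: "transition v (scale_pair (inverse u) v) \<epsilon>"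
      using transition_exists[of "scale_pair (inverse u) v" v] by (auto simp: pair_span_scale)
    have "transition v v (\<epsilon> * \<delta>)"
      using transition_trans[OF \<epsilon> transition_scale[OF u(3), of "inverse u"]] u(1) by simp
    then have "\<epsilon> * \<delta> - 1 \<in> Fit v" by (rule transition_self[OF v])
    then have "coset (Fit v) \<epsilon> \<otimes>\<^bsub>units_mod (Fit v)\<^esub> x = \<one>\<^bsub>units_mod (Fit v)\<^esub>"
      using transition_mem[OF \<epsilon>] transition_mem[OF u(3)]
      by (simp add: x mult_units_mod[OF F] one_units_mod[OF F] coset_Fit_eq_iff)
    then have "inv\<^bsub>units_mod (Fit v)\<^esub> x = coset (Fit v) \<epsilon>"
      by (intro inv_equality) (use carrier[OF u(2,3)] carrier[OF u' \<epsilon>] x in auto)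
    then show "inv\<^bsub>units_mod (Fit v)\<^esub> x \<in> eps R (pair_span v)"
      unfolding eps using u' \<epsilon> u(1) by (intro CollectI exI[of _ "inverse u"] exI[of _ \<epsilon>]) simp
    fix y assume "y \<in> eps R (pair_span v)"
    then obtain k \<eta> where k: "k \<noteq> 0" "(*) k ` pair_span v = pair_span v" "transition v (scale_pair k v) \<eta>"
      and y: "y = coset (Fit v) \<eta>" unfolding eps by blast
    have "x \<otimes>\<^bsub>units_mod (Fit v)\<^esub> y = coset (Fit v) (\<delta> * \<eta>)"
      using transition_mem[OF u(3)] transition_mem[OF k(3)] by (simp add: x y mult_units_mod[OF F])
    moreover have "transition v (scale_pair (u * k) v) (\<delta> * \<eta>)"
      using transition_trans[OF u(3) transition_scale[OF k(3), of u]] by simp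
    moreover have "(*) (u * k) ` pair_span v = pair_span v"
      using u(2) k(2) by (metis (no_types) image_image mult.assoc image_cong)
    ultimately show "x \<otimes>\<^bsub>units_mod (Fit v)\<^esub> y \<in> eps R (pair_span v)"
      unfolding eps using u(1) k(1) by (intro CollectI exI[of _ "u * k"] exI[of _ "\<delta> * \<eta>"]) simp
  qed
qed

text \<open>Lets cusps be counted by cosets through a common parametrisation by pairs.\<close>

lemma card_image_eq_of_same_kernel:
  assumes "\<And>x y. x \<in> A \<Longrightarrow> y \<in> A \<Longrightarrow> f x = f y \<longleftrightarrow> g x = g y"
  shows "card (f ` A) = card (g ` A)" "finite (f ` A) \<longleftrightarrow> finite (g ` A)"
proof -
  define h where "h = (\<lambda>c. g (SOME x. x \<in> A \<and> f x = c))"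
  have h: "h (f x) = g x" if "x \<in> A" for x
  proof -
    have "(SOME y. y \<in> A \<and> f y = f x) \<in> A \<and> f (SOME y. y \<in> A \<and> f y = f x) = f x"
      by (rule someI[of _ x]) (use that in simp)
    then show ?thesis unfolding h_def using assms that by blast
  qed
  have "bij_betw h (f ` A) (g ` A)"
    unfolding bij_betw_def
  proof
    show "inj_on h (f ` A)" using assms by (auto simp: inj_on_def h)
    show "h ` f ` A = g ` A" unfolding image_image using h by (rule image_cong[OF refl])
  qed
  then show "card (f ` A) = card (g ` A)" "finite (f ` A) \<longleftrightarrow> finite (g ` A)"
    by (rule bij_betw_same_card, rule bij_betw_finite)
qed

text \<open>Scaling \<open>w\<close> by a unit \<open>k\<close> of the multiplier ring multiplies
  its determinant by that of \<open>k\<close>. If the cosets agree, some such \<open>k\<close> makes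
  the determinants of \<open>k w\<close> and \<open>w'\<close> congruent; the transition between
  these pairs is then 1 modulo the Fitting ideal and can be adjusted to determinant 1.\<close>

lemma cusp_equiv_iff_rcoset:
  assumes u: "u \<noteq> (0, 0)" and w: "pair_span w = pair_span u" "pair_span w' = pair_span u"
    and a: "transition u w a" "transition u w' a'"
  shows "cusp_equiv w w' \<longleftrightarrow>
    eps R (pair_span u) #>\<^bsub>units_mod (Fit u)\<^esub> coset (Fit u) a =
    eps R (pair_span u) #>\<^bsub>units_mod (Fit u)\<^esub> coset (Fit u) a'"
proof -
  note F = is_submodule_Fit[of u] Fit_subset[of u]
  note eps = eps_pair_span[OF fraction_field_UNIV u]
  interpret comm_group "units_mod (Fit u)" by (rule comm_group_units_mod[OF F])
  have carrier: "coset (Fit u) a \<in> carrier (units_mod (Fit u))" "coset (Fit u) a' \<in> carrier (units_mod (Fit u))"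
    using coset_transition_mem_units[OF u w(1)[symmetric] a(1)]
      coset_transition_mem_units[OF u w(2)[symmetric] a(2)] .
  have R: "a \<in> R" "a' \<in> R" using a transition_mem by auto
  show ?thesis
  proof
    assume "cusp_equiv w w'"
    then obtain k where k: "k \<noteq> 0" "pair_span w' = pair_span (scale_pair k w)" "transition (scale_pair k w) w' 1"
      by (rule cusp_equiv_pair_span)
    have ku: "(*) k ` pair_span u = pair_span u" using k(2) w by (simp add: pair_span_scale)
    then obtain \<delta> where \<delta>: "transition u (scale_pair k u) \<delta>"
      using transition_exists[of "scale_pair k u" u] by (auto simp: pair_span_scale)
    have "transition u w' (\<delta> * a * 1)"
      by (rule transition_trans[OF transition_trans[OF \<delta> transition_scale[OF a(1)]] k(3)])
    then have "a' - \<delta> * a \<in> Fit u" using transition_unique[OF u w(2)[symmetric] a(2)] by simp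
    then have "coset (Fit u) a' = coset (Fit u) \<delta> \<otimes>\<^bsub>units_mod (Fit u)\<^esub> coset (Fit u) a"
      using R transition_mem[OF \<delta>] by (simp add: mult_units_mod[OF F] coset_Fit_eq_iff)
    moreover have "coset (Fit u) \<delta> \<in> eps R (pair_span u)" unfolding eps using k(1) ku \<delta> by blast
    ultimately have "coset (Fit u) a' \<in> eps R (pair_span u) #>\<^bsub>units_mod (Fit u)\<^esub> coset (Fit u) a"
      by (auto simp: r_coset_def)
    then show "eps R (pair_span u) #>\<^bsub>units_mod (Fit u)\<^esub> coset (Fit u) a =
        eps R (pair_span u) #>\<^bsub>units_mod (Fit u)\<^esub> coset (Fit u) a'"
      by (rule repr_independence[OF _ carrier(1) subgroup_eps[OF u]])
  next
    assume "eps R (pair_span u) #>\<^bsub>units_mod (Fit u)\<^esub> coset (Fit u) a =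
        eps R (pair_span u) #>\<^bsub>units_mod (Fit u)\<^esub> coset (Fit u) a'"
    then have "coset (Fit u) a' \<in> eps R (pair_span u) #>\<^bsub>units_mod (Fit u)\<^esub> coset (Fit u) a"
      using rcos_self[OF carrier(2) subgroup_eps[OF u]] by simp
    then obtain c where c: "c \<in> eps R (pair_span u)" "coset (Fit u) a' = c \<otimes>\<^bsub>units_mod (Fit u)\<^esub> coset (Fit u) a"
      by (auto simp: r_coset_def)
    then obtain k \<delta> where k: "k \<noteq> 0" "(*) k ` pair_span u = pair_span u" "transition u (scale_pair k u) \<delta>"
      and "c = coset (Fit u) \<delta>" unfolding eps by blast
    then have a': "a' - \<delta> * a \<in> Fit u"
      using c(2) R transition_mem[OF k(3)] by (simp add: mult_units_mod[OF F] coset_Fit_eq_iff)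
    let ?v = "scale_pair k w"
    have v: "pair_span ?v = pair_span u" using k(2) w(1) by (simp add: pair_span_scale)
    have v0: "?v \<noteq> (0, 0)" using v pair_span_eq_0_iff u by metis
    have uv: "transition u ?v (\<delta> * a)" by (rule transition_trans[OF k(3) transition_scale[OF a(1)]])
    obtain \<eta> where \<eta>: "transition ?v w' \<eta>" using transition_exists v w(2) by blast
    obtain \<epsilon> where \<epsilon>: "transition ?v u \<epsilon>" using transition_exists v by blast
    have "\<delta> * a * \<eta> - a' \<in> Fit u"
      by (rule transition_unique[OF u w(2)[symmetric] transition_trans[OF uv \<eta>] a(2)])
    from submodule_add[OF F(1) this a'] have "\<delta> * a * (\<eta> - 1) \<in> Fit u" by (simp add: algebra_simps)
    \<comment> \<open>The unit \<open>\<delta> * a\<close>, with inverse \<open>\<epsilon>\<close>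
      modulo \<open>Fit u\<close>, is cancelled.\<close>
    then have "\<epsilon> * (\<delta> * a * (\<eta> - 1)) - (\<eta> - 1) * (\<delta> * a * \<epsilon> - 1) \<in> Fit u"
      using transition_unit[OF u uv \<epsilon>] transition_mem[OF \<eta>] transition_mem[OF \<epsilon>]
      by (intro submodule_diff[OF F(1) submodule_scale[OF F(1)] submodule_scale[OF F(1)]]) auto
    then have "\<eta> - 1 \<in> Fit u" by (simp add: algebra_simps)
    then have "1 - \<eta> \<in> Fit ?v"
      using submodule_uminus[OF F(1), of "\<eta> - 1"] Fit_cong[OF v0 v] by simp
    then have "transition ?v w' 1"
      by (intro transition_adjust[OF v0 _ \<eta>]) (simp_all add: v w(2))
    then show "cusp_equiv w w'" using k(1) by (auto simp: cusp_equiv_def)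
  qed
qed

text \<open>By \<open>cusp_equiv_iff_rcoset\<close> the cosets of \<open>eps\<close> separate the
  cusps of a fixed module, and by \<open>transition_surj\<close> every coset is attained.\<close>

lemma card_fibre:
  assumes u: "u \<noteq> (0, 0)"
  shows "finite (cusp ` {w. pair_span w = pair_span u})"
    and "card (cusp ` {w. pair_span w = pair_span u}) =
      group_index (fitting_units R (pair_span u)) (eps R (pair_span u))"
proof -
  let ?X = "{w. pair_span w = pair_span u}"
  let ?G = "units_mod (Fit u)"
  note F = is_submodule_Fit[of u] Fit_subset[of u]
  \<comment> \<open>Any determinant may be chosen, as two of them are congruent modulo
    \<open>Fit u\<close>.\<close>
  define \<delta> where "\<delta> = (\<lambda>w. SOME \<delta>. transition u w \<delta>)"
  have \<delta>: "transition u w (\<delta> w)" if "w \<in> ?X" for w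
    using transition_exists[of w u] that unfolding \<delta>_def by (auto intro: someI_ex)
  define g where "g = (\<lambda>w. eps R (pair_span u) #>\<^bsub>?G\<^esub> coset (Fit u) (\<delta> w))"
  have nz: "w \<noteq> (0, 0)" if "w \<in> ?X" for w
    using that u pair_span_eq_0_iff[of w] pair_span_eq_0_iff[of u] by auto
  have ker: "cusp w = cusp w' \<longleftrightarrow> g w = g w'" if "w \<in> ?X" "w' \<in> ?X" for w w'
    using cusp_equiv_iff_rcoset[OF u _ _ \<delta>[OF that(1)] \<delta>[OF that(2)]] that
    by (simp add: cusp_eq_iff nz g_def)
  have "g ` ?X = rcosets\<^bsub>?G\<^esub> (eps R (pair_span u))"
  proof (intro equalityI subsetI)
    fix c assume "c \<in> g ` ?X"
    then obtain w where w: "w \<in> ?X" "c = g w" by blast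
    then have "coset (Fit u) (\<delta> w) \<in> carrier ?G"
      using coset_transition_mem_units[OF u _ \<delta>[OF w(1)]] by simp
    then show "c \<in> rcosets\<^bsub>?G\<^esub> (eps R (pair_span u))"
      unfolding w(2) g_def RCOSETS_def by blast
  next
    fix c assume "c \<in> rcosets\<^bsub>?G\<^esub> (eps R (pair_span u))"
    then obtain x where x: "x \<in> carrier ?G" "c = eps R (pair_span u) #>\<^bsub>?G\<^esub> x"
      by (auto simp: RCOSETS_def)
    then obtain a b where a: "x = coset (Fit u) a" "a \<in> R" "b \<in> R" "a * b - 1 \<in> Fit u"
      by (auto simp: carrier_units_mod_Fit)
    obtain w where w: "pair_span w = pair_span u" "transition u w a"
      using transition_surj[OF u a(2-4)] by blast
    then have "\<delta> w - a \<in> Fit u" using transition_unique[OF u w(1)[symmetric] \<delta> w(2)] by simp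
    then have "c = g w" by (simp add: g_def x(2) a(1)) (metis coset_Fit_eq_iff)
    then show "c \<in> g ` ?X" using w(1) by blast
  qed
  moreover have "rcosets\<^bsub>?G\<^esub> (eps R (pair_span u)) \<subseteq> Pow (carrier ?G)"
  proof -
    interpret comm_group ?G by (rule comm_group_units_mod[OF F])
    show ?thesis
      using r_coset_subset_G[OF subgroup.subset[OF subgroup_eps[OF u]]] by (auto simp: RCOSETS_def)
  qed
  ultimately have "finite (g ` ?X)" "card (g ` ?X) = group_index (fitting_units R (pair_span u)) (eps R (pair_span u))"
    using finite_subset finite_units_mod_Fit[OF u]
    by (auto simp: group_index_def fitting_units_pair_span[OF u] intro: finite_subset)
  then show "finite (cusp ` ?X)"
    "card (cusp ` ?X) = group_index (fitting_units R (pair_span u)) (eps R (pair_span u))"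
    using card_image_eq_of_same_kernel[of ?X cusp g, OF ker] by simp_all
qed

text \<open>The cusps are partitioned by the ideal class of a representing pair. The fibre over
  \<open>C\<close> is counted with the very member of \<open>C\<close> that \<open>SOME\<close>
  selects, which is the span of a scaled pair.\<close>

theorem card_cusps:
  assumes "finite (ideal_class ` {v. v \<noteq> (0, 0)})"
  shows "finite (cusps R) \<and>
    card (cusps R) =
      (\<Sum>C \<in> {C \<in> ideal_classes R. \<exists>I\<in>C. I \<noteq> {0} \<and> min_generators R I \<le> 2}.
         let I = (SOME I. I \<in> C) in group_index (fitting_units R I) (eps R I))"
proof -
  let ?Cl = "ideal_class ` {v. v \<noteq> (0, 0)}"
  define fib where "fib = (\<lambda>C. cusp ` {w. w \<noteq> (0, 0) \<and> ideal_class w = C})"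
  have union: "cusps R = (\<Union>C\<in>?Cl. fib C)"
    unfolding cusps_eq fib_def by blast
  have fib: "finite (fib C) \<and> card (fib C) = (let I = (SOME I. I \<in> C) in group_index (fitting_units R I) (eps R I))"
    if C: "C \<in> ?Cl" for C
  proof -
    obtain v where v: "v \<noteq> (0, 0)" "C = ideal_class v" using C by blast
    have "pair_span v \<in> C" unfolding v(2) mem_ideal_class by (intro exI[of _ 1]) simp
    then have "(SOME I. I \<in> C) \<in> C" by (rule someI)
    then obtain k where k: "k \<noteq> 0" "(SOME I. I \<in> C) = pair_span (scale_pair k v)"
      unfolding v(2) mem_ideal_class by blast
    let ?u = "scale_pair k v"
    have u: "?u \<noteq> (0, 0)" using k(1) v(1) by simp
    have Cu: "C = ideal_class ?u" unfolding v(2) ideal_class_eq_iff using k(1) by blast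
    have "fib C = cusp ` {w. pair_span w = pair_span ?u}"
    proof (intro equalityI subsetI)
      fix c assume "c \<in> fib C"
      then obtain w where w: "w \<noteq> (0, 0)" "ideal_class w = ideal_class ?u" "c = cusp w"
        unfolding fib_def Cu by blast
      then obtain l where l: "l \<noteq> 0" "pair_span ?u = pair_span (scale_pair l w)"
        unfolding ideal_class_eq_iff by blast
      \<comment> \<open>Rescaling a pair leaves its cusp unchanged, so each cusp over
        \<open>C\<close> has a representative that spans exactly the selected ideal.\<close>
      have "cusp_equiv w (scale_pair l w)"
        unfolding cusp_equiv_def using l(1) transition_refl by blast
      then have "c = cusp (scale_pair l w)" using w l(1) by (simp add: cusp_eq_iff)
      then show "c \<in> cusp ` {w. pair_span w = pair_span ?u}" using l(2) by blast
    next
      fix c assume "c \<in> cusp ` {w. pair_span w = pair_span ?u}"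
      then obtain w where w: "pair_span w = pair_span ?u" "c = cusp w" by blast
      have "w \<noteq> (0, 0)" using w(1) u pair_span_eq_0_iff by metis
      moreover have "ideal_class w = C" unfolding Cu ideal_class_def w(1) ..
      ultimately show "c \<in> fib C" unfolding fib_def w(2) by blast
    qed
    then show ?thesis using card_fibre[OF u] k(2) by (simp add: Let_def)
  qed
  have disj: "fib C \<inter> fib D = {}" if "C \<noteq> D" for C D
  proof (rule ccontr)
    assume "fib C \<inter> fib D \<noteq> {}"
    then obtain v w where vw: "v \<noteq> (0, 0)" "ideal_class v = C" "w \<noteq> (0, 0)" "ideal_class w = D" "cusp v = cusp w"
      unfolding fib_def by blast
    then have "cusp_equiv v w" by (simp add: cusp_eq_iff)
    then have "ideal_class v = ideal_class w"
      by (rule cusp_equiv_pair_span) (auto simp: ideal_class_eq_iff)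
    then show False using vw that by simp
  qed
  have "finite (cusps R)" unfolding union using assms fib by blast
  moreover have "card (cusps R) = (\<Sum>C\<in>?Cl. card (fib C))"
    unfolding union by (rule card_UN_disjoint) (use assms fib disj in auto)
  ultimately show ?thesis
    unfolding small_ideal_classes_eq using fib by simp
qed

end

theorem corollary1p3:
  fixes R :: "'k::field_char_0 set"
  assumes "order_in_number_field R"
  shows "finite (cusps R) \<and>
    card (cusps R) =
      (\<Sum>C \<in> {C \<in> ideal_classes R. \<exists>I\<in>C. I \<noteq> {0} \<and> min_generators R I \<le> 2}.
         let I = (SOME I. I \<in> C) in group_index (fitting_units R I) (eps R I))"
proof -
  obtain n b co where "coordinate_order R n b co" using order_coordinates[OF assms] .
  then interpret coordinate_order R n b co .
  interpret residually_finite_subring R by (rule residually_finite)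
  obtain \<J> where \<J>: "finite \<J>"
    "\<And>I d. is_submodule R (*) I \<Longrightarrow> I \<noteq> {0} \<Longrightarrow> d \<noteq> 0 \<Longrightarrow> (*) d ` I \<subseteq> R \<Longrightarrow> \<exists>k. k \<noteq> 0 \<and> (*) k ` I \<in> \<J>"
    using finite_ideal_classes by blast
  \<comment> \<open>Each of these classes contains one of the finitely many scaled ideals in
    \<open>\<J>\<close>.\<close>
  have "ideal_class ` {v. v \<noteq> (0, 0)} \<subseteq> (\<lambda>J. same_ideal_class R `` {J}) ` \<J>"
  proof
    fix C assume "C \<in> ideal_class ` {v. v \<noteq> (0, 0)}"
    then obtain v where v: "v \<noteq> (0, 0)" and C: "C = ideal_class v" by blast
    let ?I = "pair_span v"
    obtain d where d: "d \<in> R - {0}" "(*) d ` ?I \<subseteq> R"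
      using fractional_ideal_pair_span[of v] unfolding fractional_ideal_def by blast
    have "?I \<noteq> {0}" using v pair_span_eq_0_iff by blast
    moreover have "d \<noteq> 0" using d(1) by simp
    ultimately obtain k where k: "k \<noteq> 0" "(*) k ` ?I \<in> \<J>"
      using \<J>(2)[OF is_submodule_pair_span _ _ d(2)] by blast
    have "C = ideal_class (scale_pair k v)"
      unfolding C ideal_class_eq_iff using k(1) by blast
    also have "\<dots> = same_ideal_class R `` {(*) k ` ?I}"
      by (simp add: ideal_class_def pair_span_scale)
    finally show "C \<in> (\<lambda>J. same_ideal_class R `` {J}) ` \<J>" using k(2) by blast
  qed
  then have "finite (ideal_class ` {v. v \<noteq> (0, 0)})" using \<J>(1) finite_subset by blast
  then show ?thesis by (rule card_cusps)
qed

end
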